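(* Let $k$ be an algebraically closed field with $\operatorname{char}(k)\nmid(d+1)!$, $V$ an $n$-dimensional $k$-vector space, $S=\operatorname{Sym}V$, and consider the gradient morphism $\nabla\colon\mathbb{P}(S_{d+1})^{c}\to\operatorname{Grass}(n,S_d)$, $\bar f\mapsto\langle\nabla f\rangle$. (A) Suppose $f\in S_{d+1}$ is concise. Then the following are equivalent: (1) $f$ is either a direct sum or an LDS form; (2) $\nabla$ is not injective at $\bar f$, i.e. there exists $\bar g\neq\bar f$ in $\mathbb{P}(S_{d+1})^c$ with $\nabla f=\nabla g$; (3) $\nabla$ has positive fiber dimension at $\bar f$, i.e. $\nabla^{-1}(\nabla\bar f)$ has dimension $\geq1$ at $\bar f$. (B) If $f\in S_{d+1}$ is GIT semistable with respect to the standard $\mathrm{SL}(n)$-action, then the following are equivalent: (1) $f$ is a direct sum; (2) $\nabla$ is not injective at $\bar f$; (3) $\nabla$ has positive fiber dimension at $\bar f$.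
   Context: $\langle\nabla f\rangle$ is the span of the first partials of $f$ in $S_d$. $\mathbb{P}(S_{d+1})^c=\{\bar f\in\mathbb{P}S_{d+1}\mid\dim_k\langle\nabla f\rangle=n\}$; under the characteristic assumption this is the locus of concise forms, i.e. forms not expressible as polynomials in fewer than $n$ linear forms. A form $f$ is a direct sum if $V=U\oplus W$ and $f=f_1+f_2$ with nonzero $f_1\in\operatorname{Sym}^{d+1}U$, $f_2\in\operatorname{Sym}^{d+1}W$. A form $f$ is LDS if, after a linear change of variables, $f=\sum_{i=1}^{\ell}x_i\,\frac{\partial H(x_{\ell+1},\dots,x_{2\ell})}{\partial x_{\ell+i}}+G(x_{\ell+1},\dots,x_n)$ with $H,G$ forms of degree $d+1$ in $\ell$ and $n-\ell$ variables. *)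

theory Defs
  imports Main "HOL-Library.Function_Algebras" "HOL-Combinatorics.Permutations"
    "HOL-Computational_Algebra.Polynomial"
begin

definition alg_closed :: "'k::field itself \<Rightarrow> bool" where
  "alg_closed _ \<longleftrightarrow> (\<forall>p::'k poly. 0 < degree p \<longrightarrow> (\<exists>x. poly p x = 0))"

text \<open>A polynomial in the variables from a finite set I (of type 'v) is a finitely
  supported coefficient function on exponent vectors m :: 'v => nat whose monomials
  only involve variables from I.\<close>

definition is_poly :: "'v set \<Rightarrow> (('v \<Rightarrow> nat) \<Rightarrow> 'k::field) \<Rightarrow> bool" where
  "is_poly I P \<longleftrightarrow> finite {m. P m \<noteq> 0} \<and> (\<forall>m. P m \<noteq> 0 \<longrightarrow> (\<forall>v. v \<notin> I \<longrightarrow> m v = 0))"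

definition is_hpoly :: "'v set \<Rightarrow> nat \<Rightarrow> (('v \<Rightarrow> nat) \<Rightarrow> 'k::field) \<Rightarrow> bool" where
  "is_hpoly I r P \<longleftrightarrow> is_poly I P \<and> (\<forall>m. P m \<noteq> 0 \<longrightarrow> (\<Sum>v\<in>I. m v) = r)"

definition peval :: "'v set \<Rightarrow> (('v \<Rightarrow> nat) \<Rightarrow> 'k::field) \<Rightarrow> ('v \<Rightarrow> 'k) \<Rightarrow> 'k" where
  "peval I P x = (\<Sum>m\<in>{m. P m \<noteq> 0}. P m * (\<Prod>v\<in>I. x v ^ m v))"

text \<open>Forms of degree e in the n coordinates x_0,...,x_(n-1) of V = k^n.
  Elements of S_e are coefficient functions on exponent vectors.\<close>
type_synonym 'k form = "(nat \<Rightarrow> nat) \<Rightarrow> 'k"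

definition form :: "nat \<Rightarrow> nat \<Rightarrow> 'k::field form \<Rightarrow> bool" where
  "form n e f \<longleftrightarrow> is_hpoly {..<n} e f"

definition feval :: "nat \<Rightarrow> 'k::field form \<Rightarrow> (nat \<Rightarrow> 'k) \<Rightarrow> 'k" where
  "feval n f x = peval {..<n} f x"

definition coeff_idx :: "nat \<Rightarrow> nat \<Rightarrow> (nat \<Rightarrow> nat) set" where
  "coeff_idx n e = {\<alpha>. (\<forall>i. n \<le> i \<longrightarrow> \<alpha> i = 0) \<and> (\<Sum>i<n. \<alpha> i) = e}"

definition pderiv_form :: "nat \<Rightarrow> 'k::field form \<Rightarrow> 'k form" where
  "pderiv_form i f = (\<lambda>\<beta>. of_nat (Suc (\<beta> i)) * f (\<beta>(i := Suc (\<beta> i))))"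

definition fscale :: "'k::field \<Rightarrow> 'k form \<Rightarrow> 'k form" where
  "fscale c g = (\<lambda>\<beta>. c * g \<beta>)"

definition grad_span :: "nat \<Rightarrow> 'k::field form \<Rightarrow> 'k form set" where
  "grad_span n f = module.span fscale {pderiv_form i f | i. i < n}"

definition grad_dim :: "nat \<Rightarrow> 'k::field form \<Rightarrow> nat" where
  "grad_dim n f = vector_space.dim fscale (grad_span n f)"

definition lin :: "nat \<Rightarrow> (nat \<Rightarrow> nat \<Rightarrow> 'k::field) \<Rightarrow> (nat \<Rightarrow> 'k) \<Rightarrow> (nat \<Rightarrow> 'k)" where
  "lin n A x = (\<lambda>i. \<Sum>j<n. A i j * x j)"

definition mdet :: "nat \<Rightarrow> (nat \<Rightarrow> nat \<Rightarrow> 'k::field) \<Rightarrow> 'k" where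
  "mdet n A = (\<Sum>p | p permutes {..<n}. of_int (sign p) * (\<Prod>i<n. A i (p i)))"

definition concise :: "nat \<Rightarrow> nat \<Rightarrow> 'k::field form \<Rightarrow> bool" where
  "concise n e f \<longleftrightarrow> \<not> (\<exists>m<n. \<exists>(L::nat \<Rightarrow> nat \<Rightarrow> 'k) h. form m e h \<and>
      (\<forall>x. feval n f x = feval m h (\<lambda>i. \<Sum>j<n. L i j * x j)))"

text \<open>Direct sum: after an invertible linear change of coordinates adapted to V = U (+) W
  (U spanned by the first m coordinates, W by the remaining n - m),
  f = f1 + f2 with nonzero f1 in Sym^e U and f2 in Sym^e W.\<close>
definition direct_sum :: "nat \<Rightarrow> nat \<Rightarrow> 'k::field form \<Rightarrow> bool" where
  "direct_sum n e f \<longleftrightarrow> (\<exists>A m f1 f2. mdet n A \<noteq> 0 \<and> m \<le> n \<and>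
      form m e f1 \<and> f1 \<noteq> (\<lambda>_. 0) \<and> form (n - m) e f2 \<and> f2 \<noteq> (\<lambda>_. 0) \<and>
      (\<forall>x. feval n f (lin n A x) = feval m f1 x + feval (n - m) f2 (\<lambda>j. x (m + j))))"

definition LDS :: "nat \<Rightarrow> nat \<Rightarrow> 'k::field form \<Rightarrow> bool" where
  "LDS n d f \<longleftrightarrow> (\<exists>A l H G. mdet n A \<noteq> 0 \<and> 1 \<le> l \<and> 2 * l \<le> n \<and>
      form l (d + 1) H \<and> form (n - l) (d + 1) G \<and>
      (\<forall>x. feval n f (lin n A x) =
            (\<Sum>i<l. x i * feval l (pderiv_form i H) (\<lambda>j. x (l + j)))
            + feval (n - l) G (\<lambda>j. x (l + j))))"

text \<open>A point of P(S_e) is represented by any nonzero form of degree e; subsets of P(S_e)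
  are represented by their (scaling-stable) sets of nonzero representatives.\<close>
definition Pforms :: "nat \<Rightarrow> nat \<Rightarrow> 'k::field form set" where
  "Pforms n e = {f. form n e f \<and> f \<noteq> (\<lambda>_. 0)}"

definition same_point :: "'k::field form \<Rightarrow> 'k form \<Rightarrow> bool" where
  "same_point f g \<longleftrightarrow> (\<exists>c. g = fscale c f)"

definition Pc :: "nat \<Rightarrow> nat \<Rightarrow> 'k::field form set" where
  "Pc n d = {f \<in> Pforms n (d + 1). grad_dim n f = n}"

definition zclosed :: "nat \<Rightarrow> nat \<Rightarrow> 'k::field form set \<Rightarrow> bool" where
  "zclosed n e Z \<longleftrightarrow> (\<exists>\<P> :: (nat \<times> (((nat \<Rightarrow> nat) \<Rightarrow> nat) \<Rightarrow> 'k)) set.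
      (\<forall>(r, P)\<in>\<P>. is_hpoly (coeff_idx n e) r P) \<and>
      Z = {f \<in> Pforms n e. \<forall>(r, P)\<in>\<P>. peval (coeff_idx n e) P f = 0})"

definition zclosed_in :: "nat \<Rightarrow> nat \<Rightarrow> 'k::field form set \<Rightarrow> 'k form set \<Rightarrow> bool" where
  "zclosed_in n e Y T \<longleftrightarrow> (\<exists>Z. zclosed n e Z \<and> T = Y \<inter> Z)"

text \<open>Irreducible subsets (irreducibility is intrinsic to the subspace topology of T).\<close>
definition zirreducible :: "nat \<Rightarrow> nat \<Rightarrow> 'k::field form set \<Rightarrow> bool" where
  "zirreducible n e T \<longleftrightarrow> T \<noteq> {} \<and>
     (\<forall>Z1 Z2. zclosed n e Z1 \<and> zclosed n e Z2 \<and> T \<subseteq> Z1 \<union> Z2 \<longrightarrow> T \<subseteq> Z1 \<or> T \<subseteq> Z2)"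

definition local_dim_ge :: "nat \<Rightarrow> nat \<Rightarrow> 'k::field form set \<Rightarrow> 'k form \<Rightarrow> nat \<Rightarrow> bool" where
  "local_dim_ge n e Y x r \<longleftrightarrow> (\<exists>T :: nat \<Rightarrow> 'k form set.
      (\<forall>i\<le>r. zclosed_in n e Y (T i) \<and> zirreducible n e (T i)) \<and>
      (\<forall>i<r. T i \<subset> T (Suc i)) \<and> x \<in> T r)"

definition grad_fiber :: "nat \<Rightarrow> nat \<Rightarrow> 'k::field form \<Rightarrow> 'k form set" where
  "grad_fiber n d f = {g \<in> Pc n d. grad_span n g = grad_span n f}"

definition grad_not_injective_at :: "nat \<Rightarrow> nat \<Rightarrow> 'k::field form \<Rightarrow> bool" where
  "grad_not_injective_at n d f \<longleftrightarrow>
     (\<exists>g \<in> Pc n d. \<not> same_point f g \<and> grad_span n g = grad_span n f)"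

definition grad_pos_fiber_dim_at :: "nat \<Rightarrow> nat \<Rightarrow> 'k::field form \<Rightarrow> bool" where
  "grad_pos_fiber_dim_at n d f \<longleftrightarrow> local_dim_ge n (d + 1) (grad_fiber n d f) f 1"

definition SL_orbit :: "nat \<Rightarrow> nat \<Rightarrow> 'k::field form \<Rightarrow> 'k form set" where
  "SL_orbit n e f = {g. form n e g \<and> (\<exists>A. mdet n A = 1 \<and> (\<forall>x. feval n g x = feval n f (lin n A x)))}"

text \<open>f is semistable iff 0 is not in the Zariski closure of its SL(n)-orbit in the
  affine space S_e, i.e. some polynomial function on S_e vanishes on the orbit but not at 0.\<close>
definition semistable :: "nat \<Rightarrow> nat \<Rightarrow> 'k::field form \<Rightarrow> bool" where
  "semistable n e f \<longleftrightarrow> (\<exists>P :: ((nat \<Rightarrow> nat) \<Rightarrow> nat) \<Rightarrow> 'k. is_poly (coeff_idx n e) P \<and>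
      (\<forall>g \<in> SL_orbit n e f. peval (coeff_idx n e) P g = 0) \<and> peval (coeff_idx n e) P (\<lambda>_. 0) \<noteq> 0)"

end

theory Submission
  imports Defs "Jordan_Normal_Form.Char_Poly"
begin

text \<open>
  If f is concise and g has the same gradient span, then there is a linear map P with
  \<open>\<partial>\<^sub>v g = \<partial>\<^bsub>P v\<^esub> f\<close> for all v; by symmetry of second derivatives the Hessian of f satisfies
  \<open>Hess(P u, v) = Hess(u, P v)\<close>. The same symmetry holds for \<open>Q = P - a\<close>, a an eigenvalue of P, and
  for the powers of Q. If Q is not nilpotent, the Fitting decomposition \<open>ker Q\<^sup>r \<oplus> im Q\<^sup>r\<close> is orthogonal
  for the Hessian and f is a direct sum. If Q is nilpotent, a power N of Q satisfies \<open>N \<noteq> 0\<close> and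
  \<open>N\<^sup>2 = 0\<close>; the closed one-form \<open>v \<mapsto> \<partial>\<^bsub>N v\<^esub> f\<close> has a primitive h, and
  \<open>f (y + N u) = f y + \<partial>\<^sub>u h y\<close> is the LDS normal form.

  The fibre of the gradient morphism through f is an open part of a linear space: a line joining two
  of its points leaves it in finitely many points, where a pencil of matrices becomes singular. Hence
  it is irreducible, and of positive dimension as soon as it contains a second point.

  For \<open>d \<ge> 2\<close> explicit one-parameter subgroups drive LDS forms to 0, so these are not semistable, and
  likewise for forms that are not concise; concise quadratic forms in at least two variables are
  direct sums.
\<close>

hide_const (open) Module.smult

subsection \<open>Forms and directional derivatives\<close>

text \<open>Direct sums, LDS forms, conciseness and orbits are stated through values of forms,
  gradient spans through coefficients. Restriction to lines t -> x + t v links the two: over an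
  infinite field the values on a line determine a one-variable polynomial, and since (d+1)! is
  invertible, such a polynomial of degree at most d + 1 with zero derivative is constant. Taylor
  expansions and chain rules are all obtained this way. Subtracting an eigenvalue makes the kernel
  of Q nonzero, so that the Fitting decomposition has a nonzero kernel part. Moreover g - a f is
  nonzero because g is no multiple of f, so Q is nonzero and, if nilpotent, has a nonzero power of
  square zero. For the converse, the second point of the fibre comes from rescaling one summand of a
  direct sum, or from adding H to an LDS form. Positive dimension is the chain consisting of the
  point f and the whole fibre; a one-point fibre has no proper nonempty closed subset. Degree 2 is
  separate because an LDS form such as x y can be semistable there; in degree 1 and at least two
  variables the partials are always dependent.\<close>

lemma finite_coeff_idx [simp]: "finite (coeff_idx n e)"
proof -
  have "coeff_idx n e \<subseteq> {m. \<forall>i. (i \<in> {..<n} \<longrightarrow> m i \<in> {..e}) \<and> (i \<notin> {..<n} \<longrightarrow> m i = 0)}"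
  proof
    fix m assume m: "m \<in> coeff_idx n e"
    have "m i \<le> e" if "i < n" for i
      using m that member_le_sum[of i "{..<n}" m] by (auto simp: coeff_idx_def)
    with m show "m \<in> {m. \<forall>i. (i \<in> {..<n} \<longrightarrow> m i \<in> {..e}) \<and> (i \<notin> {..<n} \<longrightarrow> m i = 0)}"
      by (auto simp: coeff_idx_def)
  qed
  moreover have "finite {m. \<forall>i. (i \<in> {..<n} \<longrightarrow> m i \<in> {..e}) \<and> (i \<notin> {..<n} \<longrightarrow> m i = (0::nat))}"
    by (rule finite_set_of_finite_funs) auto
  ultimately show ?thesis by (rule finite_subset)
qed

lemma coeff_idx_0: "coeff_idx n 0 = {\<lambda>_. 0}"
  by (auto simp: coeff_idx_def fun_eq_iff) (metis lessThan_iff not_le)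

lemma coeff_idx_le: "m \<in> coeff_idx n e \<Longrightarrow> m i \<le> e"
  using member_le_sum[of i "{..<n}" m] by (cases "i < n") (auto simp: coeff_idx_def)

text \<open>The candidate exponents form a finite set, so finiteness of the support follows from its
  location.\<close>

lemma form_iff: "form n e f \<longleftrightarrow> (\<forall>m. f m \<noteq> 0 \<longrightarrow> m \<in> coeff_idx n e)"
proof
  assume "form n e f"
  then show "\<forall>m. f m \<noteq> 0 \<longrightarrow> m \<in> coeff_idx n e"
    by (auto simp: form_def is_hpoly_def is_poly_def coeff_idx_def)
next
  assume *: "\<forall>m. f m \<noteq> 0 \<longrightarrow> m \<in> coeff_idx n e"
  then have "{m. f m \<noteq> 0} \<subseteq> coeff_idx n e" by auto
  then have "finite {m. f m \<noteq> 0}" by (rule finite_subset) simp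
  with * show "form n e f"
    by (auto simp: form_def is_hpoly_def is_poly_def coeff_idx_def)
qed

text \<open>Summing over an index set independent of \<open>f\<close>, instead of its support, makes
  evaluation visibly linear in \<open>f\<close>.\<close>

lemma feval_form:
  assumes "form n e f"
  shows "feval n f x = (\<Sum>m\<in>coeff_idx n e. f m * (\<Prod>i<n. x i ^ m i))"
  unfolding feval_def peval_def
  by (rule sum.mono_neutral_left) (use assms in \<open>auto simp: form_iff\<close>)

lemma feval_cong: "(\<And>i. i < n \<Longrightarrow> x i = y i) \<Longrightarrow> feval n f x = feval n f y"
  unfolding feval_def peval_def by (intro sum.cong refl arg_cong2[of _ _ _ _ "(*)"] prod.cong) auto

lemma form_zero [simp]: "form n e (\<lambda>_. 0)"
  by (simp add: form_iff)

lemma form_add: "form n e f \<Longrightarrow> form n e g \<Longrightarrow> form n e (\<lambda>m. f m + g m)"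
  unfolding form_iff by (metis add.right_neutral)

lemma form_cmult: "form n e f \<Longrightarrow> form n e (\<lambda>m. c * f m)"
  by (auto simp: form_iff)

lemma form_sum: "(\<And>i. i \<in> I \<Longrightarrow> form n e (f i)) \<Longrightarrow> form n e (\<lambda>m. \<Sum>i\<in>I. f i m)"
  by (induction I rule: infinite_finite_induct) (auto intro: form_add)

lemma form_diff: "form n e f \<Longrightarrow> form n e g \<Longrightarrow> form n e (\<lambda>m. f m - g m)"
  using form_add[of n e f "\<lambda>m. (-1) * g m"] form_cmult[of n e g "-1"] by simp

lemma feval_add:
  assumes "form n e f" "form n e g"
  shows "feval n (\<lambda>m. f m + g m) x = feval n f x + feval n g x"
  by (simp add: feval_form[OF form_add[OF assms]] feval_form[OF assms(1)] feval_form[OF assms(2)]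
      distrib_right sum.distrib)

lemma feval_cmult:
  assumes "form n e f"
  shows "feval n (\<lambda>m. c * f m) x = c * feval n f x"
  by (simp add: feval_form[OF form_cmult[OF assms]] feval_form[OF assms] sum_distrib_left mult.assoc)

lemma feval_zero [simp]: "feval n (\<lambda>_. 0) x = 0"
  by (simp add: feval_def peval_def)

lemma feval_sum:
  assumes "\<And>i. i \<in> I \<Longrightarrow> form n e (f i)"
  shows "feval n (\<lambda>m. \<Sum>i\<in>I. f i m) x = (\<Sum>i\<in>I. feval n (f i) x)"
  using assms
  by (induction I rule: infinite_finite_induct) (auto simp: feval_add[of n e] form_sum)

lemma feval_diff:
  assumes "form n e f" "form n e g"
  shows "feval n (\<lambda>m. f m - g m) x = feval n f x - feval n g x"
  using feval_add[OF assms(1) form_cmult[OF assms(2), of "-1"], of x]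
    feval_cmult[OF assms(2), of "-1" x] by simp

lemma feval_homogeneous:
  assumes "form n e f"
  shows "feval n f (\<lambda>i. c * x i) = c ^ e * feval n f x"
proof -
  have "(\<Prod>i<n. (c * x i) ^ m i) = c ^ e * (\<Prod>i<n. x i ^ m i)" if "m \<in> coeff_idx n e" for m
    using that by (simp add: power_mult_distrib prod.distrib coeff_idx_def flip: power_sum)
  then show ?thesis
    by (simp add: feval_form[OF assms] sum_distrib_left mult_ac cong: sum.cong)
qed

lemma feval_at_zero:
  assumes "form n (Suc e) f"
  shows "feval n f (\<lambda>_. 0) = 0"
  using feval_homogeneous[OF assms, of 0 "\<lambda>_. 0"] by simp

text \<open>The derivative in direction \<open>v\<close>. Its values for varying \<open>v\<close>
  are exactly the gradient span (\<open>grad_span_eq_range\<close>), so spans are always handled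
  through directions.\<close>

definition dv :: "nat \<Rightarrow> (nat \<Rightarrow> 'k::field) \<Rightarrow> 'k form \<Rightarrow> 'k form" where
  "dv n v f = (\<lambda>m. \<Sum>i<n. v i * pderiv_form i f m)"

lemma coeff_idx_upd_Suc:
  assumes "i < n"
  shows "m(i := Suc (m i)) \<in> coeff_idx n (Suc e) \<longleftrightarrow> m \<in> coeff_idx n e"
proof -
  have "(\<Sum>j<n. (m(i := Suc (m i))) j) = (\<Sum>j<n. m j + (if j = i then 1 else 0))"
    by (rule sum.cong) auto
  then have "(\<Sum>j<n. (m(i := Suc (m i))) j) = Suc (\<Sum>j<n. m j)"
    using assms by (simp add: sum.distrib)
  then show ?thesis using assms by (auto simp: coeff_idx_def)
qed

lemma form_pderiv: "form n (Suc e) f \<Longrightarrow> i < n \<Longrightarrow> form n e (pderiv_form i f)"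
  unfolding form_iff pderiv_form_def using coeff_idx_upd_Suc by fastforce

lemma form_dv: "form n (Suc e) f \<Longrightarrow> form n e (dv n v f)"
  unfolding dv_def by (intro form_sum form_cmult form_pderiv) auto

lemma pderiv_form_commute: "pderiv_form i (pderiv_form j f) = pderiv_form j (pderiv_form i f)"
  by (cases "i = j") (auto simp: pderiv_form_def fun_upd_twist)

lemma pderiv_form_dv: "pderiv_form i (dv n v f) = dv n v (pderiv_form i f)"
  unfolding dv_def pderiv_form_commute[of _ i]
  by (simp add: pderiv_form_def[of i] sum_distrib_left mult_ac)

text \<open>Symmetry of the Hessian, the source of every orthogonality and closedness statement
  below.\<close>

lemma dv_commute: "dv n u (dv n v f) = dv n v (dv n u f)"
proof -
  have "dv n u (dv n v f) m = dv n v (dv n u f) m" for m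
    unfolding dv_def[of n u] pderiv_form_dv
    by (simp add: dv_def pderiv_form_def[of _ "\<lambda>m. \<Sum>i<n. u i * pderiv_form i f m"]
        sum_distrib_left mult_ac pderiv_form_def[of _ f])
      (simp add: pderiv_form_def sum_distrib_left mult_ac, subst sum.swap, simp add: mult_ac fun_upd_twist)
  then show ?thesis by auto
qed

lemma dv_add: "dv n (\<lambda>i. u i + v i) f = (\<lambda>m. dv n u f m + dv n v f m)"
  by (simp add: dv_def distrib_right sum.distrib)

lemma dv_cmult: "dv n (\<lambda>i. c * v i) f = (\<lambda>m. c * dv n v f m)"
  by (simp add: dv_def sum_distrib_left mult_ac)

lemma dv_cong: "(\<And>i. i < n \<Longrightarrow> u i = v i) \<Longrightarrow> dv n u f = dv n v f"
  by (simp add: dv_def)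

lemma dv_zero_vec [simp]: "dv n (\<lambda>_. 0) f = (\<lambda>_. 0)"
  by (simp add: dv_def)

lemma dv_add_form: "dv n v (\<lambda>m. f m + g m) = (\<lambda>m. dv n v f m + dv n v g m)"
  by (simp add: dv_def pderiv_form_def algebra_simps sum.distrib)

lemma dv_cmult_form: "dv n v (\<lambda>m. c * f m) = (\<lambda>m. c * dv n v f m)"
  by (simp add: dv_def pderiv_form_def sum_distrib_left mult_ac)

lemma dv_zero_form [simp]: "dv n v (\<lambda>_. 0) = (\<lambda>_. 0)"
  by (simp add: dv_def pderiv_form_def)

abbreviation unit_fun :: "nat \<Rightarrow> nat \<Rightarrow> 'k::field" where
  "unit_fun i \<equiv> (\<lambda>j. if j = i then 1 else 0)"

lemma dv_unit: "i < n \<Longrightarrow> dv n (unit_fun i) f = pderiv_form i f"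
  by (simp add: dv_def if_distrib[of "\<lambda>x. x * _"] cong: if_cong)

section \<open>Consequences of the invertibility of the factorial\<close>

lemma of_nat_neq_0_of_fact:
  assumes "of_nat (fact e) \<noteq> (0::'k::field)" "0 < k" "k \<le> e"
  shows "of_nat k \<noteq> (0::'k)"
proof -
  have "k dvd fact e" using assms(2,3) by (simp add: dvd_fact)
  then obtain c where "fact e = k * c" by (elim dvdE)
  with assms(1) show ?thesis by auto
qed

lemma fact_neq_0_le:
  assumes "of_nat (fact e) \<noteq> (0::'k::field)" "k \<le> e"
  shows "of_nat (fact k) \<noteq> (0::'k)"
proof -
  have "(fact k :: nat) dvd fact e" using assms(2) by (rule fact_dvd)
  then obtain c where "(fact e :: nat) = fact k * c" by (elim dvdE)
  then have "of_nat (fact e) = of_nat (fact k) * (of_nat c :: 'k)" by (metis of_nat_mult)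
  with assms(1) show ?thesis by auto
qed

text \<open>A monomial of positive degree contains some variable; the partial in that variable keeps
  its coefficient up to the exponent, a factor between 1 and \<open>Suc e\<close> and hence
  invertible.\<close>

lemma form_eq_0_if_pderivs_0:
  fixes f :: "'k::field form"
  assumes "of_nat (fact (Suc e)) \<noteq> (0::'k)" "form n (Suc e) f"
    and "\<And>i. i < n \<Longrightarrow> pderiv_form i f = (\<lambda>_. 0)"
  shows "f = (\<lambda>_. 0)"
proof (rule ext, rule ccontr)
  fix m assume "f m \<noteq> 0"
  then have m: "m \<in> coeff_idx n (Suc e)" using assms(2) by (auto simp: form_iff)
  have "\<exists>i<n. m i \<noteq> 0"
  proof (rule ccontr)
    assume "\<not> ?thesis"
    then have "(\<Sum>i<n. m i) = 0" by simp
    with m show False by (simp add: coeff_idx_def)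
  qed
  then obtain i where i: "i < n" "m i \<noteq> 0" by blast
  have "m = (m(i := m i - 1))(i := Suc (m i - 1))" using i by auto
  then have "pderiv_form i f (m(i := m i - 1)) = of_nat (m i) * f m"
    using i by (simp add: pderiv_form_def)
  moreover have "of_nat (m i) \<noteq> (0::'k)"
    by (rule of_nat_neq_0_of_fact[OF assms(1)]) (use i coeff_idx_le[OF m] in auto)
  ultimately show False using assms(3)[OF i(1)] \<open>f m \<noteq> 0\<close> by simp
qed

subsection \<open>Restriction of a form to a line\<close>

text \<open>The one-variable polynomial t -> f(x + t v), built from coefficients so that the
  calculus of \<open>poly\<close> applies.\<close>

definition line_poly :: "nat \<Rightarrow> nat \<Rightarrow> 'k::field form \<Rightarrow> (nat \<Rightarrow> 'k) \<Rightarrow> (nat \<Rightarrow> 'k) \<Rightarrow> 'k poly" where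
  "line_poly n e f x v = (\<Sum>m\<in>coeff_idx n e. smult (f m) (\<Prod>i<n. [:x i, v i:] ^ m i))"

lemma poly_line_poly:
  assumes "form n e f"
  shows "poly (line_poly n e f x v) t = feval n f (\<lambda>i. x i + t * v i)"
  by (simp add: line_poly_def feval_form[OF assms] poly_sum poly_prod)

lemma degree_line_poly: "degree (line_poly n e f x v) \<le> e"
  unfolding line_poly_def
proof (rule degree_sum_le)
  fix m assume m: "m \<in> coeff_idx n e"
  have "degree (\<Prod>i<n. [:x i, v i:] ^ m i) \<le> (\<Sum>i<n. degree ([:x i, v i:] ^ m i))"
    using degree_prod_sum_le[of "{..<n}" "\<lambda>i. [:x i, v i:] ^ m i"] by (simp add: o_def)
  also have "\<dots> \<le> (\<Sum>i<n. m i)"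
  proof (rule sum_mono)
    fix i
    show "degree ([:x i, v i:] ^ m i) \<le> m i"
      using degree_power_le[of "[:x i, v i:]" "m i"] by (cases "v i = 0") auto
  qed
  also have "\<dots> = e" using m by (simp add: coeff_idx_def)
  finally show "degree (smult (f m) (\<Prod>i<n. [:x i, v i:] ^ m i)) \<le> e"
    using degree_smult_le le_trans by blast
qed simp

text \<open>The chain rule: the product rule lowers one exponent of each monomial, and reindexing by
  the lowered exponent produces the coefficients of \<open>pderiv_form\<close>.\<close>

lemma pderiv_line_poly:
  assumes "form n (Suc e) f"
  shows "pderiv (line_poly n (Suc e) f x v) = line_poly n e (dv n v f) x v"
proof -
  let ?L = "\<lambda>i. [:x i, v i:]"
  define X where "X m = (\<Prod>i<n. ?L i ^ m i)" for m
  have dX: "pderiv (X m) = (\<Sum>i<n. smult (v i) (if m i = 0 then 0 else smult (of_nat (m i)) (X (m(i := m i - 1)))))"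
    for m
  proof -
    have "pderiv (X m) = (\<Sum>i<n. (\<Prod>j\<in>{..<n} - {i}. ?L j ^ m j) * pderiv (?L i ^ m i))"
      unfolding X_def by (rule pderiv_prod)
    also have "\<dots> = (\<Sum>i<n. smult (v i) (if m i = 0 then 0 else smult (of_nat (m i)) (X (m(i := m i - 1)))))"
    proof (rule sum.cong[OF refl])
      fix i assume i: "i \<in> {..<n}"
      have "X (m(i := m i - 1)) = ?L i ^ (m i - 1) * (\<Prod>j\<in>{..<n} - {i}. ?L j ^ m j)"
        unfolding X_def by (subst prod.remove[OF _ i]) (auto intro!: prod.cong)
      moreover have "pderiv (?L i) = [:v i:]" by (simp add: pderiv_pCons)
      ultimately show "(\<Prod>j\<in>{..<n} - {i}. ?L j ^ m j) * pderiv (?L i ^ m i) =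
          smult (v i) (if m i = 0 then 0 else smult (of_nat (m i)) (X (m(i := m i - 1))))"
        by (cases "m i") (simp_all add: pderiv_power_Suc mult_ac del: power_Suc)
    qed
    finally show ?thesis .
  qed
  have "pderiv (line_poly n (Suc e) f x v) = (\<Sum>m\<in>coeff_idx n (Suc e). smult (f m) (pderiv (X m)))"
    unfolding line_poly_def X_def by (simp add: pderiv_sum pderiv_smult)
  also have "\<dots> = (\<Sum>i<n. smult (v i) (\<Sum>m\<in>coeff_idx n (Suc e).
      if m i = 0 then 0 else smult (f m * of_nat (m i)) (X (m(i := m i - 1)))))"
    unfolding dX by (simp add: smult_sum2, subst sum.swap) (auto intro!: sum.cong simp: mult_ac)
  also have "\<dots> = (\<Sum>i<n. smult (v i) (\<Sum>m\<in>coeff_idx n e. smult (pderiv_form i f m) (X m)))"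
  proof (rule sum.cong[OF refl], rule arg_cong[of _ _ "smult _"])
    fix i assume "i \<in> {..<n}"
    then have i: "i < n" by simp
    have "(\<Sum>m\<in>coeff_idx n (Suc e). if m i = 0 then 0 else smult (f m * of_nat (m i)) (X (m(i := m i - 1))))
      = (\<Sum>m\<in>{m\<in>coeff_idx n (Suc e). m i \<noteq> 0}. smult (f m * of_nat (m i)) (X (m(i := m i - 1))))"
      by (rule sum.mono_neutral_cong_right) auto
    also have "\<dots> = (\<Sum>m\<in>coeff_idx n e. smult (pderiv_form i f m) (X m))"
    \<comment> \<open>Lowering the i-th exponent is a bijection from the exponents containing
      variable i to those of degree \<open>e\<close>.\<close>
    proof (rule sum.reindex_bij_witness[of _ "\<lambda>m. m(i := Suc (m i))" "\<lambda>m. m(i := m i - 1)"])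
      fix m assume m: "m \<in> {m\<in>coeff_idx n (Suc e). m i \<noteq> 0}"
      show "(m(i := m i - 1))(i := Suc ((m(i := m i - 1)) i)) = m" using m by auto
      then show "m(i := m i - 1) \<in> coeff_idx n e"
        using m coeff_idx_upd_Suc[OF i, of "m(i := m i - 1)" e] by auto
      show "smult (pderiv_form i f (m(i := m i - 1))) (X (m(i := m i - 1))) =
          smult (f m * of_nat (m i)) (X (m(i := m i - 1)))"
        using m by (simp add: pderiv_form_def mult_ac)
    next
      fix m assume "m \<in> coeff_idx n e"
      then show "m(i := Suc (m i)) \<in> {m\<in>coeff_idx n (Suc e). m i \<noteq> 0}"
        using coeff_idx_upd_Suc[OF i] by auto
    qed auto
    finally show "(\<Sum>m\<in>coeff_idx n (Suc e). if m i = 0 then 0 else smult (f m * of_nat (m i)) (X (m(i := m i - 1))))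
      = (\<Sum>m\<in>coeff_idx n e. smult (pderiv_form i f m) (X m))" .
  qed
  also have "\<dots> = line_poly n e (dv n v f) x v"
    unfolding line_poly_def dv_def X_def[symmetric]
    by (simp add: smult_sum2 smult_sum, subst sum.swap) simp
  finally show ?thesis .
qed

text \<open>Finitely many exceptions are allowed; families that involve \<open>inverse t\<close> are
  controlled only away from 0.\<close>

lemma poly_eqI_infinite:
  fixes p q :: "'k::field poly"
  assumes "infinite (UNIV :: 'k set)" "finite {t. poly p t \<noteq> poly q t}"
  shows "p = q"
proof (rule ccontr)
  assume "p \<noteq> q"
  then have "finite {t. poly (p - q) t = 0}" by (intro poly_roots_finite) simp
  moreover have "UNIV = {t. poly (p - q) t = 0} \<union> {t. poly p t \<noteq> poly q t}" by auto
  ultimately show False using assms by (metis finite_Un)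
qed

text \<open>The degree bound excludes examples like x^p in characteristic p: every index up to
  \<open>e\<close> is invertible.\<close>

lemma pderiv_eq_0_imp_const:
  fixes p :: "'k::field poly"
  assumes "of_nat (fact e) \<noteq> (0::'k)" "degree p \<le> e" "pderiv p = 0"
  shows "p = [:coeff p 0:]"
proof (rule poly_eqI)
  fix i
  show "coeff p i = coeff [:coeff p 0:] i"
  proof (cases i)
    case (Suc j)
    show ?thesis
    proof (cases "i \<le> e")
      case True
      have "of_nat i \<noteq> (0::'k)" using True Suc by (intro of_nat_neq_0_of_fact[OF assms(1)]) auto
      moreover have "of_nat i * coeff p i = 0"
        using arg_cong[OF assms(3), of "\<lambda>q. coeff q j"] Suc by (simp add: coeff_pderiv)
      ultimately show ?thesis using Suc by simp
    next
      case False
      then show ?thesis using assms(2) Suc by (simp add: coeff_eq_0)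
    qed
  qed simp
qed

lemma feval_invariant_if_dv_0:
  fixes f :: "'k::field form"
  assumes "of_nat (fact (Suc e)) \<noteq> (0::'k)" "form n (Suc e) f" "dv n v f = (\<lambda>_. 0)"
  shows "feval n f (\<lambda>i. x i + t * v i) = feval n f x"
proof -
  let ?p = "line_poly n (Suc e) f x v"
  have "pderiv ?p = 0"
    unfolding pderiv_line_poly[OF assms(2)] assms(3) by (simp add: line_poly_def)
  then obtain c where c: "?p = [:c:]"
    using pderiv_eq_0_imp_const[OF assms(1) degree_line_poly] by metis
  have "poly ?p t = poly ?p 0" by (simp add: c)
  then show ?thesis by (simp add: poly_line_poly[OF assms(2)])
qed

text \<open>The Taylor expansion along \<open>v\<close> stops after the linear term.\<close>

lemma feval_affine_if_dv_dv_0: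
  fixes f :: "'k::field form"
  assumes "of_nat (fact (Suc e)) \<noteq> (0::'k)" "form n (Suc e) f" "dv n v (dv n v f) = (\<lambda>_. 0)"
  shows "feval n f (\<lambda>i. x i + t * v i) = feval n f x + t * feval n (dv n v f) x"
proof -
  let ?p = "line_poly n (Suc e) f x v"
  let ?q = "line_poly n e (dv n v f) x v"
  note fd = form_dv[OF assms(2)]
  have "?q = [:coeff ?q 0:]"
  \<comment> \<open>For \<open>e = 0\<close> the derivative already has degree 0, and the degree
    bound alone makes its line polynomial constant.\<close>
  proof (cases e)
    case 0
    then show ?thesis using degree_line_poly[of n 0] by (metis degree_0_id le_zero_eq)
  next
    case (Suc e')
    have "pderiv ?q = 0"
      unfolding Suc by (subst pderiv_line_poly) (use fd Suc assms(3) in \<open>auto simp: line_poly_def\<close>)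
    then show ?thesis
      using pderiv_eq_0_imp_const[OF fact_neq_0_le[OF assms(1)] degree_line_poly] by (metis le_SucI order_refl)
  qed
  moreover have "coeff ?q 0 = feval n (dv n v f) x"
    using poly_line_poly[OF fd, of v x v 0] by (simp add: poly_0_coeff_0)
  ultimately have "pderiv ?p = [:feval n (dv n v f) x:]"
    by (simp add: pderiv_line_poly[OF assms(2)])
  then have "pderiv (?p - [:0, feval n (dv n v f) x:]) = 0"
    by (simp add: pderiv_diff pderiv_pCons)
  moreover have "degree (?p - [:0, feval n (dv n v f) x:]) \<le> Suc e"
    by (rule degree_diff_le) (auto simp: degree_line_poly)
  ultimately obtain c where "?p - [:0, feval n (dv n v f) x:] = [:c:]"
    using pderiv_eq_0_imp_const[OF assms(1)] by metis
  then have c: "?p = [:c:] + [:0, feval n (dv n v f) x:]" by (metis diff_add_cancel)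
  have "poly ?p t = poly ?p 0 + t * feval n (dv n v f) x" by (simp add: c)
  then show ?thesis by (simp add: poly_line_poly[OF assms(2)])
qed

text \<open>Equal values along two lines, possibly in different spaces, force equal derivatives
  there. This carries derivatives through linear substitutions without expanding
  coefficients.\<close>

lemma feval_dv_eqI:
  fixes f h :: "'k::field form"
  assumes "infinite (UNIV :: 'k set)" "form n (Suc e) f" "form m (Suc e') h"
    and "\<And>t. feval n f (\<lambda>i. x i + t * v i) = feval m h (\<lambda>i. y i + t * w i)"
  shows "feval n (dv n v f) x = feval m (dv m w h) y"
proof -
  have "line_poly n (Suc e) f x v = line_poly m (Suc e') h y w"
    by (rule poly_eqI_infinite[OF assms(1)])
      (simp add: poly_line_poly[OF assms(2)] poly_line_poly[OF assms(3)] assms(4))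
  then have "line_poly n e (dv n v f) x v = line_poly m e' (dv m w h) y w"
    by (metis pderiv_line_poly[OF assms(2)] pderiv_line_poly[OF assms(3)])
  then have "poly (line_poly n e (dv n v f) x v) 0 = poly (line_poly m e' (dv m w h) y w) 0" by simp
  then show ?thesis
    by (simp add: poly_line_poly[OF form_dv[OF assms(2)]] poly_line_poly[OF form_dv[OF assms(3)]])
qed

text \<open>Induction on the degree: if all values vanish, so do those of all partials, because a
  partial is the derivative along a line.\<close>

lemma form_eq_0_if_feval_0:
  fixes f :: "'k::field form"
  assumes inf: "infinite (UNIV :: 'k set)"
  shows "of_nat (fact e) \<noteq> (0::'k) \<Longrightarrow> form n e f \<Longrightarrow> (\<And>x. feval n f x = 0) \<Longrightarrow> f = (\<lambda>_. 0)"
proof (induction e arbitrary: f)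
  case 0
  note * = coeff_idx_0
  have "f (\<lambda>_. 0) = 0"
    using 0(3)[of "\<lambda>_. 0"] unfolding feval_form[OF 0(2)] * by simp
  moreover have "f m = 0" if "m \<noteq> (\<lambda>_. 0)" for m
    using 0(2) that unfolding form_iff * by auto
  ultimately show ?case by (metis ext)
next
  case (Suc e)
  show ?case
  proof (rule form_eq_0_if_pderivs_0[OF Suc.prems(1,2)])
    fix i assume i: "i < n"
    show "pderiv_form i f = (\<lambda>_. 0)"
    proof (rule Suc.IH)
      show "of_nat (fact e) \<noteq> (0::'k)" using fact_neq_0_le[OF Suc.prems(1)] by simp
      show "form n e (pderiv_form i f)" by (rule form_pderiv[OF Suc.prems(2) i])
      fix x :: "nat \<Rightarrow> 'k"
      \<comment> \<open>The form is compared with the zero form along a constant line.\<close>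
      have "feval n (dv n (unit_fun i) f) x = feval n (dv n (\<lambda>_. 0) (\<lambda>_. 0 :: 'k)) x"
        by (rule feval_dv_eqI[OF inf Suc.prems(2), of n e]) (simp_all add: Suc.prems(3))
      then show "feval n (pderiv_form i f) x = 0" using i by (simp add: dv_unit)
    qed
  qed
qed

lemma form_eqI:
  fixes f g :: "'k::field form"
  assumes "infinite (UNIV :: 'k set)" "of_nat (fact e) \<noteq> (0::'k)" "form n e f" "form n e g"
    and "\<And>x. feval n f x = feval n g x"
  shows "f = g"
  using form_eq_0_if_feval_0[OF assms(1,2) form_diff[OF assms(3,4)]]
  by (simp add: feval_diff[OF assms(3,4)] assms(5) fun_eq_iff)

text \<open>Over a finite field the product of all x - a, plus 1, has no root.\<close>

lemma infinite_UNIV_if_alg_closed: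
  assumes "alg_closed TYPE('k::field)"
  shows "infinite (UNIV :: 'k set)"
proof
  assume fin: "finite (UNIV :: 'k set)"
  let ?p = "(\<Prod>a\<in>(UNIV::'k set). [:- a, 1:])"
  have deg: "degree ?p = card (UNIV :: 'k set)"
    by (subst degree_prod_eq_sum_degree) auto
  have "0 < card (UNIV :: 'k set)" using fin by (simp add: card_gt_0_iff)
  then have "0 < degree (?p + 1)" using deg by (subst degree_add_eq_left) auto
  then obtain x where "poly (?p + 1) x = 0" using assms unfolding alg_closed_def by blast
  moreover have "poly ?p x = 0" using fin by (auto simp: poly_prod)
  ultimately show False by simp
qed

subsection \<open>Linear substitutions\<close>

text \<open>Multiplication by the variable x_i.\<close>

definition xmul :: "nat \<Rightarrow> 'k::field form \<Rightarrow> 'k form" where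
  "xmul i f = (\<lambda>m. if m i = 0 then 0 else f (m(i := m i - 1)))"

lemma form_xmul:
  assumes "form n e f" "i < n"
  shows "form n (Suc e) (xmul i f)"
  unfolding form_iff
proof (intro allI impI)
  fix m assume "xmul i f m \<noteq> 0"
  then have m: "m i \<noteq> 0" "f (m(i := m i - 1)) \<noteq> 0" by (auto simp: xmul_def split: if_splits)
  then have "m(i := m i - 1) \<in> coeff_idx n e" using assms(1) by (auto simp: form_iff)
  then show "m \<in> coeff_idx n (Suc e)"
    using coeff_idx_upd_Suc[OF assms(2), of "m(i := m i - 1)" e] m by simp
qed

lemma feval_xmul:
  assumes "form n e f" "i < n"
  shows "feval n (xmul i f) x = x i * feval n f x"
proof -
  have "feval n (xmul i f) x = (\<Sum>m\<in>{m\<in>coeff_idx n (Suc e). m i \<noteq> 0}. f (m(i := m i - 1)) * (\<Prod>j<n. x j ^ m j))"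
    unfolding feval_form[OF form_xmul[OF assms]] by (rule sum.mono_neutral_cong_right) (auto simp: xmul_def)
  also have "\<dots> = (\<Sum>m\<in>coeff_idx n e. f m * (x i * (\<Prod>j<n. x j ^ m j)))"
  proof (rule sum.reindex_bij_witness[of _ "\<lambda>m. m(i := Suc (m i))" "\<lambda>m. m(i := m i - 1)"])
    fix m assume m: "m \<in> {m\<in>coeff_idx n (Suc e). m i \<noteq> 0}"
    show "(m(i := m i - 1))(i := Suc ((m(i := m i - 1)) i)) = m" using m by auto
    then show "m(i := m i - 1) \<in> coeff_idx n e"
      using m coeff_idx_upd_Suc[OF assms(2), of "m(i := m i - 1)" e] by auto
    have "(\<Prod>j<n. x j ^ m j) = x i ^ m i * (\<Prod>j\<in>{..<n} - {i}. x j ^ m j)"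
      using assms(2) by (subst prod.remove[of _ i]) auto
    moreover have "(\<Prod>j<n. x j ^ (m(i := m i - 1)) j) = x i ^ (m i - 1) * (\<Prod>j\<in>{..<n} - {i}. x j ^ m j)"
      using assms(2) by (subst prod.remove[of _ i]) (auto intro!: prod.cong)
    ultimately have "x i * (\<Prod>j<n. x j ^ (m(i := m i - 1)) j) = (\<Prod>j<n. x j ^ m j)"
      using m by (cases "m i") auto
    then show "f (m(i := m i - 1)) * (x i * (\<Prod>j<n. x j ^ (m(i := m i - 1)) j)) =
      f (m(i := m i - 1)) * (\<Prod>j<n. x j ^ m j)" by simp
  next
    fix m assume "m \<in> coeff_idx n e"
    then show "m(i := Suc (m i)) \<in> {m\<in>coeff_idx n (Suc e). m i \<noteq> 0}"
      using coeff_idx_upd_Suc[OF assms(2)] by auto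
  qed auto
  also have "\<dots> = x i * feval n f x"
    by (simp add: feval_form[OF assms(1)] sum_distrib_left mult_ac)
  finally show ?thesis .
qed

text \<open>Existence of a representing form, on the level of values: closure properties then give
  linear substitutions without computing the new coefficients.\<close>

definition polyfun :: "nat \<Rightarrow> nat \<Rightarrow> ((nat \<Rightarrow> 'k::field) \<Rightarrow> 'k) \<Rightarrow> bool" where
  "polyfun n e F \<longleftrightarrow> (\<exists>h. form n e h \<and> (\<forall>x. F x = feval n h x))"

lemma polyfun_cmult: "polyfun n e F \<Longrightarrow> polyfun n e (\<lambda>x. c * F x)"
  unfolding polyfun_def by (metis form_cmult feval_cmult)

lemma polyfun_add: "polyfun n e F \<Longrightarrow> polyfun n e G \<Longrightarrow> polyfun n e (\<lambda>x. F x + G x)"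
  unfolding polyfun_def by (metis form_add feval_add)

lemma polyfun_zero: "polyfun n e (\<lambda>x. 0)"
  unfolding polyfun_def by (metis form_zero feval_zero)

lemma polyfun_sum: "(\<And>i. i \<in> I \<Longrightarrow> polyfun n e (F i)) \<Longrightarrow> polyfun n e (\<lambda>x. \<Sum>i\<in>I. F i x)"
  by (induction I rule: infinite_finite_induct) (auto intro: polyfun_add polyfun_zero)

lemma polyfun_var_mult: "polyfun n e F \<Longrightarrow> i < n \<Longrightarrow> polyfun n (Suc e) (\<lambda>x. x i * F x)"
  unfolding polyfun_def by (metis form_xmul feval_xmul)

lemma polyfun_const: "polyfun n 0 (\<lambda>x. c)"
proof -
  note * = coeff_idx_0
  let ?h = "\<lambda>m. if m = (\<lambda>_. 0) then c else 0"
  have "form n 0 ?h" unfolding form_iff * by auto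
  then show ?thesis unfolding polyfun_def by (intro exI[of _ ?h]) (simp add: feval_form *)
qed

lemma polyfun_linear_mult:
  assumes "polyfun n e F"
  shows "polyfun n (Suc e) (\<lambda>x. (\<Sum>j<n. b j * x j) * F x)"
proof -
  have "polyfun n (Suc e) (\<lambda>x. \<Sum>j<n. b j * (x j * F x))"
    by (intro polyfun_sum polyfun_cmult polyfun_var_mult[OF assms]) auto
  then show ?thesis by (simp add: sum_distrib_right mult.assoc)
qed

lemma polyfun_linear_power_mult:
  assumes "polyfun n e F"
  shows "polyfun n (k + e) (\<lambda>x. (\<Sum>j<n. b j * x j) ^ k * F x)"
proof (induction k)
  case (Suc k)
  from polyfun_linear_mult[OF this, of b] show ?case by (simp add: mult.assoc)
qed (use assms in simp)

lemma polyfun_linear_monomial: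
  "polyfun n (\<Sum>i<m. \<mu> i) (\<lambda>x. \<Prod>i<m. (\<Sum>j<n. B i j * x j) ^ \<mu> i)" for m :: nat
proof (induction m)
  case 0
  show ?case using polyfun_const[of n 1] by simp
next
  case (Suc m)
  from polyfun_linear_power_mult[OF this, of "\<mu> m" "B m"] show ?case
    by (simp add: mult.commute add.commute)
qed

text \<open>Each monomial turns into a product of powers of linear forms.\<close>

lemma polyfun_linear_subst:
  assumes "form m e f"
  shows "polyfun n e (\<lambda>x. feval m f (\<lambda>i. \<Sum>j<n. B i j * x j))"
  unfolding feval_form[OF assms]
proof (intro polyfun_sum polyfun_cmult)
  fix \<mu> assume "\<mu> \<in> coeff_idx m e"
  then show "polyfun n e (\<lambda>x. \<Prod>i<m. (\<Sum>j<n. B i j * x j) ^ \<mu> i)"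
    using polyfun_linear_monomial[of n \<mu> m B] by (simp add: coeff_idx_def)
qed

subsection \<open>The span of the gradient\<close>

global_interpretation forms: vector_space "fscale :: 'k::field \<Rightarrow> 'k form \<Rightarrow> 'k form"
  by unfold_locales (auto simp: fscale_def algebra_simps)

lemma sum_fun_apply: "(\<Sum>i\<in>I. F i) x = (\<Sum>i\<in>I. F i x)"
  by (induction I rule: infinite_finite_induct) auto

lemma dv_eq_sum: "dv n c f = (\<Sum>i<n. fscale (c i) (pderiv_form i f))"
  by (simp add: dv_def fun_eq_iff sum_fun_apply fscale_def)

lemma grad_span_eq_range: "grad_span n f = range (\<lambda>c. dv n c f)"
proof
  have "forms.subspace (range (\<lambda>c. dv n c f))"
    unfolding forms.subspace_def
  proof (intro conjI ballI allI)
    show "0 \<in> range (\<lambda>c. dv n c f)"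
      by (rule range_eqI[of _ _ "\<lambda>_. 0"]) (simp add: fun_eq_iff)
  next
    fix g h assume "g \<in> range (\<lambda>c. dv n c f)" "h \<in> range (\<lambda>c. dv n c f)"
    then obtain a b where ab: "g = dv n a f" "h = dv n b f" by auto
    show "g + h \<in> range (\<lambda>c. dv n c f)"
      by (rule range_eqI[of _ _ "\<lambda>i. a i + b i"]) (simp add: ab dv_add fun_eq_iff)
  next
    fix r g assume "g \<in> range (\<lambda>c. dv n c f)"
    then obtain a where a: "g = dv n a f" by auto
    show "fscale r g \<in> range (\<lambda>c. dv n c f)"
      by (rule range_eqI[of _ _ "\<lambda>i. r * a i"]) (simp add: a dv_cmult fscale_def)
  qed
  moreover have "{pderiv_form i f |i. i < n} \<subseteq> range (\<lambda>c. dv n c f)"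
    by (auto simp: dv_unit[symmetric])
  ultimately show "grad_span n f \<subseteq> range (\<lambda>c. dv n c f)"
    unfolding grad_span_def by (intro forms.span_minimal)
  show "range (\<lambda>c. dv n c f) \<subseteq> grad_span n f"
    unfolding grad_span_def dv_eq_sum
    by (auto intro!: forms.span_sum forms.span_scale intro: forms.span_base)
qed

text \<open>Linear independence of the first \<open>n\<close> partials, the form in which
  conciseness is used.\<close>

definition indep_grad :: "nat \<Rightarrow> 'k::field form \<Rightarrow> bool" where
  "indep_grad n f \<longleftrightarrow> (\<forall>c. dv n c f = (\<lambda>_. 0) \<longrightarrow> (\<forall>i<n. c i = 0))"

lemma grad_dim_if_indep_grad:
  fixes f :: "'k::field form"
  assumes "indep_grad n f"
  shows "grad_dim n f = n"
proof -
  let ?B = "(\<lambda>i. pderiv_form i f) ` {..<n}"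
  \<comment> \<open>The generators are a set, in which equal partials would be counted once; the
    direction e_i - e_j excludes this.\<close>
  have inj: "inj_on (\<lambda>i. pderiv_form i f) {..<n}"
  proof (rule inj_onI, rule ccontr)
    fix i j assume ij: "i \<in> {..<n}" "j \<in> {..<n}" "pderiv_form i f = pderiv_form j f" "i \<noteq> j"
    have "dv n (\<lambda>k. unit_fun i k + (-1) * unit_fun j k) f = (\<lambda>_. 0)"
      unfolding dv_add dv_cmult using ij by (simp add: dv_unit)
    then have "unit_fun i i + (-1) * unit_fun j i = (0::'k)"
      using assms ij unfolding indep_grad_def by blast
    then show False using ij by simp
  qed
  have "forms.independent ?B"
  proof (rule forms.independent_if_scalars_zero)
    fix s g assume s: "(\<Sum>g\<in>?B. fscale (s g) g) = 0" and "g \<in> ?B"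
    then obtain i where i: "i < n" "g = pderiv_form i f" by auto
    have "dv n (\<lambda>i. s (pderiv_form i f)) f = (\<lambda>_. 0)"
      unfolding dv_eq_sum using s by (simp add: sum.reindex[OF inj] zero_fun_def)
    then show "s g = 0" using assms i unfolding indep_grad_def by blast
  qed simp
  then have "forms.dim (forms.span ?B) = card ?B" by (rule forms.dim_span_eq_card_independent)
  moreover have "{pderiv_form i f |i. i < n} = ?B" by auto
  ultimately show ?thesis
    unfolding grad_dim_def grad_span_def using card_image[OF inj] by simp
qed

text \<open>A form killed by the derivative along \<open>c\<close> is constant along
  \<open>c\<close>, so f(x) = f(x - (x_i / c_i) c), and the argument on the right lies in the
  hyperplane x_i = 0.\<close>

lemma not_concise_if_dv_0:
  fixes f :: "'k::field form"
  assumes ch: "of_nat (fact (Suc e)) \<noteq> (0::'k)" and f: "form n (Suc e) f"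
    and c: "dv n c f = (\<lambda>_. 0)" "i < n" "c i \<noteq> 0"
  shows "\<not> concise n (Suc e) f"
proof -
  \<comment> \<open>\<open>\<sigma>\<close> enumerates the indices other than \<open>i\<close>,
    \<open>B\<close> embeds k^(n-1) as the hyperplane x_i = 0, and \<open>L\<close> is the
    projection along \<open>c\<close> onto that hyperplane in these coordinates.\<close>
  define \<sigma> where "\<sigma> j = (if j < i then j else Suc j)" for j
  define B :: "nat \<Rightarrow> nat \<Rightarrow> 'k" where "B p j = (if p \<noteq> i \<and> j = (if p < i then p else p - 1) then 1 else 0)" for p j
  define L :: "nat \<Rightarrow> nat \<Rightarrow> 'k" where "L j k = (if k = \<sigma> j then 1 else 0) - (if k = i then c (\<sigma> j) / c i else 0)" for j k
  obtain h where h: "form (n - 1) (Suc e) h"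
      "\<And>x. feval n f (\<lambda>p. \<Sum>j<n - 1. B p j * x j) = feval (n - 1) h x"
    using polyfun_linear_subst[OF f, of "n - 1" B] unfolding polyfun_def by blast
  have "feval n f x = feval (n - 1) h (\<lambda>j. \<Sum>k<n. L j k * x k)" for x
  proof -
    have L: "(\<Sum>k<n. L j k * x k) = x (\<sigma> j) - c (\<sigma> j) / c i * x i" if "j < n - 1" for j
    proof -
      have "\<sigma> j < n" using that c(2) by (auto simp: \<sigma>_def)
      then show ?thesis using c(2)
        by (simp add: L_def left_diff_distrib sum_subtractf if_distrib[of "\<lambda>y. y * _"] cong: if_cong)
    qed
    have "feval (n - 1) h (\<lambda>j. \<Sum>k<n. L j k * x k) = feval n f (\<lambda>p. \<Sum>j<n - 1. B p j * (\<Sum>k<n. L j k * x k))"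
      by (rule h(2)[symmetric])
    also have "\<dots> = feval n f (\<lambda>p. x p + (- x i / c i) * c p)"
    proof (rule feval_cong)
      fix p assume p: "p < n"
      show "(\<Sum>j<n - 1. B p j * (\<Sum>k<n. L j k * x k)) = x p + (- x i / c i) * c p"
      proof (cases "p = i")
        case True
        then show ?thesis using c(3) by (simp add: B_def)
      next
        case False
        let ?j = "if p < i then p else p - 1"
        have j: "?j < n - 1" "\<sigma> ?j = p" using p False c(2) by (auto simp: \<sigma>_def)
        have "(\<Sum>j<n - 1. B p j * (\<Sum>k<n. L j k * x k)) = (\<Sum>j<n - 1. if j = ?j then (\<Sum>k<n. L ?j k * x k) else 0)"
          using False by (intro sum.cong) (auto simp: B_def)
        also have "\<dots> = (\<Sum>k<n. L ?j k * x k)" using j(1) by simp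
        also have "\<dots> = x p - c p / c i * x i" by (simp only: L[OF j(1)] j(2))
        finally show ?thesis by simp
      qed
    qed
    also have "\<dots> = feval n f x" by (rule feval_invariant_if_dv_0[OF ch f c(1)])
    finally show ?thesis by simp
  qed
  moreover have "n - 1 < n" using c(2) by simp
  ultimately show ?thesis unfolding concise_def using h(1) by blast
qed

lemma indep_grad_if_concise:
  fixes f :: "'k::field form"
  assumes "of_nat (fact (Suc e)) \<noteq> (0::'k)" "form n (Suc e) f" "concise n (Suc e) f"
  shows "indep_grad n f"
  unfolding indep_grad_def using not_concise_if_dv_0[OF assms(1,2)] assms(3) by blast

lemma grad_span_subsetI:
  assumes "\<And>v. \<exists>w. dv n v g = dv n w f"
  shows "grad_span n g \<subseteq> grad_span n f"
  using assms unfolding grad_span_eq_range by fastforce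

subsection \<open>Matrices\<close>

definition sq_mat :: "nat \<Rightarrow> (nat \<Rightarrow> nat \<Rightarrow> 'k::field) \<Rightarrow> 'k mat" where
  "sq_mat n A = mat n n (\<lambda>(i, j). A i j)"

definition mmul :: "nat \<Rightarrow> (nat \<Rightarrow> nat \<Rightarrow> 'k::field) \<Rightarrow> (nat \<Rightarrow> nat \<Rightarrow> 'k) \<Rightarrow> nat \<Rightarrow> nat \<Rightarrow> 'k" where
  "mmul n A B i j = (\<Sum>k<n. A i k * B k j)"

lemma sq_mat_carrier [simp]: "sq_mat n A \<in> carrier_mat n n"
  by (simp add: sq_mat_def)

lemma det_sq_mat: "det (sq_mat n A) = mdet n A"
proof -
  have *: "(\<Prod>i<n. sq_mat n A $$ (i, p i)) = (\<Prod>i<n. A i (p i))" if "p permutes {..<n}" for p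
  proof (rule prod.cong[OF refl])
    fix i assume "i \<in> {..<n}"
    moreover from this have "p i \<in> {..<n}" using that by (simp only: permutes_in_image)
    ultimately show "sq_mat n A $$ (i, p i) = A i (p i)" by (simp add: sq_mat_def)
  qed
  show ?thesis
    unfolding det_def'[OF sq_mat_carrier] mdet_def atLeast0LessThan
    by (rule sum.cong[OF refl]) (simp only: mem_Collect_eq *)
qed

lemma sq_mat_mmul: "sq_mat n (mmul n A B) = sq_mat n A * sq_mat n B"
  by (rule eq_matI) (auto simp: sq_mat_def mmul_def scalar_prod_def atLeast0LessThan)

lemma mdet_mmul: "mdet n (mmul n A B) = mdet n A * mdet n B"
  using det_mult[OF sq_mat_carrier[of n A] sq_mat_carrier[of n B]]
  unfolding sq_mat_mmul[symmetric] det_sq_mat .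

lemma lin_mmul: "lin n (mmul n A B) x = lin n A (lin n B x)"
  unfolding lin_def mmul_def sum_distrib_left sum_distrib_right mult.assoc
  by (rule ext, rule sum.swap)

lemma sq_mat_mult_vec: "sq_mat n A *\<^sub>v vec n x = vec n (lin n A x)"
  by (rule eq_vecI) (auto simp: sq_mat_def scalar_prod_def lin_def atLeast0LessThan)

lemma mdet_neq_0_if_inj:
  fixes A :: "nat \<Rightarrow> nat \<Rightarrow> 'k::field"
  assumes "\<And>x. (\<And>i. i < n \<Longrightarrow> lin n A x i = 0) \<Longrightarrow> (\<And>j. j < n \<Longrightarrow> x j = 0)"
  shows "mdet n A \<noteq> 0"
proof
  assume "mdet n A = 0"
  then obtain v where v: "v \<in> carrier_vec n" "v \<noteq> 0\<^sub>v n" "sq_mat n A *\<^sub>v v = 0\<^sub>v n"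
    using det_0_iff_vec_prod_zero_field[OF sq_mat_carrier, of n A] by (auto simp: det_sq_mat)
  have "v = vec n (\<lambda>i. v $ i)" using v(1) by auto
  with v(3) have "vec n (lin n A (\<lambda>i. v $ i)) = 0\<^sub>v n" using sq_mat_mult_vec by metis
  then have "lin n A (\<lambda>i. v $ i) i = 0" if "i < n" for i using that by (metis index_vec index_zero_vec(1))
  from assms[OF this] have "v $ j = 0" if "j < n" for j using that by blast
  then have "v = 0\<^sub>v n" using v(1) by auto
  with v(2) show False by simp
qed

text \<open>The equations are limited to indices below \<open>n\<close> because \<open>lin\<close>
  also reads the rows of \<open>A\<close> beyond \<open>n\<close>. The product of determinants is
  what places conjugated diagonal matrices in SL(n).\<close>

lemma mdet_neq_0_inverse:
  fixes A :: "nat \<Rightarrow> nat \<Rightarrow> 'k::field"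
  assumes "mdet n A \<noteq> 0"
  shows "\<exists>B. (\<forall>x. \<forall>i<n. lin n A (lin n B x) i = x i) \<and>
    (\<forall>x. \<forall>i<n. lin n B (lin n A x) i = x i) \<and> mdet n A * mdet n B = 1"
proof -
  from det_non_zero_imp_unit[OF sq_mat_carrier, of n A] assms
  have "sq_mat n A \<in> Units (ring_mat TYPE('k) n undefined)" by (simp add: det_sq_mat)
  then obtain C where C: "C \<in> carrier_mat n n" "C * sq_mat n A = 1\<^sub>m n" "sq_mat n A * C = 1\<^sub>m n"
    unfolding Units_def ring_mat_def by auto
  define B where "B i j = C $$ (i, j)" for i j
  have CB: "C = sq_mat n B" using C(1) by (auto simp: sq_mat_def B_def)
  have *: "lin n X (lin n Y x) i = x i" if "sq_mat n X * sq_mat n Y = 1\<^sub>m n" "i < n" for X Y x i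
  proof -
    have "vec n (lin n X (lin n Y x)) = sq_mat n X *\<^sub>v (sq_mat n Y *\<^sub>v vec n x)" by (simp add: sq_mat_mult_vec)
    also have "\<dots> = (sq_mat n X * sq_mat n Y) *\<^sub>v vec n x"
      by (rule assoc_mult_mat_vec[symmetric, of _ n n _ n]) auto
    also have "\<dots> = vec n x" using that by simp
    finally show ?thesis using that(2) by (metis index_vec)
  qed
  have "mdet n A * mdet n B = 1"
    using det_mult[OF sq_mat_carrier C(1), of A] C(3) by (simp add: CB det_sq_mat)
  moreover have "\<forall>x. \<forall>i<n. lin n A (lin n B x) i = x i" "\<forall>x. \<forall>i<n. lin n B (lin n A x) i = x i"
    using *[OF C(3)[unfolded CB]] *[OF C(2)[unfolded CB]] by blast+
  ultimately show ?thesis by blast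
qed

lemma ex_eigenvector:
  fixes A :: "nat \<Rightarrow> nat \<Rightarrow> 'k::field"
  assumes "alg_closed TYPE('k)" "0 < n"
  shows "\<exists>a v. (\<forall>i<n. lin n A v i = a * v i) \<and> (\<exists>i<n. v i \<noteq> 0)"
proof -
  have "degree (char_poly (sq_mat n A)) = n" using degree_monic_char_poly[OF sq_mat_carrier] by blast
  then obtain a where "poly (char_poly (sq_mat n A)) a = 0"
    using assms unfolding alg_closed_def by metis
  then obtain v where "eigenvector (sq_mat n A) v a"
    using eigenvalue_root_char_poly[OF sq_mat_carrier] unfolding eigenvalue_def by blast
  then have v: "v \<in> carrier_vec n" "v \<noteq> 0\<^sub>v n" "sq_mat n A *\<^sub>v v = a \<cdot>\<^sub>v v"
    by (auto simp: eigenvector_def sq_mat_def)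
  have "v = vec n (\<lambda>i. v $ i)" using v(1) by auto
  with v(3) have "vec n (lin n A (\<lambda>i. v $ i)) = a \<cdot>\<^sub>v v" using sq_mat_mult_vec by metis
  then have "lin n A (\<lambda>i. v $ i) i = a * v $ i" if "i < n" for i
    using that v(1) by (metis index_vec index_smult_vec(1) carrier_vecD)
  moreover have "\<exists>i<n. v $ i \<noteq> 0" using v(1,2) by auto
  ultimately show ?thesis by blast
qed

text \<open>The determinant of A + t C is a polynomial in \<open>t\<close> that is nonzero at
  0.\<close>

lemma finite_singular_pencil:
  fixes A C :: "nat \<Rightarrow> nat \<Rightarrow> 'k::field"
  assumes "mdet n A \<noteq> 0"
  shows "finite {t. mdet n (\<lambda>i j. A i j + t * C i j) = 0}"
proof -
  define p where "p = (\<Sum>\<pi> | \<pi> permutes {..<n}. of_int (sign \<pi>) * (\<Prod>i<n. [:A i (\<pi> i), C i (\<pi> i):]))"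
  have p: "poly p t = mdet n (\<lambda>i j. A i j + t * C i j)" for t
    unfolding p_def mdet_def by (simp add: poly_sum poly_prod)
  have "p \<noteq> 0" using p[of 0] assms by auto
  then show ?thesis using poly_roots_finite[of p] by (simp add: p)
qed

subsection \<open>Bases of subspaces of the coordinate space\<close>

definition vscale :: "'k::field \<Rightarrow> (nat \<Rightarrow> 'k) \<Rightarrow> nat \<Rightarrow> 'k" where
  "vscale c v = (\<lambda>i. c * v i)"

global_interpretation kv: vector_space "vscale :: 'k::field \<Rightarrow> (nat \<Rightarrow> 'k) \<Rightarrow> nat \<Rightarrow> 'k"
  by unfold_locales (auto simp: vscale_def algebra_simps)

text \<open>k^n as functions vanishing beyond \<open>n\<close>, so that equality of vectors is
  equality of functions.\<close>

definition Kn :: "nat \<Rightarrow> (nat \<Rightarrow> 'k::field) set" where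
  "Kn n = {v. \<forall>i\<ge>n. v i = 0}"

lemma subspace_Kn: "kv.subspace (Kn n)"
  by (auto simp: kv.subspace_def Kn_def vscale_def)

definition lc :: "nat \<Rightarrow> (nat \<Rightarrow> nat \<Rightarrow> 'k::field) \<Rightarrow> (nat \<Rightarrow> 'k) \<Rightarrow> nat \<Rightarrow> 'k" where
  "lc m b c = (\<lambda>i. \<Sum>j<m. c j * b j i)"

text \<open>An ordered basis: its members serve as the columns of a coordinate change, which an
  unordered set could not.\<close>

definition basis_fam :: "(nat \<Rightarrow> 'k::field) set \<Rightarrow> nat \<Rightarrow> (nat \<Rightarrow> nat \<Rightarrow> 'k) \<Rightarrow> bool" where
  "basis_fam S m b \<longleftrightarrow> (\<forall>j<m. b j \<in> S) \<and> (\<forall>v\<in>S. \<exists>c. v = lc m b c) \<and>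
     (\<forall>c. lc m b c = (\<lambda>_. 0) \<longrightarrow> (\<forall>j<m. c j = 0))"

lemma lc_eq_sum: "lc m b c = (\<Sum>j<m. vscale (c j) (b j))"
  by (simp add: lc_def fun_eq_iff sum_fun_apply vscale_def)

lemma lc_mem: "kv.subspace S \<Longrightarrow> (\<And>j. j < m \<Longrightarrow> b j \<in> S) \<Longrightarrow> lc m b c \<in> S"
  unfolding lc_eq_sum by (intro kv.subspace_sum kv.subspace_scale) auto

lemma basis_fam_of_bij:
  fixes B :: "(nat \<Rightarrow> 'k::field) set"
  assumes "bij_betw b {..<m} B" "B \<subseteq> S" "S \<subseteq> kv.span B" "kv.independent B"
  shows "basis_fam S m b"
proof -
  have inj: "inj_on b {..<m}" and B: "B = b ` {..<m}" and "finite B"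
    using assms(1) by (auto simp: bij_betw_def)
  have "\<exists>c. v = lc m b c" if "v \<in> S" for v
  proof -
    have "v \<in> range (\<lambda>s. \<Sum>w\<in>B. vscale (s w) w)"
      using assms(3) that unfolding kv.span_finite[OF \<open>finite B\<close>] by blast
    then obtain s where "v = (\<Sum>w\<in>B. vscale (s w) w)" ..
    then have "v = lc m b (\<lambda>j. s (b j))"
      unfolding lc_eq_sum B by (simp add: sum.reindex[OF inj])
    then show ?thesis by blast
  qed
  moreover have "c j = 0" if c: "lc m b c = (\<lambda>_. 0)" and j: "j < m" for c j
  proof -
    define s where "s w = c (the_inv_into {..<m} b w)" for w
    have "(\<Sum>w\<in>B. vscale (s w) w) = 0"
      using c unfolding lc_eq_sum B sum.reindex[OF inj]
      by (simp add: s_def the_inv_into_f_f[OF inj] zero_fun_def)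
    then have "s (b j) = 0"
      by (rule kv.independentD[OF assms(4) \<open>finite B\<close> subset_refl]) (use B j in auto)
    then show ?thesis using j by (simp add: s_def the_inv_into_f_f[OF inj])
  qed
  moreover have "b j \<in> S" if "j < m" for j using that B assms(2) by auto
  ultimately show ?thesis unfolding basis_fam_def by blast
qed

lemma basis_fam_dim:
  fixes b :: "nat \<Rightarrow> nat \<Rightarrow> 'k::field"
  assumes "basis_fam S m b"
  shows "kv.dim S = m"
proof -
  have ind: "\<And>c j. lc m b c = (\<lambda>_. 0) \<Longrightarrow> j < m \<Longrightarrow> c j = 0" using assms by (auto simp: basis_fam_def)
  have inj: "inj_on b {..<m}"
  proof (rule inj_onI, rule ccontr)
    fix i j assume ij: "i \<in> {..<m}" "j \<in> {..<m}" "b i = b j" "i \<noteq> j"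
    have "lc m b (\<lambda>k. (if k = i then 1 else 0) - (if k = j then 1 else 0)) = (\<lambda>_. 0)"
      using ij by (simp add: lc_def left_diff_distrib sum_subtractf if_distrib[of "\<lambda>x. x * _"] cong: if_cong)
    from ind[OF this, of i] ij show False by simp
  qed
  have "kv.independent (b ` {..<m})"
  proof (rule kv.independent_if_scalars_zero)
    fix s w assume s: "(\<Sum>w\<in>b ` {..<m}. vscale (s w) w) = 0" and "w \<in> b ` {..<m}"
    then obtain j where j: "j < m" "w = b j" by auto
    have "lc m b (\<lambda>j. s (b j)) = (\<lambda>_. 0)"
      unfolding lc_eq_sum using s by (simp add: sum.reindex[OF inj] zero_fun_def)
    from ind[OF this j(1)] j(2) show "s w = 0" by simp
  qed simp
  moreover have "S \<subseteq> kv.span (b ` {..<m})"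
  proof
    fix v assume "v \<in> S"
    then obtain c where "v = lc m b c" using assms by (auto simp: basis_fam_def)
    then show "v \<in> kv.span (b ` {..<m})"
      unfolding lc_eq_sum by (auto intro!: kv.span_sum kv.span_scale intro: kv.span_base)
  qed
  moreover have "b ` {..<m} \<subseteq> S" using assms by (auto simp: basis_fam_def)
  ultimately have "card (b ` {..<m}) = kv.dim S" by (intro kv.basis_card_eq_dim)
  then show ?thesis using card_image[OF inj] by simp
qed

lemma basis_fam_Kn: "basis_fam (Kn n :: (nat \<Rightarrow> 'k::field) set) n unit_fun"
proof -
  have lc: "lc n unit_fun c i = (if i < n then c i else 0)" for c :: "nat \<Rightarrow> 'k" and i
    unfolding lc_def by (simp add: if_distrib[of "\<lambda>x. _ * x"] cong: if_cong)
  have "v = lc n unit_fun v" if "v \<in> Kn n" for v :: "nat \<Rightarrow> 'k"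
    using that by (auto simp: Kn_def fun_eq_iff lc)
  moreover have "c j = 0" if "lc n unit_fun c = (\<lambda>_. 0)" "j < n" for c :: "nat \<Rightarrow> 'k" and j
    using lc[of c j] that by simp
  ultimately show ?thesis unfolding basis_fam_def by (auto simp: Kn_def)
qed

text \<open>One family serves both spaces: its first \<open>l\<close> members span \<open>S\<close>.
  This yields the dimension comparisons here and the bases adapted to im N inside ker N
  later.\<close>

lemma ex_basis_fam_extend:
  fixes S T :: "(nat \<Rightarrow> 'k::field) set"
  assumes "S \<subseteq> T" "T \<subseteq> Kn n"
  obtains l m b where "l \<le> m" "basis_fam S l b" "basis_fam T m b"
proof -
  obtain B where B: "B \<subseteq> S" "kv.independent B" "S \<subseteq> kv.span B"
    using kv.maximal_independent_subset[of S] by blast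
  obtain C where C: "B \<subseteq> C" "C \<subseteq> T" "kv.independent C" "T \<subseteq> kv.span C"
    using kv.maximal_independent_subset_extend[of B T] B assms by blast
  \<comment> \<open>A finite spanning set of the surrounding space bounds every independent set and
    so makes \<open>C\<close> finite.\<close>
  have "Kn n \<subseteq> kv.span (unit_fun ` {..<n} :: (nat \<Rightarrow> 'k) set)"
  proof
    fix v :: "nat \<Rightarrow> 'k" assume "v \<in> Kn n"
    then obtain c where "v = lc n unit_fun c" using basis_fam_Kn[of n] unfolding basis_fam_def by blast
    then show "v \<in> kv.span (unit_fun ` {..<n})"
      unfolding lc_eq_sum by (auto intro!: kv.span_sum kv.span_scale intro: kv.span_base)
  qed
  then have finC: "finite C"
    using kv.independent_span_bound[of "unit_fun ` {..<n}" C] C(2,3) assms(2) by blast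
  then have finB: "finite B" using C(1) finite_subset by blast
  obtain b1 where b1: "bij_betw b1 {..<card B} B"
    using ex_bij_betw_nat_finite[OF finB] by (auto simp: atLeast0LessThan)
  obtain b2 where b2: "bij_betw b2 {..<card (C - B)} (C - B)"
    using ex_bij_betw_nat_finite[of "C - B"] finC by (auto simp: atLeast0LessThan)
  define b where "b j = (if j < card B then b1 j else b2 (j - card B))" for j
  have card: "card C = card B + card (C - B)" using C(1) finC finB card_mono[OF finC C(1)] by (simp add: card_Diff_subset)
  have 1: "bij_betw b {..<card B} B"
    using b1 by (rule bij_betw_cong[THEN iffD1, rotated]) (simp add: b_def)
  have sh: "bij_betw (\<lambda>j. j - card B) {card B..<card C} {..<card (C - B)}"
    by (rule bij_betw_byWitness[of _ "\<lambda>j. j + card B"]) (auto simp: card)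
  have 2: "bij_betw b {card B..<card C} (C - B)"
    using bij_betw_trans[OF sh b2] by (rule bij_betw_cong[THEN iffD1, rotated]) (auto simp: b_def)
  have "bij_betw b ({..<card B} \<union> {card B..<card C}) (B \<union> (C - B))"
    using bij_betw_combine[OF 1 2] by auto
  moreover have "{..<card B} \<union> {card B..<card C} = {..<card C}" using card by auto
  moreover have "B \<union> (C - B) = C" using C(1) by auto
  ultimately have 3: "bij_betw b {..<card C} C" by simp
  show thesis
  proof (rule that)
    show "card B \<le> card C" using card by simp
    show "basis_fam S (card B) b" by (rule basis_fam_of_bij[OF 1 B(1,3,2)])
    show "basis_fam T (card C) b" by (rule basis_fam_of_bij[OF 3 C(2,4,3)])
  qed
qed

lemma kv_dim_mono:
  assumes "S \<subseteq> T" "T \<subseteq> Kn n"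
  shows "kv.dim S \<le> kv.dim T"
  using ex_basis_fam_extend[OF assms] basis_fam_dim by metis

lemma kv_dim_eq:
  assumes "S \<subseteq> T" "T \<subseteq> Kn n" "kv.subspace S" "kv.dim S = kv.dim T"
  shows "S = T"
proof -
  obtain l m b where b: "l \<le> m" "basis_fam S l b" "basis_fam T m b"
    using ex_basis_fam_extend[OF assms(1,2)] by blast
  then have "l = m" using assms(4) basis_fam_dim by metis
  have "v \<in> S" if "v \<in> T" for v
  proof -
    obtain c where "v = lc m b c" using b(3) \<open>v \<in> T\<close> by (auto simp: basis_fam_def)
    then show ?thesis using lc_mem[OF assms(3), of m b c] b(2) \<open>l = m\<close> by (auto simp: basis_fam_def)
  qed
  with assms(1) show ?thesis by blast
qed

lemma mdet_basis_fam:
  assumes "basis_fam (Kn n) n b"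
  shows "mdet n (\<lambda>i j. b j i) \<noteq> 0"
proof (rule mdet_neq_0_if_inj)
  fix x :: "nat \<Rightarrow> 'a" and j assume x: "\<And>i. i < n \<Longrightarrow> lin n (\<lambda>i j. b j i) x i = 0" and j: "j < n"
  have "lc n b x i = 0" for i
  proof (cases "i < n")
    case True
    with x[OF this] show ?thesis by (simp add: lin_def lc_def mult.commute)
  next
    case False
    moreover have "lc n b x \<in> Kn n" using assms by (intro lc_mem subspace_Kn) (auto simp: basis_fam_def)
    ultimately show ?thesis by (simp add: Kn_def)
  qed
  with j assms show "x j = 0" unfolding basis_fam_def by (metis ext)
qed

lemma lin_basis_fam: "lin n (\<lambda>i j. b j i) x = lc n b x"
  by (simp add: lin_def lc_def mult.commute)

section \<open>Translation invariance and concatenated bases\<close>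

lemma dv_0 [simp]: "dv n 0 f = (\<lambda>_. 0)"
  by (simp add: dv_def)

lemma dv_lc: "dv n (lc m b c) f = (\<lambda>\<mu>. \<Sum>j<m. c j * dv n (b j) f \<mu>)"
  unfolding dv_def lc_def sum_distrib_left sum_distrib_right mult.assoc
  by (rule ext, rule sum.swap)

text \<open>Degree 0 is included because the lemma is applied to first derivatives, which are
  constants when d = 0.\<close>

lemma feval_invariant:
  fixes f :: "'k::field form"
  assumes "of_nat (fact e) \<noteq> (0::'k)" "form n e f" "dv n v f = (\<lambda>_. 0)"
  shows "feval n f (x + v) = feval n f x"
proof (cases e)
  case 0
  then show ?thesis using feval_form[of n 0 f] assms(2) by (simp add: coeff_idx_0)
next
  case (Suc d)
  then show ?thesis
    using feval_invariant_if_dv_0[of d n f v x 1] assms by (simp add: plus_fun_def)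
qed

lemma dv_eq_0_if_invariant:
  fixes f :: "'k::field form"
  assumes inf: "infinite (UNIV :: 'k set)" and ch: "of_nat (fact (Suc e)) \<noteq> (0::'k)" and f: "form n (Suc e) f"
    and "\<And>x t. x \<in> Kn n \<Longrightarrow> feval n f (x + vscale t v) = feval n f x"
  shows "dv n v f = (\<lambda>_. 0)"
proof (rule form_eq_0_if_feval_0[OF inf _ form_dv[OF f]])
  show "of_nat (fact e) \<noteq> (0::'k)" using fact_neq_0_le[OF ch] by simp
  fix x :: "nat \<Rightarrow> 'k"
  have "feval n (dv n v f) x = feval n (dv n (\<lambda>_. 0) f) x"
  proof (rule feval_dv_eqI[OF inf f f])
    fix t
    \<comment> \<open>Truncation to the first \<open>n\<close> coordinates does not change values
      but moves the point into \<open>Kn n\<close>, where invariance is assumed.\<close>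
    let ?y = "\<lambda>i. if i < n then x i else 0"
    have "feval n f (\<lambda>i. x i + t * v i) = feval n f (?y + vscale t v)"
      by (rule feval_cong) (simp add: vscale_def)
    also have "\<dots> = feval n f ?y" by (rule assms(4)) (simp add: Kn_def)
    also have "\<dots> = feval n f (\<lambda>i. x i + t * 0)" by (rule feval_cong) simp
    finally show "feval n f (\<lambda>i. x i + t * v i) = feval n f (\<lambda>i. x i + t * 0)" .
  qed
  then show "feval n (dv n v f) x = 0" by simp
qed

lemma polyfun_lc:
  assumes "form n e f"
  obtains h where "form m e h" "\<And>x. feval m h x = feval n f (lc m b x)"
proof -
  have "polyfun m e (\<lambda>x. feval n f (lc m b x))"
    using polyfun_linear_subst[OF assms, of m "\<lambda>i j. b j i"] by (simp add: lc_def mult.commute)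
  with that show thesis unfolding polyfun_def by metis
qed

definition fam_append :: "nat \<Rightarrow> (nat \<Rightarrow> 'a) \<Rightarrow> (nat \<Rightarrow> 'a) \<Rightarrow> nat \<Rightarrow> 'a" where
  "fam_append m a b = (\<lambda>j. if j < m then a j else b (j - m))"

lemma fam_append_simps [simp]:
  "j < m \<Longrightarrow> fam_append m a b j = a j" "fam_append m a b (m + j) = b j"
  by (auto simp: fam_append_def)

lemma fam_append_cases:
  assumes "j < m + (k::nat)"
  obtains "j < m" | i where "j = m + i" "i < k"
  using assms by (metis add_less_cancel_left le_add_diff_inverse not_le)

lemma sum_lessThan_add: "(\<Sum>j<m + k. F j) = (\<Sum>j<m. F j) + (\<Sum>j<k. F (m + j))" for F :: "nat \<Rightarrow> 'a::comm_monoid_add"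
  by (induction k) (simp_all add: add.assoc)

lemma lc_append: "lc (m + k) (fam_append m a b) c = lc m a c + lc k b (\<lambda>j. c (m + j))"
  by (simp add: lc_def fun_eq_iff sum_lessThan_add)

lemma lc_cong: "(\<And>j. j < m \<Longrightarrow> c j = c' j) \<Longrightarrow> (\<And>j. j < m \<Longrightarrow> b j = b' j) \<Longrightarrow> lc m b c = lc m b' c'"
  by (simp add: lc_def)

lemma lc_append_coeffs:
  "lc (m + k) (fam_append m a b) (fam_append m c c') = lc m a c + lc k b c'"
  unfolding lc_append by (intro arg_cong2[of _ _ _ _ "(+)"] lc_cong) auto

lemma lc_zero: "(\<And>j. j < m \<Longrightarrow> c j = 0) \<Longrightarrow> lc m b c = 0"
  by (simp add: lc_def fun_eq_iff)

lemma basis_famI: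
  assumes "\<And>j. j < m \<Longrightarrow> b j \<in> S" "\<And>v. v \<in> S \<Longrightarrow> \<exists>c. v = lc m b c"
    "\<And>c j. lc m b c = 0 \<Longrightarrow> j < m \<Longrightarrow> c j = 0"
  shows "basis_fam S m b"
  using assms unfolding basis_fam_def zero_fun_def by blast

lemma basis_famD:
  assumes "basis_fam S m b"
  shows "j < m \<Longrightarrow> b j \<in> S" "v \<in> S \<Longrightarrow> \<exists>c. v = lc m b c" "lc m b c = 0 \<Longrightarrow> j < m \<Longrightarrow> c j = 0"
  using assms unfolding basis_fam_def zero_fun_def by blast+

lemma ex_basis_fam:
  assumes "S \<subseteq> Kn n"
  obtains m b where "basis_fam S m b"
  using ex_basis_fam_extend[OF subset_refl assms] by blast

lemma Kn_card:
  fixes b :: "nat \<Rightarrow> nat \<Rightarrow> 'k::field"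
  assumes "basis_fam (Kn n) m b"
  shows "m = n"
  using basis_fam_dim[OF assms] basis_fam_dim[OF basis_fam_Kn[of n, where ?'k = 'k]] by simp

subsection \<open>A criterion for direct sums\<close>

text \<open>Hessian orthogonality makes the derivative along \<open>u\<close> in \<open>U\<close>
  insensitive to translation by \<open>w\<close> in \<open>W\<close>; integrating along
  \<open>u\<close> gives f(u + w) = f(u) + f(w). The summands are the restrictions to bases of
  \<open>U\<close> and \<open>W\<close>.\<close>

lemma direct_sum_if_orthogonal:
  fixes f :: "'k::field form"
  assumes inf: "infinite (UNIV :: 'k set)" and ch: "of_nat (fact (Suc e)) \<noteq> (0::'k)" and f: "form n (Suc e) f"
    and ind: "indep_grad n f"
    and U: "kv.subspace U" "U \<subseteq> Kn n" "u0 \<in> U" "u0 \<noteq> 0"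
    and W: "kv.subspace W" "W \<subseteq> Kn n" "w0 \<in> W" "w0 \<noteq> 0"
    and sum: "\<And>x. x \<in> Kn n \<Longrightarrow> \<exists>u\<in>U. \<exists>w\<in>W. x = u + w" and disj: "U \<inter> W = {0}"
    and orth: "\<And>u w. u \<in> U \<Longrightarrow> w \<in> W \<Longrightarrow> dv n u (dv n w f) = (\<lambda>_. 0)"
  shows "direct_sum n (Suc e) f"
proof -
  note fd = form_dv[OF f]
  have ch': "of_nat (fact e) \<noteq> (0::'k)" using fact_neq_0_le[OF ch] by simp
  have split: "feval n f (u + w) = feval n f u + feval n f w" if u: "u \<in> U" and w: "w \<in> W" for u w
  proof -
    \<comment> \<open>This is t -> f(w + t u) - f(t u). Its derivative vanishes, so it can be
      compared at t = 1 and t = 0; f(0) = 0 since the degree is positive.\<close>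
    let ?p = "line_poly n (Suc e) f w u - line_poly n (Suc e) f 0 u"
    have "feval n (dv n u f) (\<lambda>i. w i + t * u i) = feval n (dv n u f) (\<lambda>i. 0 + t * u i)" for t
    proof -
      have "dv n w (dv n u f) = (\<lambda>_. 0)" using orth[OF u w] by (simp add: dv_commute)
      from feval_invariant[OF ch' fd this, of "vscale t u"] show ?thesis
        by (simp add: plus_fun_def vscale_def add.commute)
    qed
    then have "line_poly n e (dv n u f) w u = line_poly n e (dv n u f) 0 u"
      by (intro poly_eqI_infinite[OF inf]) (simp add: poly_line_poly[OF fd])
    then have "pderiv ?p = 0" by (simp add: pderiv_diff pderiv_line_poly[OF f])
    moreover have "degree ?p \<le> Suc e" by (intro degree_diff_le degree_line_poly)
    ultimately obtain c where "?p = [:c:]" using pderiv_eq_0_imp_const[OF ch] by metis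
    then have "poly ?p 1 = poly ?p 0" by simp
    then have "feval n f (w + u) - feval n f u = feval n f w - feval n f (\<lambda>_. 0)"
      by (simp add: poly_line_poly[OF f] plus_fun_def)
    then show ?thesis using feval_at_zero[OF f] by (simp add: add.commute algebra_simps)
  qed
  \<comment> \<open>If \<open>f\<close> vanished on \<open>U\<close>, it would be invariant under
    translation along \<open>u0\<close>, against independence of the partials. The spaces are
    quantified anew because their roles are exchanged for the second summand.\<close>
  have nonzero: "\<exists>u\<in>U. feval n f u \<noteq> 0"
    if U: "kv.subspace U" "U \<subseteq> Kn n" "u0 \<in> U" "u0 \<noteq> 0"
      and sum: "\<And>x. x \<in> Kn n \<Longrightarrow> \<exists>u\<in>U. \<exists>w\<in>W. x = u + w"
      and split: "\<And>u w. u \<in> U \<Longrightarrow> w \<in> W \<Longrightarrow> feval n f (u + w) = feval n f u + feval n f w"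
    for U W u0
  proof (rule ccontr)
    assume "\<not> ?thesis"
    then have 0: "\<And>u. u \<in> U \<Longrightarrow> feval n f u = 0" by blast
    have "dv n u0 f = (\<lambda>_. 0)"
    proof (rule dv_eq_0_if_invariant[OF inf ch f])
      fix x :: "nat \<Rightarrow> 'k" and t assume "x \<in> Kn n"
      then obtain u w where uw: "u \<in> U" "w \<in> W" "x = u + w" using sum by blast
      have u': "u + vscale t u0 \<in> U" using U(1,3) uw(1) by (intro kv.subspace_add kv.subspace_scale)
      have "feval n f (x + vscale t u0) = feval n f ((u + vscale t u0) + w)" by (simp add: uw(3) add_ac)
      also have "\<dots> = feval n f x" using split[OF u' uw(2)] split[OF uw(1,2)] 0[OF u'] 0[OF uw(1)] uw(3) by simp
      finally show "feval n f (x + vscale t u0) = feval n f x" .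
    qed
    then have "\<forall>i<n. u0 i = 0" using ind by (auto simp: indep_grad_def)
    moreover have "\<forall>i\<ge>n. u0 i = 0" using U by (auto simp: Kn_def)
    ultimately have "u0 = 0" by (auto simp: fun_eq_iff) (meson not_le)
    with U(4) show False by simp
  qed
  obtain m a where a: "basis_fam U m a" using ex_basis_fam[OF U(2)] .
  obtain k b where b: "basis_fam W k b" using ex_basis_fam[OF W(2)] .
  let ?c = "fam_append m a b"
  have lcU: "lc m a c \<in> U" for c by (rule lc_mem[OF U(1)]) (rule basis_famD[OF a])
  have lcW: "lc k b c \<in> W" for c by (rule lc_mem[OF W(1)]) (rule basis_famD[OF b])
  have basis: "basis_fam (Kn n) (m + k) ?c"
  proof (rule basis_famI)
    fix j assume "j < m + k"
    then show "?c j \<in> Kn n"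
      by (cases rule: fam_append_cases) (use basis_famD(1)[OF a] basis_famD(1)[OF b] U(2) W(2) in auto)
  next
    fix v :: "nat \<Rightarrow> 'k" assume "v \<in> Kn n"
    then obtain u w where uw: "u \<in> U" "w \<in> W" "v = u + w" using sum by blast
    obtain c c' where "u = lc m a c" "w = lc k b c'"
      using basis_famD(2)[OF a uw(1)] basis_famD(2)[OF b uw(2)] by blast
    then have "v = lc (m + k) ?c (fam_append m c c')" using uw(3) by (simp add: lc_append_coeffs)
    then show "\<exists>c. v = lc (m + k) ?c c" by blast
  next
    fix c j assume c: "lc (m + k) ?c c = 0" and j: "j < m + k"
    let ?u = "lc m a c" and ?w = "lc k b (\<lambda>j. c (m + j))"
    have uw: "?u + ?w = 0" using c by (simp add: lc_append)
    then have "?u = - ?w" by (simp add: eq_neg_iff_add_eq_0)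
    then have "?u \<in> W" using kv.subspace_neg[OF W(1) lcW] by metis
    then have u: "?u = 0" using disj lcU by blast
    with uw have w: "?w = 0" by simp
    from j show "c j = 0"
      by (cases rule: fam_append_cases) (use basis_famD(3)[OF a u] basis_famD(3)[OF b w] in auto)
  qed
  then have n: "m + k = n" by (rule Kn_card)
  obtain f1 where f1: "form m (Suc e) f1" "\<And>x. feval m f1 x = feval n f (lc m a x)"
    using polyfun_lc[OF f] by blast
  obtain f2 where f2: "form k (Suc e) f2" "\<And>x. feval k f2 x = feval n f (lc k b x)"
    using polyfun_lc[OF f] by blast
  have "f1 \<noteq> (\<lambda>_. 0)"
  proof
    assume "f1 = (\<lambda>_. 0)"
    then have 0: "feval n f (lc m a x) = 0" for x using f1(2)[of x] by simp
    obtain u where "u \<in> U" "feval n f u \<noteq> 0" using nonzero[OF U sum split] by blast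
    then show False using basis_famD(2)[OF a] 0 by metis
  qed
  moreover have "f2 \<noteq> (\<lambda>_. 0)"
  proof
    assume "f2 = (\<lambda>_. 0)"
    then have 0: "feval n f (lc k b x) = 0" for x using f2(2)[of x] by simp
    have sum': "\<exists>w\<in>W. \<exists>u\<in>U. x = w + u" if "x \<in> Kn n" for x using sum[OF that] by (metis add.commute)
    have split': "feval n f (w + u) = feval n f w + feval n f u" if "w \<in> W" "u \<in> U" for u w
      using split[OF that(2,1)] by (simp add: add.commute)
    obtain w where "w \<in> W" "feval n f w \<noteq> 0" using nonzero[OF W sum' split'] by blast
    then show False using basis_famD(2)[OF b] 0 by metis
  qed
  moreover have "feval n f (lin n (\<lambda>i j. ?c j i) x) = feval m f1 x + feval (n - m) f2 (\<lambda>j. x (m + j))" for x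
  proof -
    have "n - m = k" using n by simp
    then show ?thesis
      unfolding lin_basis_fam f1(2) n[symmetric] lc_append by (simp add: n split[OF lcU lcW] f2(2))
  qed
  moreover have "mdet n (\<lambda>i j. ?c j i) \<noteq> 0" using mdet_basis_fam basis n by blast
  moreover have "form (n - m) (Suc e) f2" "m \<le> n" using f2(1) n by auto
  ultimately show ?thesis unfolding direct_sum_def using f1(1) by blast
qed

subsection \<open>A criterion for LDS forms\<close>

text \<open>Poincare lemma for forms: Euler's identity dictates the primitive, the sum of x_i h_i
  divided by d + 1.\<close>

lemma ex_primitive:
  fixes h :: "nat \<Rightarrow> 'k::field form"
  assumes ch: "of_nat (Suc d) \<noteq> (0::'k)" and h: "\<And>i. i < n \<Longrightarrow> form n d (h i)"
    and closed: "\<And>i j. i < n \<Longrightarrow> j < n \<Longrightarrow> pderiv_form j (h i) = pderiv_form i (h j)"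
  obtains g where "form n (Suc d) g" "\<And>i. i < n \<Longrightarrow> pderiv_form i g = h i"
proof -
  define g where "g = (\<lambda>m. inverse (of_nat (Suc d)) * (\<Sum>i<n. xmul i (h i) m))"
  have "pderiv_form j g = h j" if j: "j < n" for j
  proof (rule ext)
    fix m
    let ?m = "m(j := Suc (m j))"
    \<comment> \<open>Closedness trades the j-th partial of \<open>h i\<close> for the i-th partial
      of \<open>h j\<close>, so that each summand is a multiple of \<open>h j m\<close>. The
      multipliers add up to 1 plus the degree of \<open>m\<close>, which is d + 1 wherever
      \<open>h j m\<close> is nonzero.\<close>
    have summand: "of_nat (Suc (m j)) * xmul i (h i) ?m = of_nat (if i = j then Suc (m i) else m i) * h j m" if i: "i < n" for i
    proof (cases "i = j")
      case True
      then show ?thesis by (simp add: xmul_def)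
    next
      case False
      show ?thesis
      proof (cases "m i")
        case 0
        with False show ?thesis by (simp add: xmul_def)
      next
        case (Suc p)
        let ?m' = "m(i := p)"
        have "?m(i := p) = ?m'(j := Suc (?m' j))" using False by (simp add: fun_upd_twist)
        then have "of_nat (Suc (m j)) * xmul i (h i) ?m = pderiv_form j (h i) ?m'"
          using False Suc by (simp add: xmul_def pderiv_form_def)
        also have "\<dots> = pderiv_form i (h j) ?m'" by (simp add: closed[OF i j])
        also have "?m'(i := Suc (?m' i)) = m" using Suc by auto
        then have "pderiv_form i (h j) ?m' = of_nat (m i) * h j m" using Suc by (simp add: pderiv_form_def)
        finally show ?thesis using False by simp
      qed
    qed
    have "(\<Sum>i<n. if i = j then Suc (m i) else m i) = (\<Sum>i<n. m i + (if i = j then 1 else 0))"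
      by (rule sum.cong) auto
    also have "\<dots> = Suc (\<Sum>i<n. m i)" using j by (simp add: sum.distrib)
    finally have s: "(\<Sum>i<n. if i = j then Suc (m i) else m i) = Suc (\<Sum>i<n. m i)" .
    have "pderiv_form j g m = inverse (of_nat (Suc d)) * (\<Sum>i<n. of_nat (Suc (m j)) * xmul i (h i) ?m)"
      by (simp add: pderiv_form_def g_def sum_distrib_left mult_ac)
    also have "\<dots> = inverse (of_nat (Suc d)) * (of_nat (Suc (\<Sum>i<n. m i)) * h j m)"
      by (simp add: summand sum_distrib_right[symmetric] of_nat_sum[symmetric] s del: of_nat_Suc of_nat_sum)
    also have "\<dots> = h j m"
    proof (cases "h j m = 0")
      case False
      then have "(\<Sum>i<n. m i) = d" using h[OF j] by (auto simp: form_iff coeff_idx_def)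
      then show ?thesis using ch by (simp del: of_nat_Suc)
    qed simp
    finally show "pderiv_form j g m = h j m" .
  qed
  moreover have "form n (Suc d) g"
    unfolding g_def by (intro form_cmult form_sum form_xmul h) auto
  ultimately show thesis using that by blast
qed

section \<open>Linear operators and the LDS normal form\<close>

definition linop :: "nat \<Rightarrow> ((nat \<Rightarrow> 'k::field) \<Rightarrow> (nat \<Rightarrow> 'k)) \<Rightarrow> bool" where
  "linop n N \<longleftrightarrow> (\<forall>u v. N (u + v) = N u + N v) \<and> (\<forall>c v. N (vscale c v) = vscale c (N v)) \<and> (\<forall>v\<in>Kn n. N v \<in> Kn n)"

lemma linop_add: "linop n N \<Longrightarrow> N (u + v) = N u + N v"
  and linop_scale: "linop n N \<Longrightarrow> N (vscale c v) = vscale c (N v)"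
  and linop_Kn: "linop n N \<Longrightarrow> v \<in> Kn n \<Longrightarrow> N v \<in> Kn n"
  by (auto simp: linop_def)

lemma linop_0: "linop n N \<Longrightarrow> N 0 = 0"
  using linop_scale[of n N 0 0] by (simp add: kv.scale_zero_left)

lemma linop_diff: "linop n N \<Longrightarrow> N (u - v) = N u - N v"
  using linop_add[of n N "u - v" v] by (simp add: algebra_simps)

lemma linop_sum: "linop n N \<Longrightarrow> N (\<Sum>i\<in>I. F i) = (\<Sum>i\<in>I. N (F i))"
  by (induction I rule: infinite_finite_induct) (auto simp: linop_0 linop_add)

lemma linop_lc: "linop n N \<Longrightarrow> N (lc m b c) = lc m (\<lambda>j. N (b j)) c"
  by (simp add: lc_eq_sum linop_sum linop_scale)

lemma linop_funpow: "linop n N \<Longrightarrow> linop n (N ^^ r)"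
  by (induction r) (auto simp: linop_def)

lemma subspace_ker: "linop n N \<Longrightarrow> kv.subspace {v \<in> Kn n. N v = 0}"
  using subspace_Kn[of n] by (auto simp: kv.subspace_def linop_0 linop_add linop_scale kv.scale_zero_right)

lemma subspace_im: "linop n N \<Longrightarrow> kv.subspace (N ` Kn n)"
  unfolding kv.subspace_def
proof (intro conjI ballI allI)
  assume N: "linop n N"
  show "0 \<in> N ` Kn n" using linop_0[OF N] kv.subspace_0[OF subspace_Kn, of n] by force
  show "x + y \<in> N ` Kn n" if "x \<in> N ` Kn n" "y \<in> N ` Kn n" for x y
    using that by (auto simp: linop_add[OF N, symmetric] intro!: imageI kv.subspace_add[OF subspace_Kn])
  show "vscale c x \<in> N ` Kn n" if "x \<in> N ` Kn n" for c x
    using that by (auto simp: linop_scale[OF N, symmetric] intro!: imageI kv.subspace_scale[OF subspace_Kn])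
qed

text \<open>The primitive \<open>g\<close> is invariant under ker N, because its derivative along
  \<open>v\<close> is that of \<open>f\<close> along \<open>N v\<close>. So \<open>g\<close> depends
  only on coordinates of V / ker N, which has dimension \<open>l\<close> = dim im N; this gives
  \<open>H\<close> in \<open>l\<close> variables.\<close>

lemma LDS_if_square_zero:
  fixes f :: "'k::field form"
  assumes inf: "infinite (UNIV :: 'k set)" and ch: "of_nat (fact (Suc d)) \<noteq> (0::'k)" and f: "form n (Suc d) f"
    and N: "linop n N" and N2: "\<And>v. v \<in> Kn n \<Longrightarrow> N (N v) = 0" and v0: "v0 \<in> Kn n" "N v0 \<noteq> 0"
    and sym: "\<And>u v. u \<in> Kn n \<Longrightarrow> v \<in> Kn n \<Longrightarrow> dv n v (dv n (N u) f) = dv n u (dv n (N v) f)"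
  shows "LDS n d f"
proof -
  have ch': "of_nat (fact d) \<noteq> (0::'k)" using fact_neq_0_le[OF ch] by simp
  have unit: "(unit_fun i :: nat \<Rightarrow> 'k) \<in> Kn n" if "i < n" for i using that by (auto simp: Kn_def)
  obtain g where g: "form n (Suc d) g" "\<And>i. i < n \<Longrightarrow> pderiv_form i g = dv n (N (unit_fun i)) f"
  proof (rule ex_primitive[of d n "\<lambda>i. dv n (N (unit_fun i)) f"])
    show "of_nat (Suc d) \<noteq> (0::'k)" by (rule of_nat_neq_0_of_fact[OF ch]) auto
    show "form n d (dv n (N (unit_fun i)) f)" for i by (rule form_dv[OF f])
    \<comment> \<open>The assumed symmetry is exactly closedness of the one-form.\<close>
    show "pderiv_form j (dv n (N (unit_fun i)) f) = pderiv_form i (dv n (N (unit_fun j)) f)" if "i < n" "j < n" for i j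
      using sym[OF unit unit, OF that] that by (simp add: dv_unit)
  qed blast
  have dvg: "dv n v g = dv n (N v) f" if v: "v \<in> Kn n" for v
  proof -
    obtain c where c: "v = lc n unit_fun c" using basis_famD(2)[OF basis_fam_Kn v] by blast
    show ?thesis unfolding c linop_lc[OF N] dv_lc by (simp add: dv_unit g(2))
  qed
  have g_inv: "dv n v g = (\<lambda>_. 0)" if "v \<in> Kn n" "N v = 0" for v using dvg[OF that(1)] that(2) by simp
  have f_split: "feval n f (y + N u) = feval n f y + feval n (dv n u g) y" if u: "u \<in> Kn n" for u y
  proof -
    \<comment> \<open>One derivative of \<open>f\<close> along \<open>N u\<close> becomes a
      derivative of \<open>g\<close> along \<open>u\<close>; the other then kills \<open>g\<close>
      because N (N u) = 0. Hence \<open>f\<close> is affine in the direction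
      \<open>N u\<close>.\<close>
    have "dv n (N u) (dv n (N u) f) = dv n u (dv n (N u) g)"
      by (simp add: dvg[OF u, symmetric] dv_commute[of n "N u" u])
    also have "\<dots> = (\<lambda>_. 0)" using g_inv[OF linop_Kn[OF N u] N2[OF u]] by simp
    finally have "dv n (N u) (dv n (N u) f) = (\<lambda>_. 0)" .
    from feval_affine_if_dv_dv_0[OF ch f this, of y 1] show ?thesis by (simp add: plus_fun_def dvg[OF u])
  qed
  let ?S = "N ` Kn n" and ?T = "{v \<in> Kn n. N v = 0}"
  have ST: "?S \<subseteq> ?T" using N2 linop_Kn[OF N] by auto
  obtain l m b where b: "l \<le> m" "basis_fam ?S l b" "basis_fam ?T m b"
    using ex_basis_fam_extend[OF ST, of n] by blast
  define u where "u j = inv_into (Kn n) N (b j)" for j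
  have u: "u j \<in> Kn n" "N (u j) = b j" if "j < l" for j
    using basis_famD(1)[OF b(2) that] unfolding u_def by (rule inv_into_into, rule f_inv_into_f)
  define k where "k = m - l"
  have m: "m = l + k" using b(1) by (simp add: k_def)
  define w where "w j = b (l + j)" for j
  have lcb: "lc (l + k) b c = lc l b c + lc k w (\<lambda>j. c (l + j))" for c
    by (simp add: lc_def sum_lessThan_add w_def fun_eq_iff)
  have bT: "b j \<in> Kn n" "N (b j) = 0" if "j < l + k" for j
    using basis_famD(1)[OF b(3), of j] that unfolding m by blast+
  have lcu: "lc l u c \<in> Kn n" for c by (rule lc_mem[OF subspace_Kn u(1)])
  have lcw: "lc k w c \<in> ?T" for c
    by (rule lc_mem[OF subspace_ker[OF N]]) (use bT in \<open>auto simp: w_def\<close>)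
  have Nlcu: "N (lc l u c) = lc l b c" for c
    unfolding linop_lc[OF N] by (rule lc_cong) (auto simp: u(2))
  \<comment> \<open>The three blocks are a basis \<open>b\<close> of im N, preimages
    \<open>u\<close> of it under \<open>N\<close>, and vectors \<open>w\<close> completing
    \<open>b\<close> to a basis of ker N. They carry the variables x_1..x_l, x_(l+1)..x_(2l) and the
    rest.\<close>
  let ?B = "fam_append l b (fam_append l u w)"
  have lcB: "lc (l + (l + k)) ?B c = lc l b c + (lc l u (\<lambda>j. c (l + j)) + lc k w (\<lambda>j. c (l + (l + j))))" for c
    by (simp add: lc_append)
  have basis: "basis_fam (Kn n) (l + (l + k)) ?B"
  proof (rule basis_famI)
    fix j assume "j < l + (l + k)"
    then show "?B j \<in> Kn n"
    proof (cases rule: fam_append_cases)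
      case (2 i)
      from 2(2) show ?thesis
        by (cases rule: fam_append_cases) (use 2 u(1) bT in \<open>auto simp: w_def\<close>)
    qed (use bT in auto)
  next
    fix v :: "nat \<Rightarrow> 'k" assume v: "v \<in> Kn n"
    obtain c where c: "N v = lc l b c" using basis_famD(2)[OF b(2)] v by blast
    have "v - lc l u c \<in> ?T"
      using v lcu by (simp add: linop_diff[OF N] Nlcu c kv.subspace_diff[OF subspace_Kn])
    then obtain c' where "v - lc l u c = lc m b c'" using basis_famD(2)[OF b(3)] by blast
    then have "v = lc l u c + (lc l b c' + lc k w (\<lambda>j. c' (l + j)))"
      unfolding m lcb by (simp only: diff_eq_eq add_ac)
    then have "v = lc (l + (l + k)) ?B (fam_append l c' (fam_append l c (\<lambda>j. c' (l + j))))"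
      unfolding lc_append_coeffs by (simp only: add_ac)
    then show "\<exists>c. v = lc (l + (l + k)) ?B c" by blast
  next
    fix c j assume c: "lc (l + (l + k)) ?B c = 0" and j: "j < l + (l + k)"
    let ?cu = "\<lambda>j. c (l + j)" and ?cw = "\<lambda>j. c (l + (l + j))"
    \<comment> \<open>Applying \<open>N\<close> to a relation kills the blocks \<open>b\<close> and
      \<open>w\<close> and turns \<open>u\<close> into \<open>b\<close>, so the \<open>u\<close>
      coefficients vanish first.\<close>
    have "N (lc l b c) = 0"
      using bT unfolding linop_lc[OF N] by (simp add: lc_def fun_eq_iff)
    moreover have "N (lc k w ?cw) = 0" using lcw by blast
    ultimately have "N (lc (l + (l + k)) ?B c) = lc l b ?cu"
      by (simp add: lcB linop_add[OF N] Nlcu)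
    then have cu: "i < l \<Longrightarrow> c (l + i) = 0" for i
      using basis_famD(3)[OF b(2), of ?cu i] c linop_0[OF N] by simp
    have "lc l u ?cu = 0" by (rule lc_zero) (simp add: cu)
    then have "lc l b c + lc k w ?cw = 0" using c lcB[of c] by simp
    moreover have "lc l b (fam_append l c ?cw) = lc l b c" by (rule lc_cong) auto
    ultimately have "lc (l + k) b (fam_append l c ?cw) = 0" by (simp add: lcb)
    then have cbw: "i < l + k \<Longrightarrow> fam_append l c ?cw i = 0" for i
      using basis_famD(3)[OF b(3)] m by blast
    from j show "c j = 0"
    proof (cases rule: fam_append_cases)
      case 1
      then show ?thesis using cbw[of j] by simp
    next
      case (2 i)
      from 2(2) show ?thesis
        by (cases rule: fam_append_cases) (use 2 cu cbw[of "i"] in auto)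
    qed
  qed
  then have n: "l + (l + k) = n" by (rule Kn_card)
  have "1 \<le> l"
  proof (rule ccontr)
    assume "\<not> 1 \<le> l"
    moreover obtain c where "N v0 = lc l b c" using basis_famD(2)[OF b(2)] v0(1) by blast
    ultimately show False using v0(2) by (simp add: lc_zero)
  qed
  \<comment> \<open>\<open>H\<close> is \<open>g\<close> on the span of the block \<open>u\<close>;
    \<open>G\<close> is \<open>f\<close> on the span of the blocks \<open>u\<close> and
    \<open>w\<close>.\<close>
  obtain H where H: "form l (Suc d) H" "\<And>x. feval l H x = feval n g (lc l u x)"
    using polyfun_lc[OF g(1)] by blast
  obtain G where G: "form (l + k) (Suc d) G" "\<And>x. feval (l + k) G x = feval n f (lc (l + k) (fam_append l u w) x)"
    using polyfun_lc[OF f] by blast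
  have dH: "feval l (pderiv_form i H) x = feval n (dv n (u i) g) (lc l u x)" if i: "i < l" for i x
  proof -
    have "feval l (dv l (unit_fun i) H) x = feval n (dv n (u i) g) (lc l u x)"
    proof (rule feval_dv_eqI[OF inf H(1) g(1)])
      fix t
      have "lc l u (\<lambda>j. x j + t * unit_fun i j) = (\<lambda>j. lc l u x j + t * u i j)"
        using i by (simp add: lc_def distrib_right sum.distrib if_distrib[of "\<lambda>x. x * _"] if_distrib[of "\<lambda>x. _ * x"] cong: if_cong)
      then show "feval l H (\<lambda>j. x j + t * unit_fun i j) = feval n g (\<lambda>j. lc l u x j + t * u i j)"
        by (simp only: H(2))
    qed
    then show ?thesis using i by (simp add: dv_unit)
  qed
  have "feval n f (lin n (\<lambda>i j. ?B j i) x) =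
      (\<Sum>i<l. x i * feval l (pderiv_form i H) (\<lambda>j. x (l + j))) + feval (n - l) G (\<lambda>j. x (l + j))" for x
  proof -
    let ?x1 = "\<lambda>j. x (l + j)" and ?x2 = "\<lambda>j. x (l + (l + j))"
    let ?y = "lc (l + k) (fam_append l u w) ?x1"
    have y: "?y = lc l u ?x1 + lc k w ?x2" by (simp add: lc_append)
    have "feval n f (lin n (\<lambda>i j. ?B j i) x) = feval n f (?y + N (lc l u x))"
      unfolding lin_basis_fam n[symmetric] lcB Nlcu y by (simp add: n add_ac)
    also have "\<dots> = feval n f ?y + feval n (dv n (lc l u x) g) ?y" by (rule f_split[OF lcu])
    also have "feval n (dv n (lc l u x) g) ?y = (\<Sum>i<l. x i * feval n (dv n (u i) g) ?y)"
      unfolding dv_lc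
      by (subst feval_sum[of _ _ d]) (auto intro!: form_cmult form_dv[OF g(1)] simp: feval_cmult[OF form_dv[OF g(1)]])
    also have "\<dots> = (\<Sum>i<l. x i * feval l (pderiv_form i H) ?x1)"
    proof (intro sum.cong refl)
      fix i assume i: "i \<in> {..<l}"
      \<comment> \<open>The \<open>w\<close> part of the point lies in ker N and is invisible to
        \<open>g\<close> and its derivatives.\<close>
      have "dv n (lc k w ?x2) g = (\<lambda>_. 0)" using lcw g_inv by blast
      then have "dv n (lc k w ?x2) (dv n (u i) g) = (\<lambda>_. 0)" by (simp add: dv_commute[of n _ "u i"])
      then have "feval n (dv n (u i) g) ?y = feval n (dv n (u i) g) (lc l u ?x1)"
        unfolding y by (rule feval_invariant[OF ch' form_dv[OF g(1)]])
      then show "x i * feval n (dv n (u i) g) ?y = x i * feval l (pderiv_form i H) ?x1"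
        using dH i by simp
    qed
    also have "feval n f ?y = feval (n - l) G ?x1" using G(2) n by auto
    finally show ?thesis by (simp add: add.commute)
  qed
  moreover have "mdet n (\<lambda>i j. ?B j i) \<noteq> 0" using mdet_basis_fam basis n by blast
  moreover have "2 * l \<le> n" "form (n - l) (Suc d) G" using n G(1) by auto
  ultimately show ?thesis unfolding LDS_def Suc_eq_plus1[symmetric] using \<open>1 \<le> l\<close> H(1) by blast
qed

subsection \<open>Non-injectivity forces a direct sum or an LDS form\<close>

lemma funpow_add_apply: "(Q ^^ (i + j)) v = (Q ^^ i) ((Q ^^ j) v)"
  by (simp add: funpow_add)

text \<open>Kernels of powers grow and images shrink within bounded dimension, so both are constant
  from some \<open>r\<close> on. The conclusions say that ker Q^r and im Q^r span
  \<open>Kn n\<close> and meet only in 0.\<close>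

lemma fitting:
  fixes Q :: "(nat \<Rightarrow> 'k::field) \<Rightarrow> nat \<Rightarrow> 'k"
  assumes Q: "linop n Q"
  shows "\<exists>r\<ge>1. (\<forall>x\<in>Kn n. \<exists>y\<in>Kn n. (Q ^^ r) (x - (Q ^^ r) y) = 0) \<and>
    (\<forall>w\<in>Kn n. (Q ^^ r) ((Q ^^ r) w) = 0 \<longrightarrow> (Q ^^ r) w = 0)"
proof -
  define K where "K i = {v \<in> Kn n. (Q ^^ i) v = 0}" for i
  define I where "I i = (Q ^^ i) ` Kn n" for i
  note lin = linop_funpow[OF Q]
  have K: "K i \<subseteq> Kn n" "kv.subspace (K i)" for i
    using subspace_ker[OF lin[of i]] by (auto simp: K_def)
  have I: "I i \<subseteq> Kn n" "kv.subspace (I i)" for i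
    using subspace_im[OF lin[of i]] linop_Kn[OF lin[of i]] by (auto simp: I_def)
  have K_mono: "K i \<subseteq> K j" if "i \<le> j" for i j
  proof
    fix v assume "v \<in> K i"
    then have v: "v \<in> Kn n" "(Q ^^ i) v = 0" by (auto simp: K_def)
    have "(Q ^^ j) v = (Q ^^ (j - i)) ((Q ^^ i) v)"
      using that by (simp add: funpow_add_apply[symmetric])
    then show "v \<in> K j" using v linop_0[OF lin] by (simp add: K_def)
  qed
  have I_anti: "I j \<subseteq> I i" if "i \<le> j" for i j
  proof
    fix v assume "v \<in> I j"
    then obtain w where w: "w \<in> Kn n" "v = (Q ^^ j) w" by (auto simp: I_def)
    have "v = (Q ^^ i) ((Q ^^ (j - i)) w)"
      using that w(2) by (simp add: funpow_add_apply[symmetric])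
    then show "v \<in> I i" using linop_Kn[OF lin w(1)] by (auto simp: I_def)
  qed
  have "\<forall>i. True \<longrightarrow> kv.dim (K i) < Suc (kv.dim (Kn n :: (nat \<Rightarrow> 'k) set))"
    using kv_dim_mono[OF K(1)] by (auto simp: less_Suc_eq_le)
  then obtain r1 where r1: "\<And>i. kv.dim (K i) \<le> kv.dim (K r1)"
    using ex_has_greatest_nat[of "\<lambda>_. True" 0 "\<lambda>i. kv.dim (K i)"] by blast
  obtain r2 where r2: "\<And>i. kv.dim (I r2) \<le> kv.dim (I i)"
    using ex_has_least_nat[of "\<lambda>_. True" 0 "\<lambda>i. kv.dim (I i)"] by blast
  \<comment> \<open>\<open>r\<close> lies past both stabilisation points; \<open>Suc\<close> ensures
    r >= 1, so that ker Q is contained in ker Q^r.\<close>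
  define r where "r = Suc (r1 + r2)"
  have "K r1 = K j" if "r1 \<le> j" for j
    using K_mono[OF that] K r1[of j] kv_dim_mono[OF K_mono[OF that] K(1)]
    by (intro kv_dim_eq[of _ _ n]) auto
  from this[of r] this[of "r + r"] have Keq: "K (r + r) = K r" by (simp add: r_def)
  have "I j = I r2" if "r2 \<le> j" for j
    using I_anti[OF that] I r2[of j] kv_dim_mono[OF I_anti[OF that] I(1)]
    by (intro kv_dim_eq[of _ _ n]) auto
  from this[of r] this[of "r + r"] have Ieq: "I (r + r) = I r" by (simp add: r_def)
  show ?thesis
  proof (intro exI[of _ r] conjI ballI impI)
    show "1 \<le> r" by (simp add: r_def)
  next
    fix x :: "nat \<Rightarrow> 'k" assume "x \<in> Kn n"
    then have "(Q ^^ r) x \<in> I (r + r)" unfolding Ieq by (auto simp: I_def)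
    then obtain y where y: "y \<in> Kn n" "(Q ^^ r) x = (Q ^^ (r + r)) y" by (auto simp: I_def)
    then have "(Q ^^ r) (x - (Q ^^ r) y) = 0"
      unfolding funpow_add_apply by (simp add: linop_diff[OF lin])
    with y(1) show "\<exists>y\<in>Kn n. (Q ^^ r) (x - (Q ^^ r) y) = 0" by blast
  next
    fix w :: "nat \<Rightarrow> 'k" assume "w \<in> Kn n" "(Q ^^ r) ((Q ^^ r) w) = 0"
    then have "w \<in> K (r + r)" by (simp add: K_def funpow_add_apply)
    then show "(Q ^^ r) w = 0" unfolding Keq by (simp add: K_def)
  qed
qed

lemma form_0_vars: "form 0 (Suc e) f \<Longrightarrow> f = (\<lambda>_. 0)"
  by (auto simp: form_iff coeff_idx_def)

lemma direct_sum_or_LDS_if_same_grad_span: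
  fixes f g :: "'k::field form"
  assumes ac: "alg_closed TYPE('k)" and ch: "of_nat (fact (Suc d)) \<noteq> (0::'k)"
    and f: "form n (Suc d) f" and ind: "indep_grad n f" and g: "form n (Suc d) g"
    and sp: "grad_span n g \<subseteq> grad_span n f" and ns: "\<not> same_point f g"
  shows "direct_sum n (Suc d) f \<or> LDS n d f"
proof -
  note inf = infinite_UNIV_if_alg_closed[OF ac]
  have "0 < n"
  proof (rule ccontr)
    assume "\<not> 0 < n"
    then have "g = fscale 0 f" using g form_0_vars[of d g] by (simp add: fscale_def)
    with ns show False unfolding same_point_def by blast
  qed
  have "\<exists>c. pderiv_form i g = dv n c f" if i: "i < n" for i
  proof -
    have "dv n (unit_fun i) g \<in> grad_span n f"
      using sp unfolding grad_span_eq_range by (rule subsetD) (rule rangeI)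
    then obtain c where "dv n (unit_fun i) g = dv n c f" unfolding grad_span_eq_range by (rule rangeE)
    then have "pderiv_form i g = dv n c f" by (simp only: dv_unit[OF i])
    then show ?thesis by (intro exI)
  qed
  then have "\<forall>i. \<exists>c. i < n \<longrightarrow> pderiv_form i g = dv n c f" by blast
  then have "\<exists>M. \<forall>i. i < n \<longrightarrow> pderiv_form i g = dv n (M i) f" by (rule choice)
  then obtain M where M: "\<And>i. i < n \<Longrightarrow> pderiv_form i g = dv n (M i) f" by blast
  \<comment> \<open>The i-th partial of \<open>g\<close> is the derivative of \<open>f\<close> along
    \<open>M i\<close>, so P has the \<open>M i\<close> as columns; hence the exchanged
    indices.\<close>
  obtain a v where a: "\<forall>i<n. lin n (\<lambda>i j. M j i) v i = a * v i" and v: "\<exists>i<n. v i \<noteq> 0"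
    using ex_eigenvector[OF ac \<open>0 < n\<close>, of "\<lambda>i j. M j i"] by blast
  define g0 where "g0 = (\<lambda>m. g m + (- a) * f m)"
  \<comment> \<open>\<open>Q\<close> is P - a, cut off to \<open>Kn n\<close>; it relates the
    derivatives of \<open>g0\<close> = g - a f to those of \<open>f\<close> as P does for
    \<open>g\<close>.\<close>
  define Q where "Q v = (\<lambda>j. if j < n then lc n M v j + (- a) * v j else 0)" for v
  have g0: "form n (Suc d) g0" unfolding g0_def by (intro form_add form_cmult f g)
  have dvQ: "dv n u g0 = dv n (Q u) f" for u
  proof -
    have "dv n u g = dv n (lc n M u) f"
      unfolding dv_lc dv_def[of n u g] by (rule ext, rule sum.cong[OF refl]) (simp add: M)
    moreover have "dv n (Q u) f = dv n (\<lambda>j. lc n M u j + (- a) * u j) f"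
      by (rule dv_cong) (simp add: Q_def)
    ultimately show ?thesis
      by (simp only: g0_def dv_add_form dv_cmult_form dv_add dv_cmult)
  qed
  have Q: "linop n Q"
    by (auto simp: linop_def Q_def Kn_def fun_eq_iff vscale_def lc_def algebra_simps sum.distrib sum_distrib_left)
  have g0_neq: "g0 \<noteq> (\<lambda>_. 0)"
  proof
    assume "g0 = (\<lambda>_. 0)"
    then have "g = fscale a f" by (simp add: g0_def fun_eq_iff fscale_def)
    with ns show False by (auto simp: same_point_def)
  qed
  \<comment> \<open>One factor \<open>Q\<close> is moved across at a time: absorbing it replaces
    \<open>f\<close> by \<open>g0\<close>, whose second derivatives commute as well.\<close>
  have sym: "dv n y (dv n ((Q ^^ r) x) f) = dv n x (dv n ((Q ^^ r) y) f)" for x y r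
  proof (induction r arbitrary: x y)
    case 0
    show ?case by (simp add: dv_commute)
  next
    case (Suc r)
    have "dv n y (dv n ((Q ^^ Suc r) x) f) = dv n y (dv n ((Q ^^ r) x) g0)" by (simp add: dvQ)
    also have "\<dots> = dv n ((Q ^^ r) x) (dv n (Q y) f)" by (subst dv_commute) (simp only: dvQ)
    also have "\<dots> = dv n x (dv n ((Q ^^ r) (Q y)) f)" by (subst dv_commute) (rule Suc.IH)
    finally show ?case by (simp add: funpow_swap1)
  qed
  obtain r where r: "1 \<le> r" "\<forall>x\<in>Kn n. \<exists>y\<in>Kn n. (Q ^^ r) (x - (Q ^^ r) y) = 0"
    "\<forall>w\<in>Kn n. (Q ^^ r) ((Q ^^ r) w) = 0 \<longrightarrow> (Q ^^ r) w = 0"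
    using fitting[OF Q] by blast
  note Qr = linop_funpow[OF Q]
  \<comment> \<open>The truncated eigenvector lies in ker Q and supplies the nonzero vector of the
    kernel summand.\<close>
  define v0 where "v0 = (\<lambda>i. if i < n then v i else 0)"
  have "Q v0 = 0"
  proof -
    have "lc n M v0 j = a * v0 j" if "j < n" for j
      using a that by (simp add: lc_def lin_def v0_def mult.commute)
    then show ?thesis by (simp add: Q_def fun_eq_iff)
  qed
  have v0: "v0 \<in> Kn n" "v0 \<noteq> 0" using v by (auto simp: v0_def Kn_def fun_eq_iff)
  have "(Q ^^ r) v0 = 0"
  proof -
    obtain s where "r = Suc s" using r(1) by (cases r) auto
    then show ?thesis using \<open>Q v0 = 0\<close> linop_0[OF Qr] by (simp add: funpow_swap1)
  qed
  show ?thesis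
  proof (cases "\<exists>w\<in>Kn n. (Q ^^ r) w \<noteq> 0")
    case True
    then obtain w where w: "w \<in> Kn n" "(Q ^^ r) w \<noteq> 0" by blast
    let ?U = "{u \<in> Kn n. (Q ^^ r) u = 0}" and ?W = "(Q ^^ r) ` Kn n"
    have "direct_sum n (Suc d) f"
    proof (rule direct_sum_if_orthogonal[OF inf ch f ind, of ?U v0 ?W "(Q ^^ r) w"])
      show "\<exists>u\<in>?U. \<exists>w\<in>?W. x = u + w" if x: "x \<in> Kn n" for x
      proof -
        obtain y where y: "y \<in> Kn n" "(Q ^^ r) (x - (Q ^^ r) y) = 0" using bspec[OF r(2) x] by blast
        have "x - (Q ^^ r) y \<in> ?U"
          using x y linop_Kn[OF Qr y(1)] by (auto intro: kv.subspace_diff[OF subspace_Kn])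
        moreover have "x = (x - (Q ^^ r) y) + (Q ^^ r) y" by simp
        ultimately show ?thesis using y(1) by blast
      qed
      show "?U \<inter> ?W = {0}"
        using r(3) kv.subspace_0[OF subspace_im[OF Qr[of r]]] kv.subspace_0[OF subspace_ker[OF Qr[of r]]] by auto
      show "dv n u (dv n w f) = (\<lambda>_. 0)" if "u \<in> ?U" "w \<in> ?W" for u w
      proof -
        obtain w' where "w = (Q ^^ r) w'" using \<open>w \<in> ?W\<close> by blast
        then show ?thesis using sym[of u r w'] \<open>u \<in> ?U\<close> by simp
      qed
    qed (use subspace_ker[OF Qr] subspace_im[OF Qr] linop_Kn[OF Qr] v0 w \<open>(Q ^^ r) v0 = 0\<close> in auto)
    then show ?thesis ..
  next
    case False
    \<comment> \<open>With \<open>s\<close> the nilpotency index, Q^(s-1) is nonzero and its square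
      is Q^(s + (s-2)) = 0 once s >= 2. The value s = 1 would mean that all partials of
      \<open>g0\<close> vanish.\<close>
    define s where "s = (LEAST s. \<forall>w\<in>Kn n. (Q ^^ s) w = 0)"
    have s: "(Q ^^ s) w = 0" if "w \<in> Kn n" for w
      using LeastI[of "\<lambda>s. \<forall>w\<in>Kn n. (Q ^^ s) w = 0" r] False that unfolding s_def by blast
    have s_min: "\<exists>w\<in>Kn n. (Q ^^ t) w \<noteq> 0" if "t < s" for t
      using not_less_Least[of t] that unfolding s_def by blast
    have "s \<noteq> 0" using s[OF v0(1)] v0(2) by (cases s) auto
    have "s \<noteq> 1"
    proof
      assume "s = 1"
      have "pderiv_form i g0 = (\<lambda>_. 0)" if i: "i < n" for i
      proof -
        have "Q (unit_fun i) = 0" using s[of "unit_fun i"] \<open>s = 1\<close> i by (auto simp: Kn_def)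
        then show ?thesis using dvQ[of "unit_fun i"] i by (simp add: dv_unit)
      qed
      then have "g0 = (\<lambda>_. 0)" by (rule form_eq_0_if_pderivs_0[OF ch g0])
      with g0_neq show False ..
    qed
    with \<open>s \<noteq> 0\<close> have s2: "2 \<le> s" by simp
    let ?N = "Q ^^ (s - 1)"
    obtain w where w: "w \<in> Kn n" "?N w \<noteq> 0" using s_min[of "s - 1"] s2 by auto
    have "LDS n d f"
    proof (rule LDS_if_square_zero[OF inf ch f Qr _ w])
      fix x :: "nat \<Rightarrow> 'k" assume x: "x \<in> Kn n"
      have "?N (?N x) = (Q ^^ (s + (s - 2))) x"
        using s2 by (simp add: funpow_add_apply[symmetric] numeral_2_eq_2)
      also have "\<dots> = 0" unfolding funpow_add_apply by (rule s[OF linop_Kn[OF Qr x]])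
      finally show "?N (?N x) = 0" .
    qed (rule sym)
    then show ?thesis ..
  qed
qed

subsection \<open>Direct sums and LDS forms are not determined by their gradient span\<close>

text \<open>Equal spans carry the dimension condition over from \<open>f\<close>. Since
  \<open>same_point\<close> admits the factor 0, its failure also shows that \<open>g\<close> is
  nonzero.\<close>

lemma grad_not_injective_atI:
  fixes f g :: "'k::field form"
  assumes "indep_grad n f" "form n (Suc d) g" "\<not> same_point f g"
    and "\<And>v. \<exists>w. dv n v g = dv n w f" "\<And>v. \<exists>w. dv n v f = dv n w g"
  shows "grad_not_injective_at n d f"
proof -
  have sp: "grad_span n g = grad_span n f"
    using assms(4,5) by (intro equalityI grad_span_subsetI)
  then have "grad_dim n g = n" using grad_dim_if_indep_grad[OF assms(1)] by (simp add: grad_dim_def)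
  moreover have "g \<noteq> (\<lambda>_. 0)"
  proof
    assume "g = (\<lambda>_. 0)"
    then have "g = fscale 0 f" by (simp add: fscale_def)
    with assms(3) show False unfolding same_point_def by blast
  qed
  ultimately show ?thesis
    unfolding grad_not_injective_at_def Pc_def Pforms_def using assms(2,3) sp by auto
qed

lemma feval_dv_eqI2:
  fixes f h h' :: "'k::field form"
  assumes "infinite (UNIV :: 'k set)" "form n (Suc e) f" "form m (Suc e) h" "form m' (Suc e) h'"
    and "\<And>t. feval n f (\<lambda>i. x i + t * v i) =
      \<alpha> * feval m h (\<lambda>i. y i + t * w i) + feval m' h' (\<lambda>i. y' i + t * w' i)"
  shows "feval n (dv n v f) x = \<alpha> * feval m (dv m w h) y + feval m' (dv m' w' h') y'"
proof -
  have "line_poly n (Suc e) f x v = smult \<alpha> (line_poly m (Suc e) h y w) + line_poly m' (Suc e) h' y' w'"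
    by (rule poly_eqI_infinite[OF assms(1)])
      (simp add: poly_line_poly[OF assms(2)] poly_line_poly[OF assms(3)] poly_line_poly[OF assms(4)] assms(5))
  from arg_cong[OF this, of pderiv]
  have "line_poly n e (dv n v f) x v = smult \<alpha> (line_poly m e (dv m w h) y w) + line_poly m' e (dv m' w' h') y' w'"
    by (simp add: pderiv_add pderiv_smult pderiv_line_poly[OF assms(2)] pderiv_line_poly[OF assms(3)] pderiv_line_poly[OF assms(4)])
  from arg_cong[OF this, of "\<lambda>p. poly p 0"] show ?thesis
    by (simp add: poly_line_poly[OF form_dv[OF assms(2)]] poly_line_poly[OF form_dv[OF assms(3)]]
        poly_line_poly[OF form_dv[OF assms(4)]])
qed

lemma feval_dv_affine:
  fixes f :: "'k::field form"
  assumes "infinite (UNIV :: 'k set)" "form n (Suc e) f"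
    and "\<And>t. feval n f (\<lambda>i. x i + t * v i) = c + t * b"
  shows "feval n (dv n v f) x = b"
proof -
  have "line_poly n (Suc e) f x v = [:c, b:]"
    by (rule poly_eqI_infinite[OF assms(1)]) (simp add: poly_line_poly[OF assms(2)] assms(3))
  from arg_cong[OF this, of pderiv] have "line_poly n e (dv n v f) x v = [:b:]"
    by (simp add: pderiv_line_poly[OF assms(2)] pderiv_pCons)
  from arg_cong[OF this, of "\<lambda>p. poly p 0"] show ?thesis
    by (simp add: poly_line_poly[OF form_dv[OF assms(2)]])
qed

lemma lin_affine: "lin n A (\<lambda>i. x i + t * v i) = (\<lambda>i. lin n A x i + t * lin n A v i)"
  by (simp add: lin_def algebra_simps sum.distrib sum_distrib_left)

lemma lin_cong: "(\<And>j. j < n \<Longrightarrow> x j = y j) \<Longrightarrow> lin n A x = lin n A y"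
  by (simp add: lin_def)

text \<open>The second point is g = a f1 + f2. Its derivative along \<open>v\<close> is that of
  \<open>f\<close> along \<open>v\<close> with its \<open>U\<close> part multiplied by
  \<open>a\<close>.\<close>

lemma grad_not_injective_if_direct_sum:
  fixes f :: "'k::field form"
  assumes inf: "infinite (UNIV :: 'k set)" and ch: "of_nat (fact (Suc d)) \<noteq> (0::'k)"
    and f: "form n (Suc d) f" and ind: "indep_grad n f" and ds: "direct_sum n (Suc d) f"
  shows "grad_not_injective_at n d f"
proof -
  obtain A m f1 f2 where A: "mdet n A \<noteq> 0" and m: "m \<le> n"
    and f1: "form m (Suc d) f1" "f1 \<noteq> (\<lambda>_. 0)" and f2: "form (n - m) (Suc d) f2" "f2 \<noteq> (\<lambda>_. 0)"
    and fA: "\<And>x. feval n f (lin n A x) = feval m f1 x + feval (n - m) f2 (\<lambda>j. x (m + j))"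
    using ds unfolding direct_sum_def by blast
  have ch': "of_nat (fact d) \<noteq> (0::'k)" using fact_neq_0_le[OF ch] by simp
  obtain B where AB: "\<forall>x. \<forall>i<n. lin n A (lin n B x) i = x i" and BA: "\<forall>x. \<forall>i<n. lin n B (lin n A x) i = x i"
    using mdet_neq_0_inverse[OF A] by blast
  \<comment> \<open>a /= 0 makes the rescaling of directions invertible; a /= 1 keeps
    \<open>g\<close> from being a multiple of \<open>f\<close>.\<close>
  obtain a :: 'k where a: "a \<notin> {0, 1}" using ex_new_if_finite[OF inf, of "{0, 1}"] by auto
  have "polyfun n (Suc d) (\<lambda>y. a * feval m f1 (lin n B y) + feval (n - m) f2 (\<lambda>j. lin n B y (m + j)))"
    using polyfun_add[OF polyfun_cmult[OF polyfun_linear_subst[OF f1(1), of n B], of a]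
        polyfun_linear_subst[OF f2(1), of n "\<lambda>i. B (m + i)"]] by (simp add: lin_def)
  then obtain g where g: "form n (Suc d) g"
    "\<And>y. feval n g y = a * feval m f1 (lin n B y) + feval (n - m) f2 (\<lambda>j. lin n B y (m + j))"
    unfolding polyfun_def by metis
  have cong: "feval m f1 x = feval m f1 y" "feval (n - m) f2 (\<lambda>j. x (m + j)) = feval (n - m) f2 (\<lambda>j. y (m + j))"
    if "\<And>i. i < n \<Longrightarrow> x i = y i" for x y
    using that m by (auto intro!: feval_cong)
  define sc where "sc c x = (\<lambda>i. if i < m then c * x i else x i)" for c :: 'k and x :: "nat \<Rightarrow> 'k"
  have dvg: "dv n v g = dv n (lin n A (sc a (lin n B v))) f" for v
  proof (rule form_eqI[OF inf ch' form_dv[OF g(1)] form_dv[OF f]])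
    fix y :: "nat \<Rightarrow> 'k"
    let ?x = "lin n B y" and ?w = "lin n B v"
    have 1: "feval n (dv n v g) y = a * feval m (dv m ?w f1) ?x + feval (n - m) (dv (n - m) (\<lambda>j. ?w (m + j)) f2) (\<lambda>j. ?x (m + j))"
      by (rule feval_dv_eqI2[OF inf g(1) f1(1) f2(1)]) (simp add: g(2) lin_affine)
    have "feval n (dv n (lin n A (sc a ?w)) f) y =
      1 * feval m (dv m (sc a ?w) f1) ?x + feval (n - m) (dv (n - m) (\<lambda>j. ?w (m + j)) f2) (\<lambda>j. ?x (m + j))"
    proof (rule feval_dv_eqI2[OF inf f f1(1) f2(1)])
      fix t
      have "feval n f (\<lambda>i. y i + t * lin n A (sc a ?w) i) = feval n f (lin n A (\<lambda>i. ?x i + t * sc a ?w i))"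
        by (rule feval_cong) (simp add: lin_affine AB)
      also have "\<dots> = 1 * feval m f1 (\<lambda>i. ?x i + t * sc a ?w i) + feval (n - m) f2 (\<lambda>i. ?x (m + i) + t * ?w (m + i))"
        by (simp add: fA sc_def)
      finally show "feval n f (\<lambda>i. y i + t * lin n A (sc a ?w) i) =
        1 * feval m f1 (\<lambda>i. ?x i + t * sc a ?w i) + feval (n - m) f2 (\<lambda>i. ?x (m + i) + t * ?w (m + i))" .
    qed
    moreover have "dv m (sc a ?w) f1 = dv m (\<lambda>i. a * ?w i) f1" by (rule dv_cong) (simp add: sc_def)
    ultimately show "feval n (dv n v g) y = feval n (dv n (lin n A (sc a ?w)) f) y"
      unfolding 1 by (simp add: dv_cmult feval_cmult[OF form_dv[OF f1(1)]])
  qed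
  have dvf: "\<exists>w. dv n v f = dv n w g" for v
  proof -
    let ?u = "lin n A (sc (1 / a) (lin n B v))"
    have "lin n A (sc a (lin n B ?u)) i = v i" if "i < n" for i
    proof -
      have "lin n A (sc a (lin n B ?u)) = lin n A (lin n B v)"
        by (rule lin_cong) (use a in \<open>simp add: sc_def BA\<close>)
      then show ?thesis using AB that by simp
    qed
    then have "dv n v f = dv n ?u g" unfolding dvg by (intro dv_cong) simp
    then show ?thesis by (intro exI)
  qed
  have "\<not> same_point f g"
  proof
    assume "same_point f g"
    then obtain c where c: "g = fscale c f" by (auto simp: same_point_def)
    have *: "a * feval m f1 x + feval (n - m) f2 (\<lambda>j. x (m + j)) =
      c * (feval m f1 x + feval (n - m) f2 (\<lambda>j. x (m + j)))" for x
    proof -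
      have "feval n g (lin n A x) = a * feval m f1 x + feval (n - m) f2 (\<lambda>j. x (m + j))"
        unfolding g(2) using cong[of "lin n B (lin n A x)" x] BA by simp
      moreover have "feval n g (lin n A x) = c * feval n f (lin n A x)"
        unfolding c fscale_def by (rule feval_cmult[OF f])
      ultimately show ?thesis by (simp add: fA)
    qed
    \<comment> \<open>Evaluating g = c f at points of \<open>U\<close> and of \<open>W\<close>
      separately gives c = a and c = 1.\<close>
    obtain x where x: "feval m f1 x \<noteq> 0" using form_eq_0_if_feval_0[OF inf ch f1(1)] f1(2) by blast
    let ?x = "\<lambda>i. if i < m then x i else 0"
    have "feval m f1 ?x = feval m f1 x" by (rule feval_cong) simp
    then have ca: "a = c" using *[of ?x] x feval_at_zero[OF f2(1)] by simp
    obtain y where y: "feval (n - m) f2 y \<noteq> 0" using form_eq_0_if_feval_0[OF inf ch f2(1)] f2(2) by blast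
    let ?y = "\<lambda>i. if i < m then 0 else y (i - m)"
    have "feval m f1 ?y = feval m f1 (\<lambda>_. 0)" by (rule feval_cong) simp
    then have "1 = c" using *[of ?y] y feval_at_zero[OF f1(1)] by simp
    with ca a show False by simp
  qed
  then show ?thesis
    using dvg dvf by (intro grad_not_injective_atI[OF ind g(1)]) blast+
qed

text \<open>The second point is f + H, with H in the second block of variables: the partial of H in
  x_(l+i) equals the partial of \<open>f\<close> in x_i, so derivatives of H are derivatives of
  \<open>f\<close>.\<close>

lemma grad_not_injective_if_LDS:
  fixes f :: "'k::field form"
  assumes inf: "infinite (UNIV :: 'k set)" and ch: "of_nat (fact (Suc d)) \<noteq> (0::'k)"
    and f: "form n (Suc d) f" and ind: "indep_grad n f" and lds: "LDS n d f"
  shows "grad_not_injective_at n d f"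
proof -
  obtain A l H G where A: "mdet n A \<noteq> 0" and l: "1 \<le> l" "2 * l \<le> n" and H: "form l (Suc d) H"
    and fA: "\<And>x. feval n f (lin n A x) = (\<Sum>i<l. x i * feval l (pderiv_form i H) (\<lambda>j. x (l + j)))
            + feval (n - l) G (\<lambda>j. x (l + j))"
    using lds unfolding LDS_def Suc_eq_plus1[symmetric] by blast
  have ch': "of_nat (fact d) \<noteq> (0::'k)" using fact_neq_0_le[OF ch] by simp
  obtain B where AB: "\<forall>x. \<forall>i<n. lin n A (lin n B x) i = x i" and BA: "\<forall>x. \<forall>i<n. lin n B (lin n A x) i = x i"
    using mdet_neq_0_inverse[OF A] by blast
  obtain H' where H': "form n (Suc d) H'" "\<And>y. feval n H' y = feval l H (\<lambda>j. lin n B y (l + j))"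
    using polyfun_linear_subst[OF H, of n "\<lambda>i. B (l + i)"] unfolding polyfun_def lin_def by metis
  \<comment> \<open>\<open>s\<close> moves the second block of coordinates to the first and forgets
    the rest; as an operator it has square zero.\<close>
  define s where "s v = (\<lambda>i. if i < l then lin n B v (l + i) else 0)" for v
  have dvH: "dv n v H' = dv n (lin n A (s v)) f" for v
  proof (rule form_eqI[OF inf ch' form_dv[OF H'(1)] form_dv[OF f]])
    fix y :: "nat \<Rightarrow> 'k"
    let ?x = "lin n B y"
    let ?b = "\<Sum>i<l. s v i * feval l (pderiv_form i H) (\<lambda>j. ?x (l + j))"
    have "feval n (dv n v H') y = feval l (dv l (\<lambda>j. lin n B v (l + j)) H) (\<lambda>j. ?x (l + j))"
      by (rule feval_dv_eqI[OF inf H'(1) H]) (simp add: H'(2) lin_affine)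
    also have "\<dots> = ?b"
      unfolding dv_def
      by (subst feval_sum[of _ _ d])
        (auto intro!: form_cmult form_pderiv[OF H] sum.cong simp: feval_cmult[OF form_pderiv[OF H]] s_def)
    also have "?b = feval n (dv n (lin n A (s v)) f) y"
    proof (rule sym, rule feval_dv_affine[OF inf f])
      fix t
      have "feval n f (\<lambda>i. y i + t * lin n A (s v) i) = feval n f (lin n A (\<lambda>i. ?x i + t * s v i))"
        by (rule feval_cong) (simp add: lin_affine AB)
      also have "\<dots> = feval n f (lin n A ?x) + t * ?b"
        unfolding fA by (simp add: s_def distrib_right sum.distrib sum_distrib_left mult.assoc)
      also have "feval n f (lin n A ?x) = feval n f y" by (rule feval_cong) (simp add: AB)
      finally show "feval n f (\<lambda>i. y i + t * lin n A (s v) i) = feval n f y + t * ?b" .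
    qed
    finally show "feval n (dv n v H') y = feval n (dv n (lin n A (s v)) f) y" .
  qed
  define g where "g = (\<lambda>m. f m + H' m)"
  have g: "form n (Suc d) g" unfolding g_def by (intro form_add f H')
  have dvg: "dv n v g = dv n (\<lambda>i. v i + lin n A (s v) i) f" for v
    unfolding g_def dv_add_form dvH dv_add ..
  have s_lin: "s (lin n A z) i = (if i < l then z (l + i) else 0)" for z i
    using l by (simp add: s_def BA)
  have dvf: "\<exists>w. dv n v f = dv n w g" for v
  proof -
    \<comment> \<open>Since the shift squares to zero, 1 minus the shift inverts 1 plus the
      shift.\<close>
    let ?u = "\<lambda>i. v i + (-1) * lin n A (s v) i"
    have "s ?u = s v"
    proof (rule ext)
      fix i
      have "s ?u i = s v i + (-1) * s (lin n A (s v)) i" unfolding s_def[of ?u] lin_affine by (simp add: s_def)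
      also have "s (lin n A (s v)) i = 0" unfolding s_lin by (simp add: s_def)
      finally show "s ?u i = s v i" by simp
    qed
    then have "dv n ?u g = dv n v f" unfolding dvg by simp
    then show ?thesis by metis
  qed
  let ?e = "lin n A (unit_fun 0)"
  have e: "dv n ?e f \<noteq> (\<lambda>_. 0)"
  proof
    assume "dv n ?e f = (\<lambda>_. 0)"
    then have "?e i = 0" if "i < n" for i using ind that unfolding indep_grad_def by blast
    then have "lin n B ?e 0 = 0" by (simp add: lin_def[of n B])
    then show False using BA[rule_format, of 0 "unit_fun 0"] l by simp
  qed
  have "\<not> same_point f g"
  proof
    assume "same_point f g"
    then obtain c where "g = fscale c f" by (auto simp: same_point_def)
    then have Hc: "H' = (\<lambda>m. (c - 1) * f m)" by (simp add: g_def fscale_def fun_eq_iff algebra_simps)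
    \<comment> \<open>\<open>?e\<close> is the first direction of the first block, where H has zero
      derivative but \<open>f\<close> does not; this forces c = 1 and H = 0. But H then has zero
      derivative in the second block too, where it equals the derivative of \<open>f\<close> along
      \<open>?e\<close>.\<close>
    have "s ?e = (\<lambda>_. 0)" using l by (auto simp: s_lin fun_eq_iff)
    then have "dv n ?e H' = dv n (lin n A (\<lambda>_. 0)) f" by (simp add: dvH)
    also have "lin n A (\<lambda>_. 0) = (\<lambda>_. 0)" by (simp add: lin_def)
    finally have "(c - 1) * dv n ?e f m = 0" for m
      unfolding Hc dv_cmult_form dv_zero_vec by (rule fun_cong)
    then have "c = 1" using e by (auto simp: fun_eq_iff)
    then have "H' = (\<lambda>_. 0)" by (simp add: Hc)
    have "s (lin n A (unit_fun l)) = unit_fun 0" using l by (auto simp: s_lin fun_eq_iff)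
    then have "dv n ?e f = (\<lambda>_. 0)" using dvH[of "lin n A (unit_fun l)"] \<open>H' = (\<lambda>_. 0)\<close> by simp
    with e show False ..
  qed
  then show ?thesis
    using dvg dvf by (intro grad_not_injective_atI[OF ind g]) blast+
qed

subsection \<open>Zariski closed sets and fibres of the gradient morphism\<close>

lemma ex_poly_peval:
  "\<exists>r. \<forall>t. poly r t = peval I P (\<lambda>\<alpha>. poly (q \<alpha>) t)"
proof -
  let ?r = "\<Sum>m | P m \<noteq> 0. smult (P m) (\<Prod>v\<in>I. q v ^ m v)"
  have "poly ?r t = peval I P (\<lambda>\<alpha>. poly (q \<alpha>) t)" for t
    by (simp add: peval_def poly_sum poly_prod)
  then show ?thesis by blast
qed

lemma peval_homogeneous:
  assumes "is_hpoly I r P"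
  shows "peval I P (\<lambda>\<alpha>. c * x \<alpha>) = c ^ r * peval I P x"
  unfolding peval_def sum_distrib_left
proof (rule sum.cong[OF refl])
  fix m assume "m \<in> {m. P m \<noteq> 0}"
  then have "(\<Sum>v\<in>I. m v) = r" using assms by (auto simp: is_hpoly_def)
  then show "P m * (\<Prod>v\<in>I. (c * x v) ^ m v) = c ^ r * (P m * (\<Prod>v\<in>I. x v ^ m v))"
    by (simp add: power_mult_distrib prod.distrib flip: power_sum)
qed

lemma Pforms_scale:
  assumes "f \<in> Pforms n e" "c \<noteq> 0"
  shows "fscale c f \<in> Pforms n e"
proof -
  have "form n e (fscale c f)" unfolding fscale_def using assms by (intro form_cmult) (simp add: Pforms_def)
  moreover obtain m where "f m \<noteq> 0" using assms(1) by (auto simp: Pforms_def)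
  then have "fscale c f m \<noteq> 0" using assms(2) by (simp add: fscale_def)
  then have "fscale c f \<noteq> (\<lambda>_. 0)" by metis
  ultimately show ?thesis by (simp add: Pforms_def)
qed

lemma zclosed_scale:
  assumes "zclosed n e Z" "f \<in> Z" "c \<noteq> 0"
  shows "fscale c f \<in> Z"
proof -
  obtain \<P> where P: "\<forall>(r, P)\<in>\<P>. is_hpoly (coeff_idx n e) r P"
    and Z: "Z = {f \<in> Pforms n e. \<forall>(r, P)\<in>\<P>. peval (coeff_idx n e) P f = 0}"
    using assms(1) unfolding zclosed_def by blast
  have f: "f \<in> Pforms n e" using assms(2) Z by blast
  then have "fscale c f \<in> Pforms n e" using assms(3) by (rule Pforms_scale)
  moreover have "peval (coeff_idx n e) P (fscale c f) = 0" if "(r, P) \<in> \<P>" for r P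
  proof -
    have "is_hpoly (coeff_idx n e) r P" "peval (coeff_idx n e) P f = 0"
      using that assms(2) \<open>\<forall>(r, P)\<in>\<P>. is_hpoly (coeff_idx n e) r P\<close> Z by auto
    then show ?thesis unfolding fscale_def by (simp add: peval_homogeneous)
  qed
  ultimately show ?thesis using Z by auto
qed

definition linear_poly :: "'v set \<Rightarrow> ('v \<Rightarrow> 'k::field) \<Rightarrow> ('v \<Rightarrow> nat) \<Rightarrow> 'k" where
  "linear_poly I a = (\<lambda>\<mu>. \<Sum>\<alpha>\<in>I. if \<mu> = (\<lambda>\<beta>. if \<beta> = \<alpha> then 1 else 0) then a \<alpha> else 0)"

lemma linear_poly:
  fixes a :: "'v \<Rightarrow> 'k::field"
  assumes "finite I"
  shows "is_hpoly I 1 (linear_poly I a)" "peval I (linear_poly I a) x = (\<Sum>\<alpha>\<in>I. a \<alpha> * x \<alpha>)"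
proof -
  define \<delta> :: "'v \<Rightarrow> 'v \<Rightarrow> nat" where "\<delta> \<alpha> = (\<lambda>\<beta>. if \<beta> = \<alpha> then 1 else 0)" for \<alpha>
  have inj: "inj_on \<delta> I"
  proof (rule inj_onI)
    fix \<alpha> \<beta> assume "\<delta> \<alpha> = \<delta> \<beta>"
    then have "\<delta> \<alpha> \<alpha> = \<delta> \<beta> \<alpha>" by simp
    then show "\<alpha> = \<beta>" by (auto simp: \<delta>_def split: if_splits)
  qed
  have L: "linear_poly I a = (\<lambda>\<mu>. \<Sum>\<alpha>\<in>I. if \<mu> = \<delta> \<alpha> then a \<alpha> else 0)"
    by (simp add: linear_poly_def \<delta>_def)
  have supp: "{\<mu>. linear_poly I a \<mu> \<noteq> 0} \<subseteq> \<delta> ` I"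
  proof
    fix \<mu> assume "\<mu> \<in> {\<mu>. linear_poly I a \<mu> \<noteq> 0}"
    then have "(\<Sum>\<alpha>\<in>I. if \<mu> = \<delta> \<alpha> then a \<alpha> else 0) \<noteq> 0" by (simp add: L)
    then obtain \<alpha> where "\<alpha> \<in> I" "(if \<mu> = \<delta> \<alpha> then a \<alpha> else 0) \<noteq> 0" by (rule sum.not_neutral_contains_not_neutral)
    then show "\<mu> \<in> \<delta> ` I" by (auto split: if_splits)
  qed
  then have fin: "finite {\<mu>. linear_poly I a \<mu> \<noteq> 0}" using assms finite_subset by blast
  have \<delta>: "(\<Sum>v\<in>I. \<delta> \<alpha> v) = 1" "v \<notin> I \<Longrightarrow> \<delta> \<alpha> v = 0" if "\<alpha> \<in> I" for \<alpha> v
    using that assms by (auto simp: \<delta>_def)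
  show "is_hpoly I 1 (linear_poly I a)"
    unfolding is_hpoly_def is_poly_def
  proof (intro conjI allI impI)
    fix \<mu> assume "linear_poly I a \<mu> \<noteq> 0"
    then obtain \<alpha> where \<alpha>: "\<alpha> \<in> I" "\<mu> = \<delta> \<alpha>" using supp by blast
    show "(\<Sum>v\<in>I. \<mu> v) = 1" unfolding \<alpha>(2) by (rule \<delta>(1)[OF \<alpha>(1)])
    show "\<mu> v = 0" if "v \<notin> I" for v unfolding \<alpha>(2) by (rule \<delta>(2)[OF \<alpha>(1) that])
  qed (rule fin)
  have "peval I (linear_poly I a) x = (\<Sum>\<mu>\<in>\<delta> ` I. linear_poly I a \<mu> * (\<Prod>v\<in>I. x v ^ \<mu> v))"
    unfolding peval_def by (rule sum.mono_neutral_left) (use supp assms in auto)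
  also have "\<dots> = (\<Sum>\<alpha>\<in>I. linear_poly I a (\<delta> \<alpha>) * (\<Prod>v\<in>I. x v ^ \<delta> \<alpha> v))"
    by (simp add: sum.reindex[OF inj])
  also have "\<dots> = (\<Sum>\<alpha>\<in>I. a \<alpha> * x \<alpha>)"
  proof (rule sum.cong[OF refl])
    fix \<alpha> assume \<alpha>: "\<alpha> \<in> I"
    have "linear_poly I a (\<delta> \<alpha>) = (\<Sum>\<beta>\<in>I. if \<beta> = \<alpha> then a \<beta> else 0)"
      unfolding L by (rule sum.cong[OF refl]) (use inj_onD[OF inj _ \<alpha>] in force)
    also have "\<dots> = a \<alpha>" using \<alpha> assms by simp
    finally have 1: "linear_poly I a (\<delta> \<alpha>) = a \<alpha>" .
    have "(\<Prod>v\<in>I. x v ^ \<delta> \<alpha> v) = (\<Prod>v\<in>I. if v = \<alpha> then x v else 1)"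
      by (rule prod.cong) (auto simp: \<delta>_def)
    also have "\<dots> = x \<alpha>" using \<alpha> assms by simp
    finally show "linear_poly I a (\<delta> \<alpha>) * (\<Prod>v\<in>I. x v ^ \<delta> \<alpha> v) = a \<alpha> * x \<alpha>" by (simp add: 1)
  qed
  finally show "peval I (linear_poly I a) x = (\<Sum>\<alpha>\<in>I. a \<alpha> * x \<alpha>)" .
qed

text \<open>The equations are the 2 x 2 minors of (f, g) through a fixed coefficient
  \<open>\<alpha>0\<close> at which \<open>f\<close> is nonzero; they are linear in
  \<open>g\<close>.\<close>

lemma zclosed_point:
  fixes f :: "'k::field form"
  assumes "f \<in> Pforms n e"
  shows "zclosed n e {g. \<exists>c. c \<noteq> 0 \<and> g = fscale c f}"
proof -
  let ?I = "coeff_idx n e"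
  have f: "form n e f" using assms by (simp add: Pforms_def)
  obtain \<alpha>0 where \<alpha>0: "f \<alpha>0 \<noteq> 0" using assms by (auto simp: Pforms_def)
  then have \<alpha>0I: "\<alpha>0 \<in> ?I" using f by (simp add: form_iff)
  define a where "a \<alpha> = (\<lambda>\<beta>. (if \<beta> = \<alpha> then f \<alpha>0 else 0) - (if \<beta> = \<alpha>0 then f \<alpha> else 0))" for \<alpha>
  have a: "(\<Sum>\<beta>\<in>?I. a \<alpha> \<beta> * g \<beta>) = f \<alpha>0 * g \<alpha> - f \<alpha> * g \<alpha>0" if "\<alpha> \<in> ?I" for \<alpha> g
    using that \<alpha>0I by (simp add: a_def left_diff_distrib sum_subtractf if_distrib[of "\<lambda>y. y * _"] cong: if_cong)
  let ?P = "(\<lambda>\<alpha>. (1::nat, linear_poly ?I (a \<alpha>))) ` ?I"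
  have "{g. \<exists>c. c \<noteq> 0 \<and> g = fscale c f} = {g \<in> Pforms n e. \<forall>(r, P)\<in>?P. peval ?I P g = 0}"
  proof (intro equalityI subsetI)
    fix g assume "g \<in> {g. \<exists>c. c \<noteq> 0 \<and> g = fscale c f}"
    then obtain c where c: "c \<noteq> 0" "g = fscale c f" by blast
    have "g \<in> Pforms n e" unfolding c(2) using assms c(1) by (rule Pforms_scale)
    moreover have "peval ?I (linear_poly ?I (a \<alpha>)) g = 0" if "\<alpha> \<in> ?I" for \<alpha>
      unfolding linear_poly(2)[OF finite_coeff_idx] a[OF that] by (simp add: c(2) fscale_def)
    ultimately show "g \<in> {g \<in> Pforms n e. \<forall>(r, P)\<in>?P. peval ?I P g = 0}" by auto
  next
    fix g assume g_mem: "g \<in> {g \<in> Pforms n e. \<forall>(r, P)\<in>?P. peval ?I P g = 0}"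
    then have g: "form n e g" "g \<noteq> (\<lambda>_. 0)" by (simp_all add: Pforms_def)
    have *: "g \<alpha> = (g \<alpha>0 / f \<alpha>0) * f \<alpha>" if "\<alpha> \<in> ?I" for \<alpha>
    proof -
      have "peval ?I (linear_poly ?I (a \<alpha>)) g = 0" using g_mem that by blast
      then have "f \<alpha>0 * g \<alpha> - f \<alpha> * g \<alpha>0 = 0"
        unfolding linear_poly(2)[OF finite_coeff_idx] a[OF that] .
      then show ?thesis using \<alpha>0 by (simp add: field_simps)
    qed
    have "g \<alpha> = (g \<alpha>0 / f \<alpha>0) * f \<alpha>" for \<alpha>
    proof (cases "\<alpha> \<in> ?I")
      case False
      then have "g \<alpha> = 0" "f \<alpha> = 0" using f g(1) by (auto simp: form_iff)
      then show ?thesis by simp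
    qed (rule *)
    then obtain c where c: "\<And>\<alpha>. g \<alpha> = c * f \<alpha>" by blast
    then have "g = fscale c f" unfolding fscale_def by (intro ext)
    moreover have "c \<noteq> 0" using g(2) c by auto
    ultimately show "g \<in> {g. \<exists>c. c \<noteq> 0 \<and> g = fscale c f}" by blast
  qed
  moreover have "\<forall>(r, P)\<in>?P. is_hpoly ?I r P" by (auto simp: linear_poly(1)[simplified])
  ultimately show ?thesis unfolding zclosed_def by blast
qed

lemma zclosed_Pforms: "zclosed n e (Pforms n e)"
  unfolding zclosed_def by (intro exI[of _ "{}"]) auto

text \<open>Derivatives of the point at parameter \<open>t\<close> are derivatives of
  \<open>h1\<close> along transformed directions, where the transformation is a pencil equal to the
  identity at t = 0. Wherever it is invertible, the gradient span is unchanged.\<close>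

lemma finite_line_not_in_fiber:
  fixes f h1 h2 :: "'k::field form"
  assumes ch: "of_nat (fact (Suc d)) \<noteq> (0::'k)"
    and h1: "h1 \<in> grad_fiber n d f" and h2: "h2 \<in> grad_fiber n d f"
  shows "finite {t. (\<lambda>m. h1 m + t * (h2 m - h1 m)) \<notin> grad_fiber n d f}"
proof -
  have h: "form n (Suc d) h1" "h1 \<noteq> (\<lambda>_. 0)" "form n (Suc d) h2" "grad_dim n h1 = n"
    "grad_span n h1 = grad_span n f" "grad_span n h2 = grad_span n h1"
    using h1 h2 by (auto simp: grad_fiber_def Pc_def Pforms_def)
  have "\<exists>c. pderiv_form i h2 = dv n c h1" if i: "i < n" for i
  proof -
    have "dv n (unit_fun i) h2 \<in> grad_span n h2" unfolding grad_span_eq_range by (rule rangeI)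
    then have "dv n (unit_fun i) h2 \<in> grad_span n h1" by (simp only: h(6))
    then obtain c where "dv n (unit_fun i) h2 = dv n c h1" unfolding grad_span_eq_range by (rule rangeE)
    then have "pderiv_form i h2 = dv n c h1" by (simp only: dv_unit[OF i])
    then show ?thesis by (intro exI)
  qed
  then have "\<forall>i. \<exists>c. i < n \<longrightarrow> pderiv_form i h2 = dv n c h1" by blast
  then have "\<exists>M. \<forall>i. i < n \<longrightarrow> pderiv_form i h2 = dv n (M i) h1" by (rule choice)
  then obtain M where M: "\<And>i. i < n \<Longrightarrow> pderiv_form i h2 = dv n (M i) h1" by blast
  let ?one = "\<lambda>i j. if i = j then (1::'k) else 0"
  let ?h = "\<lambda>t m. h1 m + t * (h2 m - h1 m)"
  let ?R = "\<lambda>t i j. ?one i j + t * (M j i - ?one i j)"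
  have one: "lin n ?one x i = x i" if "i < n" for x i
    using that by (simp add: lin_def if_distrib[of "\<lambda>y. y * _"] cong: if_cong)
  have "mdet n ?one \<noteq> 0" by (rule mdet_neq_0_if_inj) (simp add: one)
  then have "finite {t. mdet n (?R t) = 0}" by (rule finite_singular_pencil)
  moreover have "{t. ?h t \<notin> grad_fiber n d f} \<subseteq> {t. mdet n (?R t) = 0}"
  proof (rule subsetI, rule CollectI, rule ccontr)
    fix t assume "t \<in> {t. ?h t \<notin> grad_fiber n d f}" and R: "mdet n (?R t) \<noteq> 0"
    then have nin: "?h t \<notin> grad_fiber n d f" by simp
    have dvh2: "dv n c h2 = dv n (lc n M c) h1" for c
      unfolding dv_lc dv_def[of n c h2] by (rule ext, rule sum.cong[OF refl]) (simp add: M)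
    have hform: "form n (Suc d) (?h t)" by (intro form_add form_cmult form_diff h)
    have eq: "?h t = (\<lambda>m. (1 - t) * h1 m + t * h2 m)" by (simp add: algebra_simps)
    have dvh: "dv n c (?h t) = dv n (lin n (?R t) c) h1" for c
    proof -
      have "dv n c (?h t) = dv n (\<lambda>i. (1 - t) * c i + t * lc n M c i) h1"
        unfolding eq dv_add_form dv_cmult_form dv_add dv_cmult dvh2 ..
      also have "\<dots> = dv n (lin n (?R t) c) h1"
      proof (rule dv_cong)
        fix i assume i: "i < n"
        have "lin n (?R t) c i = (\<Sum>j<n. (1 - t) * (?one i j * c j) + t * (c j * M j i))"
          unfolding lin_def by (rule sum.cong) (auto simp: algebra_simps)
        also have "\<dots> = (1 - t) * lin n ?one c i + t * lc n M c i"
          by (simp add: sum.distrib sum_distrib_left lin_def lc_def)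
        finally show "(1 - t) * c i + t * lc n M c i = lin n (?R t) c i" by (simp add: one[OF i])
      qed
      finally show ?thesis .
    qed
    obtain B where B: "\<forall>x. \<forall>i<n. lin n (?R t) (lin n B x) i = x i"
      using mdet_neq_0_inverse[OF R] by blast
    have dvh1: "dv n c h1 = dv n (lin n B c) (?h t)" for c
      unfolding dvh by (rule dv_cong) (simp add: B)
    have sp: "grad_span n (?h t) = grad_span n h1"
    proof (intro equalityI grad_span_subsetI)
      show "\<exists>w. dv n v (?h t) = dv n w h1" for v using dvh[of v] by (intro exI)
      show "\<exists>w. dv n v h1 = dv n w (?h t)" for v using dvh1[of v] by (intro exI)
    qed
    have "?h t \<noteq> (\<lambda>_. 0)"
    proof
      assume 0: "?h t = (\<lambda>_. 0)"
      have "pderiv_form i h1 = (\<lambda>_. 0)" if "i < n" for i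
        using dvh1[of "unit_fun i"] unfolding 0 dv_unit[OF that] dv_zero_form .
      then have "h1 = (\<lambda>_. 0)" by (rule form_eq_0_if_pderivs_0[OF ch h(1)])
      with h(2) show False ..
    qed
    then have "?h t \<in> grad_fiber n d f"
      using hform h(4,5) sp by (simp add: grad_fiber_def Pc_def Pforms_def grad_dim_def)
    with nin show False ..
  qed
  ultimately show ?thesis by (rule finite_subset[rotated])
qed

lemma zirreducible_grad_fiber:
  fixes f :: "'k::field form"
  assumes inf: "infinite (UNIV :: 'k set)" and ch: "of_nat (fact (Suc d)) \<noteq> (0::'k)"
    and "f \<in> grad_fiber n d f"
  shows "zirreducible n (Suc d) (grad_fiber n d f)"
  unfolding zirreducible_def
proof (intro conjI allI impI)
  let ?Y = "grad_fiber n d f" and ?I = "coeff_idx n (Suc d)"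
  show "?Y \<noteq> {}" using assms(3) by blast
  fix Z1 Z2 :: "'k form set"
  assume "zclosed n (Suc d) Z1 \<and> zclosed n (Suc d) Z2 \<and> ?Y \<subseteq> Z1 \<union> Z2"
  then have Z: "zclosed n (Suc d) Z1" "zclosed n (Suc d) Z2" "?Y \<subseteq> Z1 \<union> Z2" by auto
  have sep: "\<exists>P. peval ?I P h \<noteq> 0 \<and> (\<forall>g\<in>Z. peval ?I P g = 0)"
    if Z: "zclosed n (Suc d) Z" and h: "h \<in> ?Y" "h \<notin> Z" for Z h
  proof -
    have hP: "h \<in> Pforms n (Suc d)" using h(1) by (auto simp: grad_fiber_def Pc_def)
    obtain \<P> where "\<forall>(r, P)\<in>\<P>. is_hpoly ?I r P"
      and Z': "Z = {f \<in> Pforms n (Suc d). \<forall>(r, P)\<in>\<P>. peval ?I P f = 0}"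
      using Z unfolding zclosed_def by blast
    have "\<not> (\<forall>(r, P)\<in>\<P>. peval ?I P h = 0)" using hP h(2) unfolding Z' by blast
    then obtain r P where P: "(r, P) \<in> \<P>" "peval ?I P h \<noteq> 0" by blast
    moreover have "\<forall>g\<in>Z. peval ?I P g = 0" using P(1) unfolding Z' by blast
    ultimately show ?thesis by blast
  qed
  show "?Y \<subseteq> Z1 \<or> ?Y \<subseteq> Z2"
  proof (rule ccontr)
    assume "\<not> ?thesis"
    then obtain h1 h2 where h: "h1 \<in> ?Y" "h1 \<notin> Z1" "h2 \<in> ?Y" "h2 \<notin> Z2" by blast
    obtain P1 where P1: "peval ?I P1 h1 \<noteq> 0" "\<forall>g\<in>Z1. peval ?I P1 g = 0" using sep[OF Z(1) h(1,2)] by blast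
    obtain P2 where P2: "peval ?I P2 h2 \<noteq> 0" "\<forall>g\<in>Z2. peval ?I P2 g = 0" using sep[OF Z(2) h(3,4)] by blast
    let ?h = "\<lambda>t m. h1 m + t * (h2 m - h1 m)"
    have ex: "\<exists>r. \<forall>t. poly r t = peval ?I P (?h t)" for P
      using ex_poly_peval[of ?I P "\<lambda>m. [:h1 m, h2 m - h1 m:]"] by simp
    obtain r1 where r1: "\<forall>t. poly r1 t = peval ?I P1 (?h t)" using ex[of P1] by blast
    obtain r2 where r2: "\<forall>t. poly r2 t = peval ?I P2 (?h t)" using ex[of P2] by blast
    note r = r1[rule_format] r2[rule_format]
    have "poly r1 0 \<noteq> 0" "poly r2 1 \<noteq> 0" using P1(1) P2(1) by (simp_all add: r)
    then have "r1 \<noteq> 0" "r2 \<noteq> 0" by auto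
    \<comment> \<open>The line starts at \<open>h1\<close> outside \<open>Z1\<close> and reaches
      \<open>h2\<close> outside \<open>Z2\<close>. All but finitely many of its points avoid both
      closed sets and stay in the fibre.\<close>
    then have "finite ({t. poly r1 t = 0} \<union> {t. poly r2 t = 0} \<union> {t. ?h t \<notin> ?Y})"
      by (intro finite_UnI poly_roots_finite finite_line_not_in_fiber[OF ch h(1,3)])
    from ex_new_if_finite[OF inf this] obtain t where
      t: "poly r1 t \<noteq> 0" "poly r2 t \<noteq> 0" "?h t \<in> ?Y" by auto
    from Z(3) t(3) have "?h t \<in> Z1 \<union> Z2" by (rule subsetD)
    then show False
    proof
      assume "?h t \<in> Z1"
      from bspec[OF P1(2) this] t(1) show False unfolding r by (rule notE[rotated])
    next
      assume "?h t \<in> Z2"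
      from bspec[OF P2(2) this] t(2) show False unfolding r by (rule notE[rotated])
    qed
  qed
qed

text \<open>Closed sets are stable under nonzero scaling, so one containing \<open>f\<close>
  contains all its representatives.\<close>

lemma zirreducible_point:
  "zirreducible n e {g. \<exists>c. c \<noteq> 0 \<and> g = fscale c f}"
proof -
  let ?T = "{g. \<exists>c. c \<noteq> 0 \<and> g = fscale c f}"
  have f: "f \<in> ?T" by (auto intro!: exI[of _ 1] simp: fscale_def)
  moreover have "?T \<subseteq> Z" if "zclosed n e Z" "f \<in> Z" for Z using zclosed_scale[OF that] by blast
  ultimately show ?thesis unfolding zirreducible_def by blast
qed

lemma pos_fiber_dim_if_not_injective:
  fixes f :: "'k::field form"
  assumes inf: "infinite (UNIV :: 'k set)" and ch: "of_nat (fact (Suc d)) \<noteq> (0::'k)"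
    and f: "form n (Suc d) f" and ind: "indep_grad n f" and ni: "grad_not_injective_at n d f"
  shows "grad_pos_fiber_dim_at n d f"
proof -
  let ?Y = "grad_fiber n d f" and ?T = "{g. \<exists>c. c \<noteq> 0 \<and> g = fscale c f}"
  obtain g where g: "g \<in> Pc n d" "\<not> same_point f g" "grad_span n g = grad_span n f"
    using ni unfolding grad_not_injective_at_def by blast
  have "0 < n"
  proof (rule ccontr)
    assume "\<not> 0 < n"
    then show False using g(1) form_0_vars[of d g] by (auto simp: Pc_def Pforms_def)
  qed
  have "f \<noteq> (\<lambda>_. 0)"
  proof
    assume "f = (\<lambda>_. 0)"
    then have "dv n (\<lambda>_. 1) f = (\<lambda>_. 0)" by simp
    then have "(1::'k) = 0" using ind \<open>0 < n\<close> unfolding indep_grad_def by blast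
    then show False by simp
  qed
  then have fP: "f \<in> Pforms n (Suc d)" using f by (simp add: Pforms_def)
  have fY: "f \<in> ?Y" using fP grad_dim_if_indep_grad[OF ind] by (simp add: grad_fiber_def Pc_def)
  have T: "?T \<subseteq> ?Y"
  proof
    fix h assume "h \<in> ?T"
    then obtain c where c: "c \<noteq> 0" "h = fscale c f" by blast
    have hc: "h = (\<lambda>m. c * f m)" "f = (\<lambda>m. inverse c * h m)" using c by (auto simp: fscale_def)
    have sp: "grad_span n h = grad_span n f"
    proof (intro equalityI grad_span_subsetI)
      show "\<exists>w. dv n v h = dv n w f" for v
        by (intro exI[of _ "\<lambda>i. c * v i"]) (simp only: hc(1) dv_cmult dv_cmult_form)
      show "\<exists>w. dv n v f = dv n w h" for v
        by (intro exI[of _ "\<lambda>i. inverse c * v i"]) (subst hc(2), simp only: dv_cmult dv_cmult_form)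
    qed
    have "h \<in> Pforms n (Suc d)" unfolding c(2) using fP c(1) by (rule Pforms_scale)
    then show "h \<in> ?Y" using fY sp by (simp add: grad_fiber_def Pc_def grad_dim_def)
  qed
  have "g \<in> ?Y" using g by (simp add: grad_fiber_def)
  moreover have "g \<notin> ?T" using g(2) by (auto simp: same_point_def)
  ultimately have strict: "?T \<subset> ?Y" using T by blast
  have c1: "zclosed_in n (Suc d) ?Y ?T"
    unfolding zclosed_in_def using zclosed_point[OF fP] T by blast
  have "?Y \<subseteq> Pforms n (Suc d)" by (auto simp: grad_fiber_def Pc_def)
  then have c2: "zclosed_in n (Suc d) ?Y ?Y"
    unfolding zclosed_in_def using zclosed_Pforms by blast
  show ?thesis
    unfolding grad_pos_fiber_dim_at_def local_dim_ge_def Suc_eq_plus1[symmetric]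
    using c1 c2 strict fY zirreducible_point[of n "Suc d" f] zirreducible_grad_fiber[OF inf ch fY]
    by (intro exI[of _ "\<lambda>i. if i = 0 then ?T else ?Y"]) auto
qed

text \<open>If the fibre is a single point, any nonempty relatively closed subset contains every
  representative of that point, which leaves no strict inclusion.\<close>

lemma not_injective_if_pos_fiber_dim:
  fixes f :: "'k::field form"
  assumes "grad_pos_fiber_dim_at n d f"
  shows "grad_not_injective_at n d f"
proof (rule ccontr)
  assume inj: "\<not> grad_not_injective_at n d f"
  let ?Y = "grad_fiber n d f"
  obtain T where "(\<forall>i\<le>1. zclosed_in n (Suc d) ?Y (T i) \<and> zirreducible n (Suc d) (T i)) \<and>
    (\<forall>i<1. T i \<subset> T (Suc i)) \<and> f \<in> T 1"
    using assms unfolding grad_pos_fiber_dim_at_def local_dim_ge_def Suc_eq_plus1[symmetric] by (rule exE)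
  then have T: "zclosed_in n (Suc d) ?Y (T 0)" "zclosed_in n (Suc d) ?Y (T 1)"
    "T 0 \<noteq> {}" "T 0 \<subset> T 1" by (auto simp: zirreducible_def)
  have sp: "\<exists>c. g = fscale c f" if "g \<in> ?Y" for g
    using inj that unfolding grad_not_injective_at_def grad_fiber_def same_point_def by blast
  obtain Z where Z: "zclosed n (Suc d) Z" "T 0 = ?Y \<inter> Z" using T(1) unfolding zclosed_in_def by blast
  then obtain g where g: "g \<in> ?Y" "g \<in> Z" using T(3) by blast
  obtain c where c: "g = fscale c f" using sp[OF g(1)] by blast
  have "T 1 \<subseteq> T 0"
  proof
    fix h assume "h \<in> T 1"
    then have h: "h \<in> ?Y" using T(2) unfolding zclosed_in_def by blast
    then obtain b where b: "h = fscale b f" using sp by blast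
    have "g \<noteq> (\<lambda>_. 0)" "h \<noteq> (\<lambda>_. 0)" using g(1) h by (auto simp: grad_fiber_def Pc_def Pforms_def)
    then have nz: "c \<noteq> 0" "b \<noteq> 0" using b c by (auto simp: fscale_def)
    then have "h = fscale (b / c) g" by (simp add: b c fscale_def)
    then have "h \<in> Z" using zclosed_scale[OF Z(1) g(2), of "b / c"] nz by simp
    then show "h \<in> T 0" using h Z by blast
  qed
  then show False using T(4) by blast
qed

subsection \<open>Destabilizing one-parameter subgroups\<close>

text \<open>A curve of forms with coefficients polynomial in \<open>t\<close>, tending to 0 at t =
  0. The values are prescribed only for t /= 0 because the families in question contain
  \<open>inverse t\<close>.\<close>

definition pos_family :: "nat \<Rightarrow> nat \<Rightarrow> ('k::field \<Rightarrow> (nat \<Rightarrow> 'k) \<Rightarrow> 'k) \<Rightarrow> bool" where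
  "pos_family n e F \<longleftrightarrow> (\<exists>q. (\<forall>\<alpha>. \<alpha> \<notin> coeff_idx n e \<longrightarrow> q \<alpha> = 0) \<and> (\<forall>\<alpha>. poly (q \<alpha>) 0 = 0) \<and>
     (\<forall>t. t \<noteq> 0 \<longrightarrow> (\<forall>x. F t x = feval n (\<lambda>\<alpha>. poly (q \<alpha>) t) x)))"

lemma pos_family_add:
  assumes "pos_family n e F" "pos_family n e G"
  shows "pos_family n e (\<lambda>t x. F t x + G t x)"
proof -
  obtain q where q: "\<forall>\<alpha>. \<alpha> \<notin> coeff_idx n e \<longrightarrow> q \<alpha> = 0" "\<forall>\<alpha>. poly (q \<alpha>) 0 = 0"
    "\<forall>t. t \<noteq> 0 \<longrightarrow> (\<forall>x. F t x = feval n (\<lambda>\<alpha>. poly (q \<alpha>) t) x)"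
    using assms(1) unfolding pos_family_def by blast
  obtain p where p: "\<forall>\<alpha>. \<alpha> \<notin> coeff_idx n e \<longrightarrow> p \<alpha> = 0" "\<forall>\<alpha>. poly (p \<alpha>) 0 = 0"
    "\<forall>t. t \<noteq> 0 \<longrightarrow> (\<forall>x. G t x = feval n (\<lambda>\<alpha>. poly (p \<alpha>) t) x)"
    using assms(2) unfolding pos_family_def by blast
  have "form n e (\<lambda>\<alpha>. poly (q \<alpha>) t)" "form n e (\<lambda>\<alpha>. poly (p \<alpha>) t)" for t
    using q(1) p(1) unfolding form_iff by (metis poly_0)+
  note fe = feval_add[OF this]
  show ?thesis unfolding pos_family_def
    by (rule exI[of _ "\<lambda>\<alpha>. q \<alpha> + p \<alpha>"]) (use q p in \<open>simp add: fe\<close>)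
qed

lemma pos_family_zero: "pos_family n e (\<lambda>t x. 0)"
  unfolding pos_family_def by (rule exI[of _ "\<lambda>_. 0"]) simp

lemma pos_family_sum:
  "(\<And>i. i \<in> I \<Longrightarrow> pos_family n e (F i)) \<Longrightarrow> pos_family n e (\<lambda>t x. \<Sum>i\<in>I. F i t x)"
  by (induction I rule: infinite_finite_induct) (auto intro: pos_family_add pos_family_zero)

lemma pos_family_term:
  assumes "polyfun n e \<Phi>" "1 \<le> k"
  shows "pos_family n e (\<lambda>t x. t ^ k * \<Phi> x)"
proof -
  obtain h where h: "form n e h" "\<forall>x. \<Phi> x = feval n h x" using assms(1) unfolding polyfun_def by blast
  have "\<alpha> \<notin> coeff_idx n e \<Longrightarrow> h \<alpha> = 0" for \<alpha> using h(1) unfolding form_iff by blast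
  moreover have "feval n (\<lambda>\<alpha>. t ^ k * h \<alpha>) x = t ^ k * feval n h x" for t x by (rule feval_cmult[OF h(1)])
  ultimately show ?thesis unfolding pos_family_def
    using assms(2) by (intro exI[of _ "\<lambda>\<alpha>. monom (h \<alpha>) k"]) (simp add: poly_monom h(2) mult.commute)
qed

lemma pos_family_cong:
  "(\<And>t x. t \<noteq> 0 \<Longrightarrow> F t x = G t x) \<Longrightarrow> pos_family n e G \<Longrightarrow> pos_family n e F"
  unfolding pos_family_def by simp

lemma mdet_diag: "mdet n (\<lambda>i j. if i = j then s i else 0) = (\<Prod>i<n. s i)"
proof -
  let ?D = "\<lambda>i j. if i = j then s i else 0"
  have "upper_triangular (sq_mat n ?D)" by (auto simp: sq_mat_def)
  then have "det (sq_mat n ?D) = prod_list (diag_mat (sq_mat n ?D))"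
    by (rule det_upper_triangular) (rule sq_mat_carrier)
  also have "\<dots> = (\<Prod>i<n. s i)" by (simp add: prod_list_diag_prod sq_mat_def atLeast0LessThan)
  finally show ?thesis by (simp add: det_sq_mat)
qed

text \<open>For t /= 0 the family runs inside the SL(n) orbit. A polynomial function vanishing on
  the orbit therefore vanishes on the curve away from t = 0, hence also at its limit 0.\<close>

lemma not_semistable_if_pos_family:
  fixes f :: "'k::field form"
  assumes inf: "infinite (UNIV :: 'k set)" and AB: "mdet n A * mdet n B = 1"
    and s: "\<And>t. t \<noteq> 0 \<Longrightarrow> (\<Prod>i<n. s t i) = 1"
    and F: "pos_family n e (\<lambda>t x. feval n f (lin n A (\<lambda>i. s t i * lin n B x i)))"
  shows "\<not> semistable n e f"
proof
  assume "semistable n e f"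
  then obtain P :: "((nat \<Rightarrow> nat) \<Rightarrow> nat) \<Rightarrow> 'k" where
    P: "\<forall>g\<in>SL_orbit n e f. peval (coeff_idx n e) P g = 0" "peval (coeff_idx n e) P (\<lambda>_. 0) \<noteq> 0"
    unfolding semistable_def by blast
  obtain q where q: "\<forall>\<alpha>. \<alpha> \<notin> coeff_idx n e \<longrightarrow> q \<alpha> = 0" "\<forall>\<alpha>. poly (q \<alpha>) 0 = 0"
    "\<forall>t. t \<noteq> 0 \<longrightarrow> (\<forall>x. feval n f (lin n A (\<lambda>i. s t i * lin n B x i)) = feval n (\<lambda>\<alpha>. poly (q \<alpha>) t) x)"
    using F unfolding pos_family_def by blast
  obtain r where r: "\<forall>t. poly r t = peval (coeff_idx n e) P (\<lambda>\<alpha>. poly (q \<alpha>) t)"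
    using ex_poly_peval[of "coeff_idx n e" P q] by blast
  have "poly r t = 0" if t: "t \<noteq> 0" for t
  proof -
    let ?g = "\<lambda>\<alpha>. poly (q \<alpha>) t"
    let ?S = "\<lambda>i j. if i = j then s t i else 0"
    let ?D = "mmul n A (mmul n ?S B)"
    have "mdet n ?D = 1" using AB s[OF t] by (simp add: mdet_mmul mdet_diag)
    moreover have "feval n ?g x = feval n f (lin n ?D x)" for x
    proof -
      have "lin n ?S y i = s t i * y i" if "i < n" for y i
        using that by (simp add: lin_def if_distrib[of "\<lambda>z. z * _"] cong: if_cong)
      then have "lin n ?D x = lin n A (\<lambda>i. s t i * lin n B x i)"
        unfolding lin_mmul by (intro lin_cong) simp
      then show ?thesis using q(3) t by simp
    qed
    moreover have "form n e ?g" using q(1) unfolding form_iff by (metis poly_0)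
    ultimately have "?g \<in> SL_orbit n e f" unfolding SL_orbit_def by blast
    then show ?thesis using P(1) r by simp
  qed
  then have "{t. poly r t \<noteq> poly 0 t} \<subseteq> {0}" by auto
  then have "r = 0" by (intro poly_eqI_infinite[OF inf]) (rule finite_subset, auto)
  then show False using r[rule_format, of 0] q(2) P(2) by simp
qed

text \<open>If \<open>f\<close> factors through fewer linear forms, it is invariant along a common
  zero \<open>c\<close> of them. Weight 1 on the other coordinates, compensated by weight -(n - 1)
  along \<open>c\<close>, multiplies \<open>f\<close> by t^(d+1).\<close>

lemma concise_if_semistable:
  fixes f :: "'k::field form"
  assumes inf: "infinite (UNIV :: 'k set)" and f: "form n (Suc d) f" and ss: "semistable n (Suc d) f"
  shows "concise n (Suc d) f"
proof (rule ccontr)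
  assume "\<not> concise n (Suc d) f"
  then have "\<exists>m<n. \<exists>L h. form m (Suc d) h \<and> (\<forall>x. feval n f x = feval m h (\<lambda>i. \<Sum>j<n. L i j * x j))"
    unfolding concise_def by (rule notnotD)
  then obtain m L h where m: "m < n" and "form m (Suc d) h"
    and fL: "\<forall>x. feval n f x = feval m h (\<lambda>i. \<Sum>j<n. L i j * x j)" by (elim exE conjE) (rule that)
  \<comment> \<open>Zero rows make the matrix square; row \<open>m\<close> is zero as m < n, so the
    matrix is singular.\<close>
  let ?L = "\<lambda>i j. if i < m then L i j else 0"
  have det: "mdet n ?L = 0"
  proof (rule ccontr)
    assume "mdet n ?L \<noteq> 0"
    from mdet_neq_0_inverse[OF this]
    obtain B where "\<forall>x. \<forall>i<n. lin n ?L (lin n B x) i = x i" by blast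
    then have "lin n ?L (lin n B (\<lambda>_. 1)) m = 1" using m by simp
    then show False by (simp add: lin_def)
  qed
  have "\<exists>c. (\<forall>i<n. lin n ?L c i = 0) \<and> (\<exists>j<n. c j \<noteq> 0)"
  proof (rule ccontr)
    assume neg: "\<not> ?thesis"
    have "mdet n ?L \<noteq> 0"
    proof (rule mdet_neq_0_if_inj, rule ccontr)
      fix x j assume "\<And>i. i < n \<Longrightarrow> lin n ?L x i = 0" "j < n" "x j \<noteq> 0"
      then have "(\<forall>i<n. lin n ?L x i = 0) \<and> (\<exists>j<n. x j \<noteq> 0)" by blast
      then have "\<exists>c. (\<forall>i<n. lin n ?L c i = 0) \<and> (\<exists>j<n. c j \<noteq> 0)" by (intro exI)
      with neg show False by (rule notE)
    qed
    with det show False by simp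
  qed
  then obtain c where "(\<forall>i<n. lin n ?L c i = 0) \<and> (\<exists>j<n. c j \<noteq> 0)" by (elim exE) (rule that)
  then obtain i0 where c: "\<forall>i<n. lin n ?L c i = 0" and i0: "i0 < n" "c i0 \<noteq> 0" by blast
  have inv: "feval n f (\<lambda>i. x i + t * c i) = feval n f x" for x t
  proof -
    have "(\<Sum>j<n. L i j * (x j + t * c j)) = (\<Sum>j<n. L i j * x j)" if "i < m" for i
    proof -
      have "(\<Sum>j<n. L i j * c j) = 0" using c[rule_format, of i] m that by (simp add: lin_def)
      moreover have "(\<Sum>j<n. L i j * (x j + t * c j)) = (\<Sum>j<n. L i j * x j) + t * (\<Sum>j<n. L i j * c j)"
        by (simp add: algebra_simps sum.distrib sum_distrib_left)
      ultimately show ?thesis by simp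
    qed
    then show ?thesis unfolding fL[rule_format] by (rule feval_cong)
  qed
  \<comment> \<open>The identity with column \<open>i0\<close> replaced by \<open>c\<close>:
    invertible since c_i0 /= 0, and coordinate \<open>i0\<close> now runs along
    \<open>c\<close>.\<close>
  let ?A = "\<lambda>i j. if j = i0 then c i else if i = j then 1 else 0"
  have A: "lin n ?A x i = (if i = i0 then 0 else x i) + x i0 * c i" if "i < n" for x i
  proof -
    have "lin n ?A x i = (\<Sum>j<n. (if j = i0 then c i * x j else 0) + (if j = i then if i = i0 then 0 else x j else 0))"
      unfolding lin_def by (rule sum.cong) auto
    then show ?thesis using that i0(1) by (simp add: sum.distrib mult.commute)
  qed
  have "mdet n ?A \<noteq> 0"
  proof (rule mdet_neq_0_if_inj)
    fix x j assume x: "\<And>i. i < n \<Longrightarrow> lin n ?A x i = 0" and j: "j < n"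
    have "x i0 = 0" using x[OF i0(1)] A[OF i0(1), of x] i0(2) by simp
    then show "x j = 0" using x[OF j] A[OF j, of x] by (simp split: if_splits)
  qed
  from mdet_neq_0_inverse[OF this] obtain B where B: "mdet n ?A * mdet n B = 1" by blast
  define s where "s t i = (if i = i0 then inverse t ^ (n - 1) else t)" for t :: 'k and i
  \<comment> \<open>Dropping the coordinate along \<open>c\<close> does not change the values of
    \<open>f\<close>, and it removes the negative power of \<open>t\<close>.\<close>
  let ?B = "\<lambda>i j. if i = i0 then 0 else B i j"
  have "\<not> semistable n (Suc d) f"
  proof (rule not_semistable_if_pos_family[OF inf B])
    fix t :: 'k assume t: "t \<noteq> 0"
    have "(\<Prod>i<n. s t i) = s t i0 * (\<Prod>i\<in>{..<n} - {i0}. s t i)" using i0(1) by (simp add: prod.remove)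
    also have "(\<Prod>i\<in>{..<n} - {i0}. s t i) = (\<Prod>i\<in>{..<n} - {i0}. t)" by (rule prod.cong) (auto simp: s_def)
    also have "\<dots> = t ^ (n - 1)" using i0(1) by simp
    finally show "(\<Prod>i<n. s t i) = 1" using t by (simp add: s_def power_inverse)
  next
    have "pos_family n (Suc d) (\<lambda>t x. t ^ Suc d * feval n f (lin n ?B x))"
      using polyfun_linear_subst[OF f, of n ?B] by (intro pos_family_term) (simp_all add: lin_def)
    then show "pos_family n (Suc d) (\<lambda>t x. feval n f (lin n ?A (\<lambda>i. s t i * lin n B x i)))"
    proof (rule pos_family_cong[rotated])
      fix t :: 'k and x :: "nat \<Rightarrow> 'k"
      let ?y = "\<lambda>i. s t i * lin n B x i"
      have "feval n f (lin n ?A ?y) = feval n f (\<lambda>i. t * lin n ?B x i + ?y i0 * c i)"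
      proof (rule feval_cong)
        fix i assume i: "i < n"
        have "lin n ?B x i = (if i = i0 then 0 else lin n B x i)" by (simp add: lin_def)
        then show "lin n ?A ?y i = t * lin n ?B x i + ?y i0 * c i"
          unfolding A[OF i] by (simp add: s_def)
      qed
      also have "\<dots> = feval n f (\<lambda>i. t * lin n ?B x i)" by (rule inv)
      also have "\<dots> = t ^ Suc d * feval n f (lin n ?B x)" by (rule feval_homogeneous[OF f])
      finally show "feval n f (lin n ?A ?y) = t ^ Suc d * feval n f (lin n ?B x)" .
    qed
  qed
  with ss show False by blast
qed

text \<open>The three blocks of variables of an LDS form get weights \<open>-a\<close>, \<open>b\<close> and \<open>c\<close>: they sum to 0
  and every monomial of the normal form has positive weight.\<close>

lemma ex_LDS_weights:
  assumes "1 \<le> l" "2 * l \<le> n" "2 \<le> (d::nat)"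
  obtains a b c where "1 \<le> b" "1 \<le> c" "a < b * d" "a * l = b * l + c * (n - 2 * l)"
proof (cases "n = 2 * l")
  case True
  then show thesis using assms by (intro that[of 1 1 1]) auto
next
  case False
  obtain d' where d: "d = d' + 2" using assms(3) by (metis add.commute le_Suc_ex)
  define k where "k = n - 2 * l"
  have k: "1 \<le> k" using False assms(2) by (simp add: k_def)
  show thesis
  \<comment> \<open>The witnesses are given in the order \<open>b\<close>, \<open>c\<close>,
    \<open>a\<close>. For b = 2 k the bound is b d = 2 d k; the choice a = (2 d - 1) k lies just
    below it, and the balance equation then gives c = (2 d - 3) l, positive since d >= 2.\<close>
  proof (rule that[of "2 * k" "l * (2 * d' + 1)" "k * (2 * d' + 3)"])
    show "k * (2 * d' + 3) < 2 * k * d" using k by (simp add: d algebra_simps)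
    show "k * (2 * d' + 3) * l = 2 * k * l + l * (2 * d' + 1) * (n - 2 * l)"
      unfolding k_def[symmetric] by (simp add: algebra_simps)
  qed (use k assms in auto)
qed

lemma not_semistable_if_LDS:
  fixes f :: "'k::field form"
  assumes inf: "infinite (UNIV :: 'k set)" and d: "2 \<le> d" and lds: "LDS n d f"
  shows "\<not> semistable n (Suc d) f"
proof -
  obtain A l H G where A: "mdet n A \<noteq> 0" and l: "1 \<le> l" "2 * l \<le> n"
    and H: "form l (Suc d) H" and G: "form (n - l) (Suc d) G"
    and fA: "\<And>x. feval n f (lin n A x) = (\<Sum>i<l. x i * feval l (pderiv_form i H) (\<lambda>j. x (l + j)))
            + feval (n - l) G (\<lambda>j. x (l + j))"
    using lds unfolding LDS_def Suc_eq_plus1[symmetric] by blast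
  obtain B where B: "mdet n A * mdet n B = 1" using mdet_neq_0_inverse[OF A] by blast
  obtain a b c where w: "1 \<le> b" "1 \<le> c" "a < b * d" "a * l = b * l + c * (n - 2 * l)"
    using ex_LDS_weights[OF l d] by metis
  define wt where "wt j = (if j < l then b else c)" for j
  define s where "s t i = (if i < l then inverse t ^ a else t ^ wt (i - l))" for t :: 'k and i
  \<comment> \<open>The common weight of all terms x_i times a partial of \<open>H\<close>: -a from
    x_i and b d from the partial of degree d.\<close>
  define k where "k = b * d - a"
  show ?thesis
  proof (rule not_semistable_if_pos_family[OF inf B])
    fix t :: 'k assume t: "t \<noteq> 0"
    have n: "n = l + (l + (n - 2 * l))" using l by simp
    have split: "(\<Prod>i<p + r. F i) = (\<Prod>i<p. F i) * (\<Prod>i<r. F (p + i))" for p r :: nat and F :: "nat \<Rightarrow> 'k"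
      by (induction r) (simp_all add: mult.assoc)
    have "(\<Prod>i<n. s t i) = (\<Prod>i<l. s t i) * ((\<Prod>i<l. s t (l + i)) * (\<Prod>i<n - 2 * l. s t (l + (l + i))))"
      by (subst n) (simp only: split)
    also have "\<dots> = inverse t ^ (a * l) * (t ^ (b * l) * t ^ (c * (n - 2 * l)))"
      by (simp add: s_def wt_def power_mult)
    also have "\<dots> = inverse t ^ (a * l) * t ^ (a * l)" by (simp add: w(4) power_add)
    also have "\<dots> = 1" using t by (simp add: power_inverse)
    finally show "(\<Prod>i<n. s t i) = 1" .
  next
    let ?y = "\<lambda>x j. lin n B x (l + j)"
    let ?\<Phi> = "\<lambda>x. \<Sum>i<l. lin n B x i * feval l (pderiv_form i H) (?y x)"
    \<comment> \<open>The monomials of \<open>G\<close> have differing weights, so \<open>G\<close>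
      is treated monomial by monomial.\<close>
    let ?\<Psi> = "\<lambda>\<mu> x. G \<mu> * (\<Prod>j<n - l. ?y x j ^ \<mu> j)"
    let ?I = "coeff_idx (n - l) (Suc d)"
    have \<Phi>: "polyfun n (Suc d) ?\<Phi>"
    proof (rule polyfun_sum)
      fix i assume "i \<in> {..<l}"
      then have "form l d (pderiv_form i H)" by (intro form_pderiv[OF H]) simp
      from polyfun_linear_mult[OF polyfun_linear_subst[OF this, of n "\<lambda>i. B (l + i)"], of "B i"]
      show "polyfun n (Suc d) (\<lambda>x. lin n B x i * feval l (pderiv_form i H) (?y x))"
        by (simp add: lin_def)
    qed
    have \<Psi>: "polyfun n (Suc d) (?\<Psi> \<mu>)" if "\<mu> \<in> ?I" for \<mu>
    proof (rule polyfun_cmult)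
      show "polyfun n (Suc d) (\<lambda>x. \<Prod>j<n - l. ?y x j ^ \<mu> j)"
        using polyfun_linear_monomial[of n \<mu> "n - l" "\<lambda>i. B (l + i)"] that by (simp add: lin_def coeff_idx_def)
    qed
    have wt_pos: "1 \<le> (\<Sum>j<n - l. wt j * \<mu> j)" if "\<mu> \<in> ?I" for \<mu>
    proof -
      have "1 \<le> (\<Sum>j<n - l. \<mu> j)" using that by (simp add: coeff_idx_def)
      also have "\<dots> \<le> (\<Sum>j<n - l. wt j * \<mu> j)"
        by (rule sum_mono) (use w(1,2) in \<open>auto simp: wt_def\<close>)
      finally show ?thesis .
    qed
    have "pos_family n (Suc d) (\<lambda>t x. t ^ k * ?\<Phi> x + (\<Sum>\<mu>\<in>?I. t ^ (\<Sum>j<n - l. wt j * \<mu> j) * ?\<Psi> \<mu> x))"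
      using w(3) by (intro pos_family_add pos_family_sum pos_family_term \<Phi> \<Psi> wt_pos) (auto simp: k_def)
    then show "pos_family n (Suc d) (\<lambda>t x. feval n f (lin n A (\<lambda>i. s t i * lin n B x i)))"
    proof (rule pos_family_cong[rotated])
      fix t :: 'k and x :: "nat \<Rightarrow> 'k" assume t: "t \<noteq> 0"
      have 1: "(s t i * lin n B x i) * feval l (pderiv_form i H) (\<lambda>j. s t (l + j) * ?y x j) =
          t ^ k * (lin n B x i * feval l (pderiv_form i H) (?y x))" if i: "i < l" for i
      proof -
        have "feval l (pderiv_form i H) (\<lambda>j. s t (l + j) * ?y x j) = feval l (pderiv_form i H) (\<lambda>j. t ^ b * ?y x j)"
          by (rule feval_cong) (simp add: s_def wt_def)
        also have "\<dots> = (t ^ b) ^ d * feval l (pderiv_form i H) (?y x)"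
          by (rule feval_homogeneous[OF form_pderiv[OF H i]])
        finally have 2: "feval l (pderiv_form i H) (\<lambda>j. s t (l + j) * ?y x j) = (t ^ b) ^ d * feval l (pderiv_form i H) (?y x)" .
        have "(t ^ b) ^ d = t ^ a * t ^ k" using w(3) by (simp add: k_def power_mult[symmetric] power_add[symmetric])
        then have "inverse t ^ a * (t ^ b) ^ d = t ^ k" using t by (simp add: power_inverse)
        then show ?thesis unfolding 2 using i by (simp add: s_def mult_ac)
      qed
      have 3: "feval (n - l) G (\<lambda>j. s t (l + j) * ?y x j) = (\<Sum>\<mu>\<in>?I. t ^ (\<Sum>j<n - l. wt j * \<mu> j) * ?\<Psi> \<mu> x)"
        unfolding feval_form[OF G]
        by (rule sum.cong[OF refl])
          (simp add: s_def power_mult_distrib prod.distrib power_sum mult_ac flip: power_mult)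
      show "feval n f (lin n A (\<lambda>i. s t i * lin n B x i)) =
        t ^ k * ?\<Phi> x + (\<Sum>\<mu>\<in>?I. t ^ (\<Sum>j<n - l. wt j * \<mu> j) * ?\<Psi> \<mu> x)"
        unfolding fA 3 sum_distrib_left by (simp add: 1)
    qed
  qed
qed

subsection \<open>Quadratic and linear forms\<close>

lemma form_degree_0_eq_0_iff:
  assumes "form n 0 h"
  shows "h = (\<lambda>_. 0) \<longleftrightarrow> h (\<lambda>_. 0) = 0"
proof
  assume "h (\<lambda>_. 0) = 0"
  then have "h m = 0" for m using assms unfolding form_iff coeff_idx_0 by (metis singletonD)
  then show "h = (\<lambda>_. 0)" by (rule ext)
qed simp

text \<open>One step of orthogonalisation: a vector \<open>v\<close> with f(v) /= 0 splits off its
  line from its orthogonal complement for the polar form \<open>b\<close>.\<close>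

lemma direct_sum_if_quadratic:
  fixes f :: "'k::field form"
  assumes inf: "infinite (UNIV :: 'k set)" and ch: "of_nat (fact (Suc 1)) \<noteq> (0::'k)"
    and f: "form n (Suc 1) f" and ind: "indep_grad n f" and n: "2 \<le> n"
  shows "direct_sum n (Suc 1) f"
proof -
  have "f \<noteq> (\<lambda>_. 0)"
  proof
    assume "f = (\<lambda>_. 0)"
    then have "dv n (\<lambda>_. 1) f = (\<lambda>_. 0)" by simp
    then have "(1::'k) = 0" using ind n unfolding indep_grad_def by (metis less_le_trans zero_less_numeral)
    then show False by simp
  qed
  then obtain v' where v': "feval n f v' \<noteq> 0" using form_eq_0_if_feval_0[OF inf ch f] by blast
  define v where "v = (\<lambda>i. if i < n then v' i else 0)"
  have v: "v \<in> Kn n" "feval n f v \<noteq> 0"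
    using v' feval_cong[of n v v' f] by (auto simp: v_def Kn_def)
  define b where "b w = dv n w (dv n v f) (\<lambda>_. 0)" for w
  have fd: "form n 0 (dv n w (dv n v f))" for w using form_dv[OF form_dv[OF f[unfolded One_nat_def]]] .
  have b0: "dv n w (dv n v f) = (\<lambda>_. 0) \<longleftrightarrow> b w = 0" for w
    unfolding b_def by (rule form_degree_0_eq_0_iff[OF fd])
  have b_add: "b (x + y) = b x + b y" for x y by (simp add: b_def dv_def distrib_right sum.distrib)
  have b_scale: "b (vscale t x) = t * b x" for t x by (simp add: b_def dv_def vscale_def sum_distrib_left mult_ac)
  \<comment> \<open>Otherwise \<open>f\<close> would be affine along \<open>v\<close> through 0,
    with zero value and zero derivative at 0, so f(v) = 0.\<close>
  have bv: "b v \<noteq> 0"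
  proof
    assume "b v = 0"
    then have "dv n v (dv n v f) = (\<lambda>_. 0)" by (simp add: b0)
    from feval_affine_if_dv_dv_0[OF ch f this, of "\<lambda>_. 0" 1]
    have "feval n f v = 0"
      using feval_at_zero[OF f] feval_at_zero[OF form_dv[OF f[unfolded One_nat_def]]] by simp
    with v(2) show False ..
  qed
  define pr where "pr x = x - vscale (b x / b v) v" for x
  let ?W = "{w \<in> Kn n. b w = 0}" and ?U = "range (\<lambda>t. vscale t v)"
  have pr: "pr x \<in> ?W" if "x \<in> Kn n" for x
  proof -
    have "b x = b (pr x) + (b x / b v) * b v"
      using b_add[of "pr x" "vscale (b x / b v) v"] by (simp only: pr_def b_scale diff_add_cancel)
    then have "b (pr x) = 0" using bv by simp
    moreover have "pr x \<in> Kn n" unfolding pr_def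
      by (intro kv.subspace_diff[OF subspace_Kn] kv.subspace_scale[OF subspace_Kn] that v(1))
    ultimately show ?thesis by simp
  qed
  have b_zero: "b 0 = 0" using b_scale[of 0 0] by simp
  have W: "kv.subspace ?W"
    using subspace_Kn[of n] by (auto simp: kv.subspace_def b_add b_scale b_zero)
  have U: "kv.subspace ?U" unfolding kv.span_singleton[symmetric] by (rule kv.subspace_span)
  \<comment> \<open>If the complement were 0, the first two unit vectors would both be multiples of
    \<open>v\<close>.\<close>
  have "\<exists>w0\<in>?W. w0 \<noteq> 0"
  proof (rule ccontr)
    assume "\<not> ?thesis"
    then have all0: "\<forall>w\<in>?W. w = 0" by blast
    have e: "\<exists>t. unit_fun i = vscale t v" if "i < n" for i
    proof -
      have "(unit_fun i :: nat \<Rightarrow> 'k) \<in> Kn n" using that by (auto simp: Kn_def)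
      from all0[rule_format, OF pr[OF this]] show ?thesis unfolding pr_def by (intro exI) simp
    qed
    obtain t0 where t0: "unit_fun 0 = vscale t0 v" using e[of 0] n by auto
    obtain t1 where t1: "unit_fun 1 = vscale t1 v" using e[of 1] n by auto
    have "t0 * v 0 = 1" "t1 * v 0 = 0" "t1 * v 1 = 1"
      using fun_cong[OF t0, of 0] fun_cong[OF t1, of 0] fun_cong[OF t1, of 1] by (simp_all add: vscale_def)
    then show False by auto
  qed
  then obtain w0 where w0: "w0 \<in> ?W" "w0 \<noteq> 0" by blast
  have v_neq: "v \<noteq> 0" using bv b_zero by auto
  show ?thesis
  proof (rule direct_sum_if_orthogonal[OF inf ch f ind U _ _ v_neq W _ w0])
    show "?U \<subseteq> Kn n" using kv.subspace_scale[OF subspace_Kn v(1)] by auto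
    show "v \<in> ?U" by (rule range_eqI[of _ _ 1]) (simp add: vscale_def)
    show "\<exists>u\<in>?U. \<exists>w\<in>?W. x = u + w" if "x \<in> Kn n" for x
    proof (intro bexI)
      show "x = vscale (b x / b v) v + pr x" by (simp add: pr_def)
      show "pr x \<in> ?W" by (rule pr[OF that])
    qed (rule rangeI)
    show "?U \<inter> ?W = {0}"
    proof
      show "?U \<inter> ?W \<subseteq> {0}" using bv by (auto simp: b_scale kv.scale_zero_left)
      show "{0} \<subseteq> ?U \<inter> ?W" using kv.subspace_0[OF U] kv.subspace_0[OF W] by blast
    qed
    show "dv n u (dv n w f) = (\<lambda>_. 0)" if "u \<in> ?U" "w \<in> ?W" for u w
    proof -
      obtain t where t: "u = vscale t v" using \<open>u \<in> ?U\<close> by blast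
      have "dv n w (dv n v f) = (\<lambda>_. 0)" using \<open>w \<in> ?W\<close> b0 by blast
      then have "dv n v (dv n w f) = (\<lambda>_. 0)" by (simp add: dv_commute)
      then show ?thesis unfolding t vscale_def dv_cmult by simp
    qed
  qed auto
qed

text \<open>The partials are constants and span at most a line; a relation between the first two is
  read off from their values.\<close>

lemma linear_form_not_indep_grad:
  fixes f :: "'k::field form"
  assumes f: "form n (Suc 0) f" and n: "2 \<le> n"
  shows "\<not> indep_grad n f"
proof
  assume ind: "indep_grad n f"
  define a where "a i = pderiv_form i f (\<lambda>_. 0)" for i
  have dv0: "dv n c f = (\<lambda>_. 0)" if "(\<Sum>i<n. c i * a i) = 0" for c
    unfolding form_degree_0_eq_0_iff[OF form_dv[OF f]] using that by (simp add: dv_def a_def)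
  let ?c = "\<lambda>i. (if i = 0 then a 1 else 0) + (if i = 1 then - a 0 else 0)"
  have "(\<Sum>i<n. ?c i * a i) = 0"
    using n by (simp add: distrib_right sum.distrib if_distrib[of "\<lambda>x. x * _"] cong: if_cong)
  with dv0 have "dv n ?c f = (\<lambda>_. 0)" .
  then have c: "\<forall>i<n. ?c i = 0" using ind unfolding indep_grad_def by blast
  have "a 0 = 0" using c[rule_format, of 1] n by simp
  then have "(\<Sum>i<n. unit_fun 0 i * a i) = 0"
    using n by (simp add: if_distrib[of "\<lambda>x. x * _"] cong: if_cong)
  from dv0[OF this] have e: "\<forall>i<n. (unit_fun 0 i :: 'k) = 0" using ind unfolding indep_grad_def by blast
  from e[rule_format, of 0] n show False by simp
qed

theorem theorem3p2:
  fixes n d :: nat and f :: "'k::field form"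
  assumes "alg_closed TYPE('k)"
    and "of_nat (fact (d + 1)) \<noteq> (0::'k)"
    and "form n (d + 1) f"
  shows "(concise n (d + 1) f \<longrightarrow>
            ((direct_sum n (d + 1) f \<or> LDS n d f) \<longleftrightarrow> grad_not_injective_at n d f) \<and>
            (grad_not_injective_at n d f \<longleftrightarrow> grad_pos_fiber_dim_at n d f))
       \<and> (semistable n (d + 1) f \<longrightarrow>
            (direct_sum n (d + 1) f \<longleftrightarrow> grad_not_injective_at n d f) \<and>
            (grad_not_injective_at n d f \<longleftrightarrow> grad_pos_fiber_dim_at n d f))"
proof -
  note ac = assms(1)
  note inf = infinite_UNIV_if_alg_closed[OF ac]
  have ch: "of_nat (fact (Suc d)) \<noteq> (0::'k)" unfolding Suc_eq_plus1 by (rule assms(2))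
  have f: "form n (Suc d) f" unfolding Suc_eq_plus1 by (rule assms(3))
  have A: "((direct_sum n (Suc d) f \<or> LDS n d f) \<longleftrightarrow> grad_not_injective_at n d f) \<and>
      (grad_not_injective_at n d f \<longleftrightarrow> grad_pos_fiber_dim_at n d f)" if "concise n (Suc d) f"
  proof -
    note ind = indep_grad_if_concise[OF ch f that]
    have "direct_sum n (Suc d) f \<or> LDS n d f" if ni: "grad_not_injective_at n d f"
    proof -
      obtain g where g: "g \<in> Pc n d" "\<not> same_point f g" "grad_span n g = grad_span n f"
        using ni unfolding grad_not_injective_at_def by blast
      have "form n (Suc d) g" using g(1) by (simp add: Pc_def Pforms_def)
      then show ?thesis
        by (rule direct_sum_or_LDS_if_same_grad_span[OF ac ch f ind _ equalityD1[OF g(3)] g(2)])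
    qed
    then show ?thesis
      using grad_not_injective_if_direct_sum[OF inf ch f ind] grad_not_injective_if_LDS[OF inf ch f ind]
        pos_fiber_dim_if_not_injective[OF inf ch f ind] not_injective_if_pos_fiber_dim[of n d f] by blast
  qed
  \<comment> \<open>Semistability thus reduces the second part to the first, with the LDS
    alternative absorbed by the direct sums.\<close>
  have B: "concise n (Suc d) f \<and> (LDS n d f \<longrightarrow> direct_sum n (Suc d) f)" if ss: "semistable n (Suc d) f"
  proof (intro conjI impI)
    show conc: "concise n (Suc d) f" by (rule concise_if_semistable[OF inf f ss])
    note ind = indep_grad_if_concise[OF ch f conc]
    assume lds: "LDS n d f"
    then have n: "2 \<le> n" unfolding LDS_def by auto
    \<comment> \<open>An LDS form has n >= 2l >= 2. Degree 1 contradicts independence of the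
      partials, in degree 2 the form is a direct sum anyway, and from degree 3 on it is not
      semistable.\<close>
    consider "d = 0" | "d = 1" | "2 \<le> d" by linarith
    then show "direct_sum n (Suc d) f"
    proof cases
      case 1
      then show ?thesis using linear_form_not_indep_grad[of n f] f ind n by simp
    next
      case 2
      then show ?thesis using direct_sum_if_quadratic[OF inf _ _ ind n] ch f by blast
    next
      case 3
      then show ?thesis using not_semistable_if_LDS[OF inf _ lds] ss by blast
    qed
  qed
  show ?thesis unfolding Suc_eq_plus1[symmetric] using A B by blast
qed

end
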